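(* Let $\omega:[0,\infty)\to(0,\infty)$ be a function with $\omega(x)=1$ for $0\le x\le 1$, such that $x\omega(x)$ and $1/\omega(x)$ are increasing positive functions for $x\ge 1$, and $$\int_1^\infty \frac{\omega(x)}{x}\,dx<\infty.$$ Then for $0<H\le 1$ and $T\ge 1$ one has $$\int_T^{T+H}|\zeta(\sigma+it)|\,dt \gg \frac{H^2\,\omega(|\log H|)}{1+|\log H|}$$ for all $\sigma\ge 1-H\,\omega(H\log T)$, where the implied constant depends only on $\omega$.
   Context: $\zeta$ denotes the Riemann zeta-function. *)

theory Defs
  imports "HOL-Complex_Analysis.Complex_Analysis"
begin

text \<open>
  The Riemann zeta function, as the unique holomorphic continuation to the complex plane
  without 1 of the Dirichlet series. The value 0 at the pole is a convention; it only serves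
  to make the description unique.
\<close>

definition zeta :: "complex \<Rightarrow> complex" where
  "zeta = (THE f. f holomorphic_on (- {1}) \<and>
                  (\<forall>s. Re s > 1 \<longrightarrow> f s = (\<Sum>n. 1 / of_nat (Suc n) powr s)) \<and>
                  f 1 = 0)"

end

theory Submission
  imports Defs "HOL-Number_Theory.Prime_Powers"
begin

text \<open>
  The bound holds in the stronger form \<open>\<integral> \<bar>zeta\<bar> \<ge> c H\<^sup>2\<close>. The mollified function
  \<open>G s = zeta s / zeta (s + r H)\<close> with a small constant \<open>r\<close> satisfies \<open>\<bar>G s - 1\<bar> \<le> 12 r H / (Re s - 1)\<close>
  to the right of 1, because \<open>log zeta\<close> has nonnegative coefficients. Since \<open>1 / zeta (s + r H)\<close> is
  at most of order \<open>1 / (r H)\<close> on the line \<open>Re s = \<sigma>\<close>, it suffices to bound the mean of \<open>\<bar>G\<bar>\<close> on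
  the segment from below by a constant. As \<open>zeta\<close> has no zeros to the right of 1, comparing it with its
  reflection in a line \<open>Re s = \<beta> > 1\<close> gives \<open>\<bar>G\<bar> \<le> C exp (2 r X)\<close> for \<open>Re s \<ge> 1 - r H / 4\<close>, where \<open>X = H ln T\<close>.

  If \<open>X\<close> is bounded, a two-constants argument finishes the proof. If \<open>X\<close> is large, average \<open>G\<close>
  successively over vertical windows with a kernel whose contour can be shifted to the right; an
  average on the scale \<open>w\<close> over a window of length \<open>w ln Y\<close> removes a bound of size \<open>exp Y\<close> and leaves
  one of size \<open>1 / w\<close>. On the scales \<open>w = \<omega> (Y)\<close> with \<open>Y = R\<^sup>2, R\<^sup>4, R\<^sup>8, \<dots>\<close> the windows fit into
  the unit interval because \<open>\<omega> x / x\<close> is integrable, and the last average is close to 1.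
\<close>

subsection \<open>Analytic continuation of the zeta function\<close>

text \<open>In the coordinate \<open>s = 1 + \<i> T + H z\<close> the bound for \<open>G - 1\<close>
  is \<open>12 r / Re z\<close>, free of \<open>H\<close>, and everything takes place in a strip of
  height 1 where only \<open>X\<close> enters. One factor \<open>H\<close> of the result is the
  length of the segment, the other is the lower bound of order \<open>r H\<close> for
  \<open>zeta (s + r H)\<close>.

  The obstacle is a bound as large as \<open>exp (3 X)\<close> on a line \<open>Re z = v\<close> to
  the left of 0. An average on the scale \<open>w\<close> needs
  \<open>\<bar>v\<bar> \<le> w\<close>, because the decay of the kernel is secured across a strip of
  width \<open>2 w\<close>. So the start is at a scale no smaller than \<open>\<omega> X\<close>,
  and what is left, of size \<open>1 / w\<close>, may still be unbounded in \<open>X\<close>. This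
  forces the repetition on larger scales. Monotonicity of \<open>x * \<omega> x\<close> gives
  \<open>1 / \<omega> Y \<le> Y\<close>, far below the \<open>exp (3 Y)\<close> that the next step
  removes. The lengths fit because of the squaring:
  \<open>ln (Y\<^sup>2) = 2 * (ln (Y\<^sup>2) - ln Y)\<close>, and as \<open>\<omega>\<close>
  decreases, \<open>\<omega> (Y\<^sup>2) * ln (Y\<^sup>2)\<close> is at most twice the integral of
  \<open>\<omega> x / x\<close> from \<open>Y\<close> to \<open>Y\<^sup>2\<close>.\<close>

lemma taylor_powr_nat:
  fixes a :: complex and n k :: nat
  assumes n: "n > 0" and a: "Re a \<le> real k + 1"
  shows "norm (of_nat (Suc n) powr a - (\<Sum>j\<le>k. (a gchoose j) * of_nat n powr (a - of_nat j)))
           \<le> norm (\<Prod>i<Suc k. a - of_nat i) * real n powr (Re a - real k - 1)"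
proof -
  define S where "S = closed_segment (of_nat n :: complex) (of_nat (Suc n))"
  \<comment> \<open>\<open>f i\<close> is the \<open>i\<close>-th derivative of
    \<open>z powr a\<close>. The step from \<open>n\<close> to \<open>n + 1\<close> has length 1, so
    the Taylor terms are exactly the binomial terms of the statement.\<close>
  define f where "f = (\<lambda>i (z::complex). (\<Prod>l<i. a - of_nat l) * z powr (a - of_nat i))"
  have S: "\<exists>x. z = of_real x \<and> real n \<le> x" if "z \<in> S" for z
  proof -
    have "z \<in> closed_segment (of_real (real n)) (of_real (real (Suc n)))"
      using that by (simp add: S_def)
    then obtain x where "z = of_real x" "x \<in> closed_segment (real n) (real (Suc n))"
      using closed_segment_of_real[of "real n" "real (Suc n)"] by (metis imageE)
    then show ?thesis by (auto simp: closed_segment_eq_real_ivl)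
  qed
  have "norm (f 0 (of_nat (Suc n)) - (\<Sum>i\<le>k. f i (of_nat n) * (of_nat (Suc n) - of_nat n) ^ i / fact i))
      \<le> norm (\<Prod>i<Suc k. a - of_nat i) * real n powr (Re a - real k - 1) *
          norm (of_nat (Suc n) - of_nat n :: complex) ^ Suc k / fact k"
  proof (rule complex_Taylor)
    show "convex S" by (simp add: S_def)
    show "of_nat n \<in> S" "of_nat (Suc n) \<in> S" by (auto simp: S_def)
    show "(f i has_field_derivative f (Suc i) x) (at x within S)" if x: "x \<in> S" for i x
    proof -
      obtain r where r: "x = of_real r" "real n \<le> r" using S[OF x] by blast
      then have "x \<notin> \<real>\<^sub>\<le>\<^sub>0" using n by auto
      note D = DERIV_cmult[OF has_field_derivative_powr[OF this, of "a - of_nat i"], of "\<Prod>l<i. a - of_nat l"]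
      have "(f i has_field_derivative f (Suc i) x) (at x)"
        unfolding f_def using D by (simp add: mult.assoc diff_diff_eq add.commute)
      then show ?thesis by (rule has_field_derivative_at_within)
    qed
    \<comment> \<open>By hypothesis the exponent \<open>Re a - k - 1\<close> is nonpositive, so on
      the segment the modulus is largest at the left end \<open>n\<close>.\<close>
    show "norm (f (Suc k) x) \<le> norm (\<Prod>i<Suc k. a - of_nat i) * real n powr (Re a - real k - 1)"
      if x: "x \<in> S" for x
    proof -
      obtain r where r: "x = of_real r" "real n \<le> r" using S[OF x] by blast
      have "norm (x powr (a - of_nat (Suc k))) = r powr (Re a - real k - 1)"
        using r n by (simp add: norm_powr_real_powr algebra_simps)
      also have "\<dots> \<le> real n powr (Re a - real k - 1)"
        using r n a by (intro powr_mono2') auto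
      finally show ?thesis
        unfolding f_def norm_mult by (intro mult_left_mono) auto
    qed
  qed
  also have "(\<lambda>i. f i (of_nat n) * (of_nat (Suc n) - of_nat n) ^ i / fact i)
       = (\<lambda>i. (a gchoose i) * of_nat n powr (a - of_nat i))"
    by (simp add: f_def gbinomial_prod_rev atLeast0LessThan)
  also have "norm (\<Prod>i<Suc k. a - of_nat i) * real n powr (Re a - real k - 1) *
          norm (of_nat (Suc n) - of_nat n :: complex) ^ Suc k / fact k
        \<le> norm (\<Prod>i<Suc k. a - of_nat i) * real n powr (Re a - real k - 1)"
  proof -
    have "x / fact k \<le> x" if "x \<ge> 0" for x :: real
      using that by (simp add: divide_le_eq mult_le_cancel_left1)
    from this[of "norm (\<Prod>i<Suc k. a - of_nat i) * real n powr (Re a - real k - 1)"]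
    show ?thesis by (simp del: prod.lessThan_Suc)
  qed
  finally show ?thesis by (simp add: f_def)
qed

text \<open>
  Summing the Taylor expansion of \<open>(N + 1) powr (1 - s) - N powr (1 - s)\<close> over \<open>N\<close> telescopes on
  the left and produces \<open>zeta (s + j - 1)\<close> on the right. Hence \<open>(s - 1) * zeta s\<close> is expressed
  by the values at \<open>s + 1, s + 2, \<dots>\<close> and a remainder that converges further to the left,
  which gives the continuation one unit at a time.
\<close>

definition telescope_rem :: "nat \<Rightarrow> nat \<Rightarrow> complex \<Rightarrow> complex" where
  "telescope_rem k n s = of_nat (Suc (Suc n)) powr (1 - s)
      - (\<Sum>j\<le>k. ((1 - s) gchoose j) * of_nat (Suc n) powr (1 - s - of_nat j))"

lemma norm_telescope_rem_le:
  assumes "Re s \<ge> - real k"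
  shows "norm (telescope_rem k n s) \<le> norm (\<Prod>i<Suc k. 1 - s - of_nat i) * real (Suc n) powr (- Re s - real k)"
  using taylor_powr_nat[of "Suc n" "1 - s" k] assms by (simp add: telescope_rem_def algebra_simps)

lemma summable_Suc_powr: "summable (\<lambda>n. real (Suc n) powr x) \<longleftrightarrow> x < -1"
  by (subst summable_Suc_iff) (rule summable_real_powr_iff)

lemma holomorphic_telescope_rem [holomorphic_intros]: "telescope_rem k n holomorphic_on A"
  unfolding telescope_rem_def gbinomial_prod_rev
  by (intro holomorphic_intros) (auto simp: of_nat_neq_0 simp del: of_nat_Suc)

lemma telescope_rem_sums:
  obtains g where "g holomorphic_on {s. Re s > 1 - real k}"
    "\<And>s. Re s > 1 - real k \<Longrightarrow> (\<lambda>n. telescope_rem k n s) sums g s"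
proof -
  let ?S = "{s. Re s > 1 - real k}"
  have op: "open ?S" by (simp add: open_halfspace_Re_gt)
  obtain g where g: "\<forall>x\<in>?S. (\<lambda>n. telescope_rem k n x) sums g x \<and> g field_differentiable (at x)"
  proof (rule series_differentiable_comparison_complex[OF op])
    show "telescope_rem k n field_differentiable at x" for n x
      using holomorphic_telescope_rem[of k n UNIV]
      by (simp add: holomorphic_on_imp_differentiable_at)
  next
    fix s assume s: "s \<in> ?S"
    \<comment> \<open>Half the distance from \<open>s\<close> to the line
      \<open>Re s = 1 - k\<close>: on this disc the exponent \<open>- Re y - k\<close> stays
      uniformly below \<open>-1\<close>, and compactness bounds the polynomial prefactor. This gives
      the majorant \<open>h\<close>.\<close>
    define d where "d = (Re s + real k - 1) / 2"
    have d: "d > 0" using s by (simp add: d_def)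
    define p where "p = (\<lambda>z. norm (\<Prod>i<Suc k. 1 - z - of_nat i :: complex))"
    have "compact (p ` cball s d)"
      unfolding p_def by (intro compact_continuous_image continuous_intros compact_cball)
    then obtain C where C: "\<And>z. z \<in> cball s d \<Longrightarrow> p z \<le> C"
      by (meson bounded_imp_bdd_above compact_imp_bounded bdd_above.unfold imageI)
    have C0: "C \<ge> 0" using C[of s] d by (auto simp: p_def intro: order_trans[OF norm_ge_zero])
    define h where "h = (\<lambda>n. of_real (C * real (Suc n) powr (- (Re s - d) - real k)) :: complex)"
    have "- (Re s - d) - real k < -1" using s by (simp add: d_def field_simps)
    then have "summable (\<lambda>n. real (Suc n) powr (- (Re s - d) - real k))"
      by (subst summable_Suc_powr)
    then have "summable h"
      unfolding h_def by (intro summable_of_real summable_mult)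
    moreover have "range h \<subseteq> \<real>\<^sub>\<ge>\<^sub>0" using C0 by (auto simp: h_def)
    moreover have "norm (telescope_rem k n y) \<le> norm (h n)" if "y \<in> ball s d \<inter> ?S" for n y
    proof -
      have "\<bar>Re y - Re s\<bar> \<le> norm (y - s)" by (metis abs_Re_le_cmod minus_complex.sel(1))
      also have "\<dots> < d" using that by (simp add: dist_norm norm_minus_commute)
      finally have y: "Re y \<ge> Re s - d" by linarith
      have "norm (telescope_rem k n y) \<le> p y * real (Suc n) powr (- Re y - real k)"
        unfolding p_def using that by (intro norm_telescope_rem_le) auto
      also have "\<dots> \<le> C * real (Suc n) powr (- (Re s - d) - real k)"
        using C[of y] that C0 y by (intro mult_mono powr_mono) auto
      also have "\<dots> = norm (h n)"
        using C0 by (simp add: h_def norm_mult del: of_real_mult)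
      finally show ?thesis .
    qed
    ultimately show "\<exists>d h. 0 < d \<and> summable (h :: nat \<Rightarrow> complex) \<and> range h \<subseteq> \<real>\<^sub>\<ge>\<^sub>0 \<and>
        (\<forall>\<^sub>F n in sequentially. \<forall>y\<in>ball s d \<inter> ?S. norm (telescope_rem k n y) \<le> norm (h n))"
      using d by (intro exI[of _ d] exI[of _ h] conjI always_eventually allI ballI) auto
  qed
  show ?thesis
    by (rule that[of g]) (use g op in \<open>auto simp: holomorphic_on_open field_differentiable_def\<close>)
qed

definition zeta_series :: "complex \<Rightarrow> complex" where
  "zeta_series s = (\<Sum>n. 1 / of_nat (Suc n) powr s)"

lemma norm_inverse_powr: "norm (1 / of_nat (Suc n) powr s :: complex) = real (Suc n) powr (- Re s)"
  by (simp add: norm_divide norm_powr_real_powr powr_minus divide_simps del: of_nat_Suc)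

lemma zeta_series_sums:
  assumes "Re s > 1"
  shows "(\<lambda>n. 1 / of_nat (Suc n) powr s) sums zeta_series s"
proof -
  have "summable (\<lambda>n. norm (1 / of_nat (Suc n) powr s :: complex))"
    unfolding norm_inverse_powr using assms by (subst summable_Suc_powr) auto
  from summable_sums[OF summable_norm_cancel[OF this]] show ?thesis unfolding zeta_series_def .
qed

lemma tendsto_powr_nat_0:
  assumes "Re a < 0"
  shows "(\<lambda>n. of_nat (Suc n) powr a :: complex) \<longlonglongrightarrow> 0"
proof (rule tendsto_norm_zero_cancel)
  have "(\<lambda>n. real (Suc n) powr Re a) \<longlonglongrightarrow> 0"
    using assms by (intro LIMSEQ_Suc tendsto_neg_powr filterlim_real_sequentially)
  then show "(\<lambda>n. norm (of_nat (Suc n) powr a :: complex)) \<longlonglongrightarrow> 0"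
    by (simp add: norm_powr_real_powr del: of_nat_Suc)
qed

text \<open>The term \<open>j = 0\<close> completes the telescoping difference; the term
  \<open>j = 1\<close> is \<open>(1 - s) * zeta_series s\<close> and accounts for
  \<open>(s - 1) * zeta_series s\<close>. The other terms only involve arguments at least one unit
  to the right of \<open>s\<close>.\<close>

lemma telescope_rem_sums_zeta_series:
  assumes s: "Re s > 1" and k: "k \<ge> 1"
  shows "(\<lambda>n. telescope_rem k n s) sums
     ((s - 1) * zeta_series s - 1 - (\<Sum>j=2..k. ((1 - s) gchoose j) * zeta_series (s + of_nat j - 1)))"
proof -
  define a where "a = 1 - s"
  have tel: "(\<lambda>n. of_nat (Suc (Suc n)) powr a - of_nat (Suc n) powr a) sums (0 - of_nat (Suc 0) powr a)"
    by (rule telescope_sums) (rule tendsto_powr_nat_0, use s in \<open>simp add: a_def\<close>)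
  have "(\<lambda>n. (a gchoose j) * of_nat (Suc n) powr (a - of_nat j)) sums ((a gchoose j) * zeta_series (s + of_nat j - 1))"
    if "j \<ge> 1" for j
  proof -
    have "(\<lambda>n. 1 / of_nat (Suc n) powr (s + of_nat j - 1)) sums zeta_series (s + of_nat j - 1)"
      using s that by (intro zeta_series_sums) auto
    moreover have "1 / of_nat (Suc n) powr (s + of_nat j - 1) = of_nat (Suc n) powr (a - of_nat j)" for n
    proof -
      have "a - of_nat j = - (s + of_nat j - 1)" by (simp add: a_def)
      then show ?thesis by (simp only: powr_minus divide_inverse mult_1)
    qed
    ultimately show ?thesis by (intro sums_mult) simp
  qed
  then have "(\<lambda>n. \<Sum>j=1..k. (a gchoose j) * of_nat (Suc n) powr (a - of_nat j)) sums
      (\<Sum>j=1..k. (a gchoose j) * zeta_series (s + of_nat j - 1))"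
    by (intro sums_sum) auto
  from sums_diff[OF tel this]
  have "(\<lambda>n. of_nat (Suc (Suc n)) powr a - of_nat (Suc n) powr a
        - (\<Sum>j=1..k. (a gchoose j) * of_nat (Suc n) powr (a - of_nat j)))
     sums (- 1 - (\<Sum>j=1..k. (a gchoose j) * zeta_series (s + of_nat j - 1)))"
    by simp
  moreover have "telescope_rem k n s = of_nat (Suc (Suc n)) powr a - of_nat (Suc n) powr a
        - (\<Sum>j=1..k. (a gchoose j) * of_nat (Suc n) powr (a - of_nat j))" for n
  proof -
    have "{..k} = insert 0 {1..k}" by auto
    then show ?thesis by (simp add: telescope_rem_def a_def)
  qed
  moreover have "(\<Sum>j=1..k. (a gchoose j) * zeta_series (s + of_nat j - 1))
      = a * zeta_series s + (\<Sum>j=2..k. (a gchoose j) * zeta_series (s + of_nat j - 1))"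
  proof -
    have "{1..k} = insert 1 {2..k}" using k by auto
    then show ?thesis by simp
  qed
  moreover have "- 1 - (a * zeta_series s + x) = (s - 1) * zeta_series s - 1 - x" for x
    by (simp add: a_def algebra_simps)
  ultimately show ?thesis by (simp only: a_def)
qed

text \<open>The binomial coefficient cancels the pole of \<open>zeta (s + j - 1)\<close>.\<close>

lemma gbinomial_zeta_series:
  assumes "Re s > 1" "j \<ge> 2"
  shows "((1 - s) gchoose j) * zeta_series (s + of_nat j - 1) =
     - ((\<Prod>i<j - 1. 1 - s - of_nat i) / fact j) * ((s + of_nat j - 1 - 1) * zeta_series (s + of_nat j - 1))"
proof -
  obtain i where j: "j = Suc i" using assms(2) by (cases j) auto
  have "1 - s - of_nat i = - (s + of_nat j - 1 - 1)" by (simp add: j)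
  then have "((1 - s) gchoose j) = (\<Prod>i<j - 1. 1 - s - of_nat i) * (- (s + of_nat j - 1 - 1)) / fact j"
    by (simp add: j gbinomial_prod_rev atLeast0LessThan)
  then show ?thesis by (simp only: times_divide_eq_left mult_minus_left mult_minus_right mult.assoc minus_divide_left)
qed

text \<open>Induction on \<open>m\<close>: one more unit to the left uses the previous continuation
  only at \<open>s + 1, s + 2, ...\<close>. The factor \<open>s - 1\<close> keeps the pole out of
  all functions involved.\<close>

lemma zeta_continuation_halfplane:
  "\<exists>g. g holomorphic_on {s. Re s > 1 - real m} \<and> (\<forall>s. Re s > 1 \<longrightarrow> g s = (s - 1) * zeta_series s)"
proof (induction m)
  case 0
  \<comment> \<open>The base case also goes through the remainder, with \<open>k = 1\<close>, so
    that holomorphy of the Dirichlet series comes as a by-product.\<close>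
  obtain g where g: "g holomorphic_on {s. Re s > 1 - real 1}"
    "\<And>s. Re s > 1 - real 1 \<Longrightarrow> (\<lambda>n. telescope_rem 1 n s) sums g s"
    using telescope_rem_sums[of 1] by blast
  have "g s + 1 = (s - 1) * zeta_series s" if "Re s > 1" for s
  proof -
    have "(\<lambda>n. telescope_rem 1 n s) sums ((s - 1) * zeta_series s - 1)"
      using telescope_rem_sums_zeta_series[of s 1] that by simp
    moreover have "(\<lambda>n. telescope_rem 1 n s) sums g s" using g(2) that by simp
    ultimately show ?thesis using sums_unique2 by fastforce
  qed
  moreover have "(\<lambda>s. g s + 1) holomorphic_on {s. Re s > 1 - real 0}"
    by (intro holomorphic_intros holomorphic_on_subset[OF g(1)]) auto
  ultimately show ?case by (intro exI[of _ "\<lambda>s. g s + 1"]) auto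
next
  case (Suc m)
  then obtain g where g: "g holomorphic_on {s. Re s > 1 - real m}"
    "\<And>s. Re s > 1 \<Longrightarrow> g s = (s - 1) * zeta_series s" by blast
  obtain q where q: "q holomorphic_on {s. Re s > 1 - real (Suc m)}"
    "\<And>s. Re s > 1 - real (Suc m) \<Longrightarrow> (\<lambda>n. telescope_rem (Suc m) n s) sums q s"
    using telescope_rem_sums[of "Suc m"] by blast
  define G where "G = (\<lambda>s. q s + 1 + (\<Sum>j=2..Suc m.
     - ((\<Prod>i<j - 1. 1 - s - of_nat i) / fact j) * g (s + of_nat j - 1)))"
  have "(\<lambda>s. g (s + of_nat j - 1)) holomorphic_on {s. Re s > 1 - real (Suc m)}" if "j \<ge> 2" for j
  proof -
    have "g \<circ> (\<lambda>s. s + of_nat j - 1) holomorphic_on {s. Re s > 1 - real (Suc m)}"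
      by (rule holomorphic_on_compose_gen[OF _ g(1)]) (use that in \<open>auto intro!: holomorphic_intros\<close>)
    then show ?thesis by (simp add: o_def)
  qed
  then have "G holomorphic_on {s. Re s > 1 - real (Suc m)}"
    unfolding G_def by (intro holomorphic_intros q(1)) auto
  moreover have "G s = (s - 1) * zeta_series s" if s: "Re s > 1" for s
  proof -
    have "q s = (s - 1) * zeta_series s - 1 - (\<Sum>j=2..Suc m. ((1 - s) gchoose j) * zeta_series (s + of_nat j - 1))"
      using telescope_rem_sums_zeta_series[OF s, of "Suc m"] q(2)[of s] s sums_unique2 by force
    moreover have "((1 - s) gchoose j) * zeta_series (s + of_nat j - 1)
       = - ((\<Prod>i<j - 1. 1 - s - of_nat i) / fact j) * g (s + of_nat j - 1)" if "j \<in> {2..Suc m}" for j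
      using that s by (subst gbinomial_zeta_series[OF s]; (subst g(2))?) auto
    then have "(\<Sum>j=2..Suc m. ((1 - s) gchoose j) * zeta_series (s + of_nat j - 1))
       = (\<Sum>j=2..Suc m. - ((\<Prod>i<j - 1. 1 - s - of_nat i) / fact j) * g (s + of_nat j - 1))"
      by (intro sum.cong refl)
    moreover have "y - 1 - x + 1 + x = y" for x y :: complex by simp
    ultimately show ?thesis unfolding G_def by (simp only:)
  qed
  ultimately show ?case by blast
qed

lemma half_plane_unique:
  assumes "f holomorphic_on {s. Re s > c}" "g holomorphic_on {s. Re s > c}" "c \<le> 1"
    "\<And>s. Re s > 1 \<Longrightarrow> f s = g s" "Re s > c"
  shows "f s = g s"
proof -
  let ?S = "{s. Re s > c}"
  have "f s - g s = 0"
  proof (rule analytic_continuation[of "\<lambda>s. f s - g s" ?S "{s. Re s > 1}" 2])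
    show "open ?S" by (simp add: open_halfspace_Re_gt)
    show "connected ?S" by (intro convex_connected convex_halfspace_Re_gt)
    show "2 islimpt {s. Re s > 1}"
      by (intro interior_limit_point interiorI[of "{s. Re s > 1}"]) (auto simp: open_halfspace_Re_gt)
  qed (use assms in \<open>auto intro!: holomorphic_intros\<close>)
  then show ?thesis by simp
qed

lemma zeta_exists:
  "\<exists>f. f holomorphic_on (- {1}) \<and> (\<forall>s. Re s > 1 \<longrightarrow> f s = zeta_series s) \<and> f 1 = 0"
proof -
  obtain g where g: "\<And>m. g m holomorphic_on {s. Re s > 1 - real m}"
    "\<And>m s. Re s > 1 \<Longrightarrow> g m s = (s - 1) * zeta_series s"
    using zeta_continuation_halfplane by metis
  have eq: "g m s = g m' s" if "m \<le> m'" "Re s > 1 - real m" for m m' s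
    by (rule half_plane_unique[OF g(1) holomorphic_on_subset[OF g(1)]]) (use that g(2) in auto)
  \<comment> \<open>The index varies with \<open>s\<close> and always satisfies
    \<open>Re s > 1 - m\<close>; by \<open>eq\<close> every other admissible index gives the same
    value.\<close>
  define Z where "Z = (\<lambda>s. g (nat \<lceil>2 - Re s\<rceil>) s)"
  have Z: "Z s = g m s" if "Re s > 1 - real m" for s m
  proof -
    have "Re s > 1 - real (nat \<lceil>2 - Re s\<rceil>)" by linarith
    then show ?thesis unfolding Z_def using eq that by (metis nle_le)
  qed
  have "Z holomorphic_on UNIV"
  proof -
    have "Z field_differentiable at s" for s
    proof -
      define m where "m = nat \<lceil>2 - Re s\<rceil>"
      have s: "Re s > 1 - real m" unfolding m_def by linarith
      have "Z holomorphic_on {s. Re s > 1 - real m}"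
        using g(1)[of m] by (rule holomorphic_transform) (use Z in auto)
      then show ?thesis
        using s by (auto intro!: holomorphic_on_imp_differentiable_at simp: open_halfspace_Re_gt)
    qed
    then show ?thesis by (simp add: holomorphic_on_def)
  qed
  then have Zh: "Z holomorphic_on A" for A using holomorphic_on_subset by blast
  define f where "f = (\<lambda>s. if s = 1 then 0 else Z s / (s - 1))"
  have "f holomorphic_on (- {1})"
  proof -
    have "(\<lambda>s. Z s / (s - 1)) holomorphic_on (- {1})" by (intro holomorphic_intros Zh) auto
    then show ?thesis by (rule holomorphic_transform) (auto simp: f_def)
  qed
  moreover have "f s = zeta_series s" if "Re s > 1" for s
    using Z[of 0 s] g(2)[of s 0] that by (auto simp: f_def)
  ultimately show ?thesis by (intro exI[of _ f]) (auto simp: f_def)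
qed

lemma zeta_holomorphic': "zeta holomorphic_on (- {1})"
  and zeta_eq_zeta_series: "Re s > 1 \<Longrightarrow> zeta s = zeta_series s"
proof -
  let ?P = "\<lambda>f. f holomorphic_on (- {1}) \<and> (\<forall>s. Re s > 1 \<longrightarrow> f s = zeta_series s) \<and> f 1 = 0"
  have "\<exists>!f. ?P f"
  proof (rule ex_ex1I[OF zeta_exists])
    fix f g assume f: "?P f" and g: "?P g"
    have "f s - g s = 0" if "s \<noteq> 1" for s
    proof (rule analytic_continuation[of "\<lambda>s. f s - g s" "- {1}" "{s. Re s > 1}" 2])
      show "connected (- {1::complex})"
        by (simp add: connected_punctured_universe)
      show "2 islimpt {s. Re s > 1}"
        by (intro interior_limit_point interiorI[of "{s. Re s > 1}"]) (auto simp: open_halfspace_Re_gt)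
    qed (use f g that in \<open>auto intro!: holomorphic_intros\<close>)
    then have "f s = g s" for s using f g by (cases "s = 1") auto
    then show "f = g" by blast
  qed
  moreover have "zeta = (THE f. ?P f)" by (simp add: zeta_def zeta_series_def)
  ultimately have "?P zeta" using theI'[of ?P] by simp
  then show "zeta holomorphic_on (- {1})" "Re s > 1 \<Longrightarrow> zeta s = zeta_series s" by auto
qed

lemma zeta_holomorphic [holomorphic_intros]: "1 \<notin> A \<Longrightarrow> zeta holomorphic_on A"
  by (rule holomorphic_on_subset[OF zeta_holomorphic']) auto

text \<open>For \<open>k = 1\<close> the remainder carries the prefactor
  \<open>(1 - s) * (- s)\<close>, and for \<open>Re s \<ge> 1/2\<close> its terms decay like
  \<open>n powr (- (3/2))\<close>. After division by \<open>s - 1\<close> this is linear growth of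
  \<open>zeta\<close>, hence a logarithm of order \<open>ln T\<close> in the reflection
  argument.\<close>

lemma norm_zeta_le:
  assumes s: "Re s \<ge> 1/2" "s \<noteq> 1"
  shows "norm ((s - 1) * zeta s) \<le> 1 + norm s * norm (s - 1) * (\<Sum>n. real (Suc n) powr (- (3/2)))"
proof -
  obtain g where g: "g holomorphic_on {s. Re s > 1 - real 1}"
    "\<And>s. Re s > 1 - real 1 \<Longrightarrow> (\<lambda>n. telescope_rem 1 n s) sums g s"
    using telescope_rem_sums[of 1] by blast
  define Z where "Z = (\<lambda>s. if s = 1 then g 1 + 1 else (s - 1) * zeta s)"
  have eq: "g s + 1 = (s - 1) * zeta s" if "Re s > 1" for s
  proof -
    have "(\<lambda>n. telescope_rem 1 n s) sums ((s - 1) * zeta_series s - 1)"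
      using telescope_rem_sums_zeta_series[of s 1] that by simp
    moreover have "(\<lambda>n. telescope_rem 1 n s) sums g s" using g(2) that by simp
    ultimately show ?thesis using sums_unique2 zeta_eq_zeta_series[OF that] by fastforce
  qed
  have "g s + 1 - (s - 1) * zeta s = 0"
  proof (rule analytic_continuation[of "\<lambda>s. g s + 1 - (s - 1) * zeta s" "{s. Re s > 0} - {1}" "{s. Re s > 1}" 2])
    show "connected ({s. Re s > 0} - {1})"
      by (intro connected_open_delete convex_connected convex_halfspace_Re_gt)
         (auto simp: open_halfspace_Re_gt)
    show "open ({s. Re s > 0} - {1})" by (intro open_delete) (simp add: open_halfspace_Re_gt)
    show "2 islimpt {s. Re s > 1}"
      by (intro interior_limit_point interiorI[of "{s. Re s > 1}"]) (auto simp: open_halfspace_Re_gt)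
  qed (use s eq in \<open>auto intro!: holomorphic_intros holomorphic_on_subset[OF g(1)]\<close>)
  then have *: "(s - 1) * zeta s = g s + 1" by simp
  have sm: "summable (\<lambda>n. real (Suc n) powr (- (3/2)))" by (subst summable_Suc_powr) auto
  have "norm (telescope_rem 1 n s) \<le> norm s * norm (s - 1) * real (Suc n) powr (- (3/2))" for n
  proof -
    have "norm (telescope_rem 1 n s) \<le> norm (\<Prod>i<Suc 1. 1 - s - of_nat i) * real (Suc n) powr (- Re s - real 1)"
      using s by (intro norm_telescope_rem_le) auto
    also have "norm (\<Prod>i<Suc 1. 1 - s - of_nat i) = norm s * norm (s - 1)"
      by (simp add: norm_mult norm_minus_commute)
    also have "real (Suc n) powr (- Re s - real 1) \<le> real (Suc n) powr (- (3/2))"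
      using s by (intro powr_mono) auto
    finally show ?thesis by (simp add: mult_left_mono)
  qed
  then have "norm (g s) \<le> (\<Sum>n. norm s * norm (s - 1) * real (Suc n) powr (- (3/2)))"
    using g(2)[of s] s sm
    by (subst sums_unique[OF g(2)]) (auto intro!: norm_suminf_le summable_mult)
  also have "\<dots> = norm s * norm (s - 1) * (\<Sum>n. real (Suc n) powr (- (3/2)))"
    using sm by (rule suminf_mult)
  finally show ?thesis unfolding * using norm_triangle_ineq[of "g s" 1] by simp
qed

subsection \<open>The zeta function to the right of 1\<close>

text \<open>Coefficients bounded by 1 cover both applications: the constant 1 for
  \<open>zeta\<close> and \<open>log_zeta_coeff\<close> for its logarithm.\<close>

lemma dirichlet_series_deriv:
  fixes a :: "nat \<Rightarrow> complex"
  assumes a: "\<And>n. norm (a n) \<le> 1"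
  shows "\<exists>g g'. \<forall>s\<in>{s. Re s > 1}. (\<lambda>n. a n / of_nat (Suc n) powr s) sums g s \<and>
           (\<lambda>n. - (a n * of_real (ln (real (Suc n)))) / of_nat (Suc n) powr s) sums g' s \<and>
           (g has_field_derivative g' s) (at s)"
proof (rule series_and_derivative_comparison_complex)
  show "open {s. Re s > 1}" by (simp add: open_halfspace_Re_gt)
  fix n s
  have "((\<lambda>s. a n * of_nat (Suc n) powr (- s)) has_field_derivative
      a n * (Ln (of_nat (Suc n)) * of_nat (Suc n) powr (- s) * - 1)) (at s)"
    by (intro DERIV_cmult DERIV_chain2[OF has_field_derivative_powr_right DERIV_minus[OF DERIV_ident]])
       (simp del: of_nat_Suc)
  moreover have "Ln (of_nat (Suc n)) = of_real (ln (real (Suc n)))"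
    by (rule Ln_of_nat) simp
  ultimately show "((\<lambda>s. a n / of_nat (Suc n) powr s) has_field_derivative
     - (a n * of_real (ln (real (Suc n)))) / of_nat (Suc n) powr s) (at s)"
    by (simp add: powr_minus divide_inverse ac_simps del: of_nat_Suc)
next
  fix s assume s: "s \<in> {s. Re s > 1}"
  define d where "d = (Re s - 1) / 2"
  have d: "d > 0" using s by (simp add: d_def)
  define h where "h = (\<lambda>n. of_real (real (Suc n) powr (- (Re s - d))) :: complex)"
  have "- (Re s - d) < -1" using s by (simp add: d_def field_simps)
  then have "summable h"
    unfolding h_def by (intro summable_of_real) (subst summable_Suc_powr)
  moreover have "range h \<subseteq> \<real>\<^sub>\<ge>\<^sub>0" by (auto simp: h_def)
  moreover have "norm (a n / of_nat (Suc n) powr y) \<le> norm (h n)" if "y \<in> ball s d \<inter> {s. Re s > 1}" for n y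
  proof -
    have "\<bar>Re y - Re s\<bar> \<le> norm (y - s)" by (metis abs_Re_le_cmod minus_complex.sel(1))
    also have "\<dots> < d" using that by (simp add: dist_norm norm_minus_commute)
    finally have y: "Re y \<ge> Re s - d" by linarith
    have "norm (a n / of_nat (Suc n) powr y) = norm (a n) * norm (1 / of_nat (Suc n) powr y :: complex)"
      by (simp add: norm_divide)
    also have "\<dots> \<le> 1 * real (Suc n) powr (- (Re s - d))"
      unfolding norm_inverse_powr using y a by (intro mult_mono powr_mono) auto
    finally show ?thesis by (simp add: h_def del: of_nat_Suc)
  qed
  ultimately show "\<exists>d h. 0 < d \<and> summable (h :: nat \<Rightarrow> complex) \<and> range h \<subseteq> \<real>\<^sub>\<ge>\<^sub>0 \<and>
        (\<forall>\<^sub>F n in sequentially. \<forall>y\<in>ball s d \<inter> {s. Re s > 1}. norm (a n / of_nat (Suc n) powr y) \<le> norm (h n))"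
    using d by (intro exI[of _ d] exI[of _ h] conjI always_eventually allI ballI) auto
qed

section \<open>The logarithm of zeta as a Dirichlet series\<close>

lemma mangoldt_le_ln: "n > 0 \<Longrightarrow> mangoldt n \<le> ln (real n)"
proof -
  assume n: "n > 0"
  have "mangoldt n \<le> (\<Sum>d | d dvd n. mangoldt d :: real)"
    using n by (intro member_le_sum) (auto intro: mangoldt_nonneg)
  then show ?thesis using mangoldt_sum[of n, where 'a = real] n by simp
qed

lemma summable_mangoldt:
  assumes "Re s > 1"
  shows "summable (\<lambda>n. norm (mangoldt (Suc n) / of_nat (Suc n) powr s :: complex))"
proof (rule summable_comparison_test')
  define d where "d = (Re s - 1) / 2"
  have d: "d > 0" using assms by (simp add: d_def)
  have "- Re s + d < - 1" using assms by (simp add: d_def field_simps)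
  then show "summable (\<lambda>n. 1 / d * real (Suc n) powr (- Re s + d))"
    by (intro summable_mult) (subst summable_Suc_powr)
  fix n :: nat
  have "mangoldt (Suc n) \<le> real (Suc n) powr d / d"
    using mangoldt_le_ln[of "Suc n"] ln_powr_bound[of "real (Suc n)" d] d by simp
  then have "mangoldt (Suc n) * real (Suc n) powr (- Re s) \<le> real (Suc n) powr d / d * real (Suc n) powr (- Re s)"
    by (intro mult_right_mono) auto
  also have "\<dots> = 1 / d * real (Suc n) powr (- Re s + d)"
    unfolding powr_add by (simp del: of_nat_Suc)
  also have "mangoldt (Suc n) * real (Suc n) powr (- Re s) = norm (mangoldt (Suc n) / of_nat (Suc n) powr s :: complex)"
    using norm_inverse_powr[of n s] by (simp add: norm_mult norm_divide divide_inverse del: of_nat_Suc)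
  finally show "norm (norm (mangoldt (Suc n) / of_nat (Suc n) powr s :: complex)) \<le> 1 / d * real (Suc n) powr (- Re s + d)"
    by simp
qed

text \<open>Both series converge absolutely, so their product is a sum over pairs. Grouping the
  pairs by the product of their entries leaves divisor sums of \<open>mangoldt\<close>, which are
  logarithms.\<close>

lemma dirichlet_convolution_mangoldt:
  fixes s :: complex
  assumes s: "Re s > 1"
  shows "(\<lambda>n. of_real (ln (real (Suc n))) / of_nat (Suc n) powr s) sums
    (zeta_series s * (\<Sum>n. mangoldt (Suc n) / of_nat (Suc n) powr s))"
proof -
  define u where "u = (\<lambda>n. 1 / of_nat (Suc n) powr s :: complex)"
  define v where "v = (\<lambda>n. mangoldt (Suc n) / of_nat (Suc n) powr s :: complex)"
  have u: "summable (\<lambda>n. norm (u n))"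
    unfolding u_def norm_inverse_powr using s by (subst summable_Suc_powr) auto
  have v: "summable (\<lambda>n. norm (v n))" unfolding v_def by (rule summable_mangoldt[OF s])
  have hu: "(u has_sum zeta_series s) UNIV"
    using norm_summable_imp_has_sum[OF u] zeta_series_sums[OF s] by (simp add: u_def)
  have hv: "(v has_sum (\<Sum>n. v n)) UNIV"
    using norm_summable_imp_has_sum[OF v] summable_sums[OF summable_norm_cancel[OF v]] by simp
  have "(\<lambda>x. norm (case x of (m, d) \<Rightarrow> u m * v d)) summable_on UNIV \<times> UNIV"
  proof (rule summable_on_SigmaI)
    show "((\<lambda>d. norm (case (m, d) of (m, d) \<Rightarrow> u m * v d)) has_sum norm (u m) * (\<Sum>n. norm (v n))) UNIV" for m
      using norm_summable_imp_has_sum[of "\<lambda>n. norm (v n)"] v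
      by (simp add: norm_mult has_sum_cmult_right summable_sums)
    show "(\<lambda>m. norm (u m) * (\<Sum>n. norm (v n))) summable_on UNIV"
      using u by (intro summable_on_cmult_left norm_summable_imp_summable_on) simp
  qed simp
  then have "(\<lambda>(m, d). u m * v d) summable_on UNIV \<times> UNIV" by (rule abs_summable_summable)
  then have "((\<lambda>(m, d). u m * v d) has_sum (zeta_series s * (\<Sum>n. v n))) (UNIV \<times> UNIV)"
    by (intro has_sum_SigmaI[where g = "\<lambda>m. u m * (\<Sum>n. v n)"])
       (auto intro!: has_sum_cmult_right has_sum_cmult_left hu hv)
  also have "?this \<longleftrightarrow> ((\<lambda>(n, e). mangoldt e / of_nat (Suc n) powr s) has_sum (zeta_series s * (\<Sum>n. v n)))
      (Sigma UNIV (\<lambda>n. {e. e dvd Suc n}))"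
  \<comment> \<open>Mind the shifts: \<open>(m, d)\<close> stands for the factors
    \<open>Suc m\<close> and \<open>Suc d\<close>, whereas in \<open>(n, e)\<close> the product is
    \<open>Suc n\<close> but \<open>e\<close> is the divisor itself.\<close>
  proof (rule has_sum_reindex_bij_witness[where
       i = "\<lambda>(n, e). (Suc n div e - 1, e - 1)" and j = "\<lambda>(m, d). (Suc m * Suc d - 1, Suc d)"])
    fix x assume x: "x \<in> (UNIV \<times> UNIV :: (nat \<times> nat) set)"
    obtain m d where md: "x = (m, d)" by (cases x)
    have "of_nat (Suc m * Suc d) powr s = of_nat (Suc m) powr s * of_nat (Suc d) powr s"
      unfolding of_nat_mult by (intro powr_times_real) auto
    then show "(case case x of (m, d) \<Rightarrow> (Suc m * Suc d - 1, Suc d) of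
            (n, e) \<Rightarrow> mangoldt e / of_nat (Suc n) powr s) = (case x of (m, d) \<Rightarrow> u m * v d)"
      by (simp add: md u_def v_def del: of_nat_Suc of_nat_mult mult_Suc mult_Suc_right)
  next
    fix x assume x: "x \<in> Sigma UNIV (\<lambda>n. {e. e dvd Suc n})"
    then obtain n e where ne: "x = (n, e)" "e dvd Suc n" by auto
    then obtain k where k: "Suc n = e * k" by (auto elim: dvdE)
    then have "e > 0" "k > 0" by (auto intro: Nat.gr0I)
    then show "(case case x of (n, e) \<Rightarrow> (Suc n div e - 1, e - 1) of (m, d) \<Rightarrow> (Suc m * Suc d - 1, Suc d)) = x"
      using k by (simp add: ne mult.commute del: mult_Suc mult_Suc_right)
  qed (auto simp del: mult_Suc mult_Suc_right)
  finally have "((\<lambda>(n, e). mangoldt e / of_nat (Suc n) powr s) has_sum (zeta_series s * (\<Sum>n. v n)))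
      (Sigma UNIV (\<lambda>n. {e. e dvd Suc n}))" .
  then have "((\<lambda>n. of_real (ln (real (Suc n))) / of_nat (Suc n) powr s) has_sum (zeta_series s * (\<Sum>n. v n))) UNIV"
  proof (rule has_sum_SigmaD)
    fix n :: nat
    have "((\<lambda>e. mangoldt e / of_nat (Suc n) powr s) has_sum (\<Sum>e | e dvd Suc n. mangoldt e / of_nat (Suc n) powr s))
      {e. e dvd Suc n}"
      by (intro has_sum_finite) auto
    also have "(\<Sum>e | e dvd Suc n. mangoldt e / of_nat (Suc n) powr s) = of_real (ln (real (Suc n))) / of_nat (Suc n) powr s"
      using mangoldt_sum[of "Suc n", where 'a = complex] by (simp flip: sum_divide_distrib del: of_nat_Suc)
    finally show "((\<lambda>e. case (n, e) of (n, e) \<Rightarrow> mangoldt e / of_nat (Suc n) powr s) has_sum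
       of_real (ln (real (Suc n))) / of_nat (Suc n) powr s) {e. e dvd Suc n}" by simp
  qed
  then show ?thesis unfolding v_def by (rule has_sum_imp_sums)
qed

text \<open>
  The coefficients of \<open>log zeta\<close>. At \<open>n = 0\<close> the quotient is \<open>0 / 0 = 0\<close>, as it should be.
\<close>

definition log_zeta_coeff :: "nat \<Rightarrow> real" where
  "log_zeta_coeff n = mangoldt (Suc n) / ln (real (Suc n))"

lemma log_zeta_coeff_nonneg: "log_zeta_coeff n \<ge> 0" and log_zeta_coeff_le_1: "log_zeta_coeff n \<le> 1"
  using mangoldt_le_ln[of "Suc n"] mangoldt_nonneg[of "Suc n"]
  by (auto simp: log_zeta_coeff_def divide_le_eq_1 simp del: of_nat_Suc)

lemma log_zeta_coeff_ln: "log_zeta_coeff n * ln (real (Suc n)) = mangoldt (Suc n)"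
  by (cases n) (auto simp: log_zeta_coeff_def)

lemma norm_log_zeta_coeff_term:
  "norm (of_real (log_zeta_coeff n) / of_nat (Suc n) powr s :: complex) = log_zeta_coeff n * real (Suc n) powr (- Re s)"
  using norm_inverse_powr[of n s] log_zeta_coeff_nonneg[of n]
  by (simp add: norm_mult norm_divide divide_inverse del: of_nat_Suc)

lemma summable_log_zeta_coeff: "x > 1 \<Longrightarrow> summable (\<lambda>n. log_zeta_coeff n * real (Suc n) powr (- x))"
proof (rule summable_comparison_test'[where g = "\<lambda>n. real (Suc n) powr (- x)"])
  show "summable (\<lambda>n. real (Suc n) powr (- x))" if "x > 1" using that by (subst summable_Suc_powr) auto
  show "norm (log_zeta_coeff n * real (Suc n) powr (- x)) \<le> real (Suc n) powr (- x)" for n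
    using log_zeta_coeff_nonneg[of n] log_zeta_coeff_le_1[of n] by (simp add: abs_mult mult_left_le_one_le)
qed

text \<open>The convolution identity says that the logarithmic derivative of \<open>zeta\<close> is
  the derivative of the series \<open>p\<close> in the exponent, so \<open>zeta * exp (- p)\<close>
  has derivative 0 on a convex set. The constant \<open>C\<close> cancels in quotients and enters
  the lower bound for \<open>zeta\<close> only as a factor.\<close>

lemma zeta_series_eq_exp:
  obtains C where
    "\<And>s. Re s > 1 \<Longrightarrow> zeta_series s = C * exp (\<Sum>n. of_real (log_zeta_coeff n) / of_nat (Suc n) powr s)"
proof -
  let ?S = "{s::complex. Re s > 1}"
  have "\<exists>g g'. \<forall>s\<in>?S. (\<lambda>n. 1 / of_nat (Suc n) powr s) sums g s \<and>
           (\<lambda>n. - (1 * of_real (ln (real (Suc n)))) / of_nat (Suc n) powr s) sums g' s \<and>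
           (g has_field_derivative g' s) (at s)"
    by (rule dirichlet_series_deriv) auto
  then obtain g g' where g: "\<And>s. s \<in> ?S \<Longrightarrow> (\<lambda>n. 1 / of_nat (Suc n) powr s) sums g s"
    "\<And>s. s \<in> ?S \<Longrightarrow> (\<lambda>n. - (1 * of_real (ln (real (Suc n)))) / of_nat (Suc n) powr s) sums g' s"
    "\<And>s. s \<in> ?S \<Longrightarrow> (g has_field_derivative g' s) (at s)"
    by blast
  have "\<exists>g g'. \<forall>s\<in>?S. (\<lambda>n. of_real (log_zeta_coeff n) / of_nat (Suc n) powr s) sums g s \<and>
           (\<lambda>n. - (of_real (log_zeta_coeff n) * of_real (ln (real (Suc n)))) / of_nat (Suc n) powr s) sums g' s \<and>
           (g has_field_derivative g' s) (at s)"
    by (rule dirichlet_series_deriv) (use log_zeta_coeff_nonneg log_zeta_coeff_le_1 in auto)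
  then obtain p p' where p: "\<And>s. s \<in> ?S \<Longrightarrow> (\<lambda>n. of_real (log_zeta_coeff n) / of_nat (Suc n) powr s) sums p s"
    "\<And>s. s \<in> ?S \<Longrightarrow> (\<lambda>n. - (of_real (log_zeta_coeff n) * of_real (ln (real (Suc n)))) / of_nat (Suc n) powr s) sums p' s"
    "\<And>s. s \<in> ?S \<Longrightarrow> (p has_field_derivative p' s) (at s)"
    by blast
  have gz: "g s = zeta_series s" if "s \<in> ?S" for s
    using sums_unique2[OF g(1)[OF that] zeta_series_sums] that by simp
  have der: "g' s = g s * p' s" if s: "s \<in> ?S" for s
  proof -
    define M where "M = (\<Sum>n. mangoldt (Suc n) / of_nat (Suc n) powr s)"
    have "(\<lambda>n. - (of_real (ln (real (Suc n))) / of_nat (Suc n) powr s)) sums (- (zeta_series s * M))"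
      unfolding M_def by (intro sums_minus dirichlet_convolution_mangoldt) (use s in simp)
    then have "g' s = - (zeta_series s * M)"
      using sums_unique2[OF g(2)[OF s]] by simp
    moreover have "(\<lambda>n. - (mangoldt (Suc n) / of_nat (Suc n) powr s)) sums (- M)"
      unfolding M_def using summable_mangoldt[of s] s
      by (intro sums_minus summable_sums) (rule summable_norm_cancel, simp)
    then have "p' s = - M"
      using sums_unique2[OF p(2)[OF s]] log_zeta_coeff_ln by (simp del: of_nat_Suc flip: of_real_mult)
    ultimately show ?thesis using gz[OF s] by simp
  qed
  have "\<exists>C. \<forall>s\<in>?S. g s * exp (- p s) = C"
  proof (rule has_field_derivative_zero_constant)
    show "convex ?S" by (rule convex_halfspace_Re_gt)
    fix s assume s: "s \<in> ?S"
    have "((\<lambda>s. g s * exp (- p s)) has_field_derivative (g' s * exp (- p s) + (exp (- p s) * (- p' s)) * g s)) (at s)"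
      by (rule DERIV_mult[OF g(3)[OF s] DERIV_chain2[OF DERIV_exp DERIV_minus[OF p(3)[OF s]]]])
    then show "((\<lambda>s. g s * exp (- p s)) has_field_derivative 0) (at s within ?S)"
      by (rule has_field_derivative_at_within[OF DERIV_cong]) (simp add: der[OF s])
  qed
  then obtain C where C: "\<And>s. s \<in> ?S \<Longrightarrow> g s * exp (- p s) = C" by blast
  show ?thesis
  proof
    fix s assume s: "Re s > 1"
    have "p s = (\<Sum>n. of_real (log_zeta_coeff n) / of_nat (Suc n) powr s)"
      using p(1)[of s] s by (simp add: sums_iff)
    moreover have "zeta_series s = C * exp (p s)"
      using C[of s] gz[of s] s by (simp add: exp_minus field_simps)
    ultimately show "zeta_series s = C * exp (\<Sum>n. of_real (log_zeta_coeff n) / of_nat (Suc n) powr s)" by simp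
  qed
qed

section \<open>Zeta on the real axis\<close>

definition real_zeta :: "real \<Rightarrow> real" where "real_zeta x = (\<Sum>n. real (Suc n) powr (- x))"

lemma real_zeta_sums: "x > 1 \<Longrightarrow> (\<lambda>n. real (Suc n) powr (- x)) sums real_zeta x"
  unfolding real_zeta_def by (intro summable_sums) (subst summable_Suc_powr, simp)

lemma powr_of_real_eq: "1 / of_nat (Suc n) powr of_real x = (of_real (real (Suc n) powr (- x)) :: complex)"
proof -
  have "of_nat (Suc n) powr of_real x = (of_real (real (Suc n) powr x) :: complex)"
    by (subst powr_of_real[symmetric]) auto
  then show ?thesis by (simp add: powr_minus divide_inverse del: of_nat_Suc)
qed

lemma zeta_series_of_real: "x > 1 \<Longrightarrow> zeta_series (of_real x) = of_real (real_zeta x)"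
  unfolding zeta_series_def powr_of_real_eq real_zeta_def
  by (intro suminf_of_real[symmetric]) (subst summable_Suc_powr, simp)

text \<open>Convexity of \<open>z powr p\<close> for \<open>p \<le> 0\<close>, in the form that the
  tangent at \<open>y\<close> lies below the graph. Applied at both ends of
  \<open>[n, n + 1]\<close> it replaces the comparison of \<open>zeta\<close> with an
  integral.\<close>

lemma powr_tangent_le:
  fixes y z p :: real
  assumes "y > 0" "z > 0" "p \<le> 0"
  shows "y powr p + p * (z - y) * y powr (p - 1) \<le> z powr p"
proof -
  have "ln (z / y) \<le> z / y - 1" using assms by (intro ln_le_minus_one) auto
  then have "p * (z / y - 1) \<le> p * ln (z / y)" using assms by (intro mult_left_mono_neg)
  then have "1 + p * (z / y - 1) \<le> exp (p * ln (z / y))"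
    using exp_ge_add_one_self[of "p * ln (z / y)"] by linarith
  also have "\<dots> = z powr p / y powr p" using assms by (simp add: powr_def ln_div right_diff_distrib exp_diff)
  finally have *: "(1 + p * (z / y - 1)) * y powr p \<le> z powr p" using assms by (simp add: field_simps)
  have "(1 + p * (z / y - 1)) * y powr p = y powr p + p * (z - y) * (y powr p / y)"
    using assms by (simp add: field_simps)
  also have "y powr p / y = y powr (p - 1)" using assms by (simp add: powr_diff)
  finally show ?thesis using * by simp
qed

text \<open>The differences \<open>n powr (1 - x) - (n + 1) powr (1 - x)\<close> sum to 1. The terms
  \<open>(x - 1) * n powr (- x)\<close> dominate them as they stand and are dominated by them when
  shifted by one index.\<close>

lemma real_zeta_bounds:
  assumes x: "x > 1"
  shows "1 \<le> (x - 1) * real_zeta x" "(x - 1) * real_zeta x \<le> x"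
proof -
  let ?N = "\<lambda>n. real (Suc n)"
  have lim: "(\<lambda>n. ?N n powr (1 - x)) \<longlonglongrightarrow> 0"
    using x by (intro LIMSEQ_Suc tendsto_neg_powr filterlim_real_sequentially) auto
  have "(\<lambda>n. ?N n powr (1 - x) - ?N (Suc n) powr (1 - x)) sums (?N 0 powr (1 - x) - 0)"
    by (rule telescope_sums'[OF lim])
  then have tel: "(\<lambda>n. ?N n powr (1 - x) - ?N (Suc n) powr (1 - x)) sums 1" by simp
  have sz: "(\<lambda>n. (x - 1) * ?N n powr (- x)) sums ((x - 1) * real_zeta x)"
    by (intro sums_mult real_zeta_sums x)
  show "1 \<le> (x - 1) * real_zeta x"
  proof (rule sums_le[OF _ tel sz])
    fix n
    show "?N n powr (1 - x) - ?N (Suc n) powr (1 - x) \<le> (x - 1) * ?N n powr (- x)"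
      using powr_tangent_le[of "?N n" "?N (Suc n)" "1 - x"] x by (simp add: algebra_simps)
  qed
  have sz': "(\<lambda>n. (x - 1) * ?N (Suc n) powr (- x)) sums ((x - 1) * real_zeta x - (x - 1))"
    using sz by (subst sums_Suc_iff) simp
  have "(x - 1) * real_zeta x - (x - 1) \<le> 1"
  proof (rule sums_le[OF _ sz' tel])
    fix n
    show "(x - 1) * ?N (Suc n) powr (- x) \<le> ?N n powr (1 - x) - ?N (Suc n) powr (1 - x)"
      using powr_tangent_le[of "?N (Suc n)" "?N n" "1 - x"] x by (simp add: algebra_simps)
  qed
  then show "(x - 1) * real_zeta x \<le> x" by simp
qed

lemma real_zeta_pos: "x > 1 \<Longrightarrow> real_zeta x > 0"
  using real_zeta_bounds(1)[of x] by (metis diff_gt_0_iff_gt less_le_trans zero_less_mult_pos zero_less_one)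

text \<open>Let \<open>d = x - 1\<close>, so that
  \<open>real_zeta (x + r) \<ge> 1 / (d + r)\<close>. For \<open>r \<le> d\<close>, use
  \<open>1 - N powr (- r) \<le> r * ln N\<close> and pay for the logarithm with half of the distance
  to the pole, \<open>ln N \<le> N powr (d / 2) / (d / 2)\<close>; with
  \<open>real_zeta (1 + d / 2) \<le> 3 / d\<close> the difference is at most
  \<open>6 * r / d\<^sup>2\<close>, and \<open>d + r \<le> 2 * d\<close> makes the constant 12. For
  \<open>r > d\<close> the bound \<open>real_zeta x \<le> 2 / d\<close> suffices.\<close>

lemma real_zeta_ratio:
  assumes x: "1 < x" "x \<le> 2" and r: "0 < r" "r \<le> 1"
  shows "real_zeta x / real_zeta (x + r) \<le> 1 + 12 * r / (x - 1)"
proof -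
  define d where "d = x - 1"
  have d: "0 < d" "d \<le> 1" using x by (auto simp: d_def)
  have lower: "1 / (d + r) \<le> real_zeta (x + r)"
    using real_zeta_bounds(1)[of "x + r"] x r by (simp add: d_def field_simps)
  have pos: "real_zeta (x + r) > 0" using x r by (intro real_zeta_pos) auto
  have "real_zeta x - real_zeta (x + r) \<le> 12 * r / d * real_zeta (x + r)"
  proof (cases "r \<le> d")
    case True
    have "real_zeta x - real_zeta (x + r) \<le> r * (2 / d) * real_zeta (1 + d / 2)"
    proof (rule sums_le)
      show "(\<lambda>n. real (Suc n) powr (- x) - real (Suc n) powr (- (x + r))) sums (real_zeta x - real_zeta (x + r))"
        using x r by (intro sums_diff real_zeta_sums) auto
      show "(\<lambda>n. r * (2 / d) * real (Suc n) powr (- (1 + d / 2))) sums (r * (2 / d) * real_zeta (1 + d / 2))"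
        using d by (intro sums_mult real_zeta_sums) auto
      fix n
      let ?N = "real (Suc n)"
      have "1 - ?N powr (- r) \<le> r * ln ?N"
        using exp_ge_add_one_self[of "- r * ln ?N"] by (simp add: powr_def)
      also have "ln ?N \<le> ?N powr (d / 2) / (d / 2)" using d by (intro ln_powr_bound) auto
      finally have "1 - ?N powr (- r) \<le> r * (2 / d) * ?N powr (d / 2)" using r by (simp add: field_simps)
      then have "?N powr (- x) * (1 - ?N powr (- r)) \<le> ?N powr (- x) * (r * (2 / d) * ?N powr (d / 2))"
        by (intro mult_left_mono) auto
      also have "\<dots> = r * (2 / d) * (?N powr (- x) * ?N powr (d / 2))" by (simp only: ac_simps)
      also have "?N powr (- x) * ?N powr (d / 2) = ?N powr (- (1 + d / 2))"
      proof -
        have "- (1 + d / 2) = - x + d / 2" by (simp add: d_def field_simps)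
        then show ?thesis by (simp only: powr_add)
      qed
      also have "?N powr (- x) * (1 - ?N powr (- r)) = ?N powr (- x) - ?N powr (- (x + r))"
      proof -
        have "- (x + r) = - x + - r" by simp
        then show ?thesis by (simp only: powr_add right_diff_distrib mult_1_right)
      qed
      finally show "?N powr (- x) - ?N powr (- (x + r)) \<le> r * (2 / d) * ?N powr (- (1 + d / 2))" .
    qed
    also have "\<dots> \<le> r * (2 / d) * (3 / d)"
    proof (intro mult_left_mono)
      have "real_zeta (1 + d / 2) \<le> (1 + d / 2) / (d / 2)"
        using real_zeta_bounds(2)[of "1 + d / 2"] d by (simp add: field_simps)
      also have "\<dots> \<le> 3 / d" using d by (simp add: field_simps)
      finally show "real_zeta (1 + d / 2) \<le> 3 / d" .
    qed (use d r in auto)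
    also have "\<dots> = 12 * r / d * (1 / (2 * d))" using d by (simp add: field_simps)
    also have "\<dots> \<le> 12 * r / d * real_zeta (x + r)"
    proof (intro mult_left_mono)
      have "1 / (2 * d) \<le> 1 / (d + r)" using True d r by (intro divide_left_mono) auto
      then show "1 / (2 * d) \<le> real_zeta (x + r)" using lower by simp
    qed (use d r in auto)
    finally show ?thesis .
  next
    case False
    have "real_zeta x - real_zeta (x + r) \<le> real_zeta x" using pos by simp
    also have "\<dots> \<le> 2 / d" using real_zeta_bounds(2)[of x] x by (simp add: d_def field_simps)
    also have "\<dots> \<le> 12 * r / d * (1 / (2 * r))" using d r by (simp add: field_simps)
    also have "\<dots> \<le> 12 * r / d * real_zeta (x + r)"
    proof (intro mult_left_mono)
      have "1 / (2 * r) \<le> 1 / (d + r)" using False d r by (intro divide_left_mono) auto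
      then show "1 / (2 * r) \<le> real_zeta (x + r)" using lower by simp
    qed (use d r in auto)
    finally show ?thesis .
  qed
  then show ?thesis using pos by (simp add: d_def field_simps)
qed

section \<open>Comparison of complex arguments with the real axis\<close>

lemma norm_exp_minus_1_le: "norm (exp z - 1) \<le> exp (norm z) - 1" for z :: complex
proof -
  have "(\<lambda>n. z ^ n /\<^sub>R fact n) sums exp z" by (rule exp_converges)
  then have 1: "(\<lambda>n. z ^ Suc n /\<^sub>R fact (Suc n)) sums (exp z - 1)" by (subst sums_Suc_iff) simp
  have "(\<lambda>n. norm z ^ n /\<^sub>R fact n) sums exp (norm z)" by (rule exp_converges)
  then have 2: "(\<lambda>n. norm z ^ Suc n /\<^sub>R fact (Suc n)) sums (exp (norm z) - 1)" by (subst sums_Suc_iff) simp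
  have "norm (\<Sum>n. z ^ Suc n /\<^sub>R fact (Suc n)) \<le> (\<Sum>n. norm z ^ Suc n /\<^sub>R fact (Suc n))"
    using 2 by (intro norm_suminf_le) (auto simp: sums_iff norm_power norm_mult)
  then show ?thesis using 1 2 by (simp add: sums_iff)
qed

text \<open>As \<open>log zeta\<close> has nonnegative coefficients, its increment between
  \<open>s\<close> and \<open>s + r\<close> is dominated termwise by the increment on the real axis,
  whose exponential is \<open>real_zeta (Re s) / real_zeta (Re s + r)\<close>. Only the modulus of
  the increment enters, so the quotient and its reciprocal are treated alike.\<close>

lemma zeta_ratio_bounds:
  assumes s: "1 < Re s" "Re s \<le> 2" and r: "0 < r" "r \<le> 1"
  shows "norm (zeta s / zeta (s + of_real r) - 1) \<le> 12 * r / (Re s - 1)"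
    "norm (zeta (s + of_real r) / zeta s) \<le> 1 + 12 * r / (Re s - 1)"
proof -
  obtain C where C: "\<And>s. Re s > 1 \<Longrightarrow> zeta_series s = C * exp (\<Sum>n. of_real (log_zeta_coeff n) / of_nat (Suc n) powr s)"
    using zeta_series_eq_exp by blast
  define P where "P = (\<lambda>s. \<Sum>n. of_real (log_zeta_coeff n) / of_nat (Suc n) powr s :: complex)"
  define p where "p = (\<lambda>x. \<Sum>n. log_zeta_coeff n * real (Suc n) powr (- x))"
  have psum: "(\<lambda>n. log_zeta_coeff n * real (Suc n) powr (- x)) sums p x" if "x > 1" for x
    unfolding p_def by (rule summable_sums[OF summable_log_zeta_coeff[OF that]])
  have Psum: "(\<lambda>n. of_real (log_zeta_coeff n) / of_nat (Suc n) powr s) sums P s" if "Re s > 1" for s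
    unfolding P_def using psum[OF that]
    by (intro summable_sums) (rule summable_norm_cancel, simp only: norm_log_zeta_coeff_term sums_iff)
  have Pp: "P (of_real x) = of_real (p x)" if "x > 1" for x
  proof -
    have "of_real (log_zeta_coeff n) / of_nat (Suc n) powr of_real x = (of_real (log_zeta_coeff n * real (Suc n) powr (- x)) :: complex)" for n
      using powr_of_real_eq[of n x] by (simp add: divide_inverse)
    then have "(\<lambda>n. of_real (log_zeta_coeff n) / of_nat (Suc n) powr of_real x) sums (of_real (p x) :: complex)"
      using sums_of_real[OF psum[OF that]] by simp
    with Psum[of "of_real x"] that show ?thesis by (simp add: sums_unique2)
  qed
  have zP: "zeta s = C * exp (P s)" if "Re s > 1" for s
    using C[OF that] zeta_eq_zeta_series[OF that] by (simp add: P_def)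
  have zrp: "of_real (real_zeta x) = C * of_real (exp (p x))" if "x > 1" for x
    using zP[of "of_real x"] zeta_eq_zeta_series[of "of_real x"] zeta_series_of_real[OF that] Pp[OF that] that
    by (simp add: exp_of_real)
  have C0: "C \<noteq> 0" using zrp[of 2] real_zeta_pos[of 2] by auto
  let ?x = "Re s"
  have "norm (P s - P (s + of_real r)) \<le> p ?x - p (?x + r)"
  proof -
    have a: "(\<lambda>n. of_real (log_zeta_coeff n) / of_nat (Suc n) powr s - of_real (log_zeta_coeff n) / of_nat (Suc n) powr (s + of_real r))
       sums (P s - P (s + of_real r))"
      using s r by (intro sums_diff Psum) auto
    have b: "(\<lambda>n. log_zeta_coeff n * real (Suc n) powr (- ?x) - log_zeta_coeff n * real (Suc n) powr (- (?x + r))) sums (p ?x - p (?x + r))"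
      using s r by (intro sums_diff psum) auto
    have le: "norm (of_real (log_zeta_coeff n) / of_nat (Suc n) powr s - of_real (log_zeta_coeff n) / of_nat (Suc n) powr (s + of_real r) :: complex)
       \<le> log_zeta_coeff n * real (Suc n) powr (- ?x) - log_zeta_coeff n * real (Suc n) powr (- (?x + r))" for n
    proof -
      let ?N = "real (Suc n)"
      have "1 / of_nat (Suc n) powr (of_real r) = (of_real (?N powr (- r)) :: complex)" by (rule powr_of_real_eq)
      then have "of_real (log_zeta_coeff n) / of_nat (Suc n) powr s - of_real (log_zeta_coeff n) / of_nat (Suc n) powr (s + of_real r)
         = of_real (log_zeta_coeff n) / of_nat (Suc n) powr s * (of_real (1 - ?N powr (- r)) :: complex)"
        by (simp add: powr_add divide_inverse algebra_simps del: of_nat_Suc)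
      also have "norm \<dots> = log_zeta_coeff n * ?N powr (- ?x) * (1 - ?N powr (- r))"
      proof -
        have "?N powr (- r) \<le> ?N powr 0" using r by (intro powr_mono) auto
        then have "norm (of_real (1 - ?N powr (- r)) :: complex) = 1 - ?N powr (- r)"
          unfolding norm_of_real by simp
        then show ?thesis by (simp only: norm_mult norm_log_zeta_coeff_term)
      qed
      also have "\<dots> = log_zeta_coeff n * ?N powr (- ?x) - log_zeta_coeff n * ?N powr (- (?x + r))"
      proof -
        have "- (?x + r) = - ?x + - r" by simp
        then show ?thesis by (simp only: powr_add right_diff_distrib mult_1_right mult.assoc)
      qed
      finally show ?thesis by simp
    qed
    have "norm (\<Sum>n. of_real (log_zeta_coeff n) / of_nat (Suc n) powr s - of_real (log_zeta_coeff n) / of_nat (Suc n) powr (s + of_real r) :: complex)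
       \<le> (\<Sum>n. log_zeta_coeff n * real (Suc n) powr (- ?x) - log_zeta_coeff n * real (Suc n) powr (- (?x + r)))"
      using b le by (intro norm_suminf_le) (auto simp: sums_iff)
    then show ?thesis using a b by (simp add: sums_iff)
  qed
  then have "exp (norm (P s - P (s + of_real r))) \<le> exp (p ?x - p (?x + r))" by simp
  also have "\<dots> = real_zeta ?x / real_zeta (?x + r)"
  proof -
    have "complex_of_real (real_zeta ?x / real_zeta (?x + r)) = of_real (exp (p ?x - p (?x + r)))"
      using zrp[of ?x] zrp[of "?x + r"] s r C0 by (simp add: exp_diff)
    then show ?thesis by (simp only: of_real_eq_iff)
  qed
  also have "\<dots> \<le> 1 + 12 * r / (?x - 1)" by (rule real_zeta_ratio[OF s r])
  finally have *: "exp (norm (P s - P (s + of_real r))) \<le> 1 + 12 * r / (?x - 1)" .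
  have "zeta s / zeta (s + of_real r) = exp (P s - P (s + of_real r))"
    using zP[of s] zP[of "s + of_real r"] s r C0 by (simp add: exp_diff)
  then show "norm (zeta s / zeta (s + of_real r) - 1) \<le> 12 * r / (Re s - 1)"
    using norm_exp_minus_1_le[of "P s - P (s + of_real r)"] * by simp
  have "zeta (s + of_real r) / zeta s = exp (P (s + of_real r) - P s)"
    using zP[of s] zP[of "s + of_real r"] s r C0 by (simp add: exp_diff)
  then show "norm (zeta (s + of_real r) / zeta s) \<le> 1 + 12 * r / (Re s - 1)"
    using order_trans[OF norm_exp[of "P (s + of_real r) - P s"]] *
    by (metis norm_minus_commute)
qed

text \<open>If \<open>p\<close> is the exponent at the real point \<open>Re s\<close>, then
  \<open>\<bar>zeta s\<bar> \<ge> \<bar>C\<bar> * exp (- p)\<close> while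
  \<open>real_zeta (Re s) = \<bar>C\<bar> * exp p\<close>. So the product of the two is at least
  \<open>\<bar>C\<bar>\<^sup>2\<close>, and the upper bound for \<open>real_zeta\<close> does the
  rest.\<close>

lemma zeta_lower_bound:
  obtains c where "c > 0" "\<And>s. Re s > 1 \<Longrightarrow> norm (zeta s) \<ge> c * ((Re s - 1) / Re s)"
proof -
  obtain C where C: "\<And>s. Re s > 1 \<Longrightarrow> zeta_series s = C * exp (\<Sum>n. of_real (log_zeta_coeff n) / of_nat (Suc n) powr s)"
    using zeta_series_eq_exp by blast
  have C0: "C \<noteq> 0" using C[of 2] zeta_series_of_real[of 2] real_zeta_pos[of 2] by auto
  have "norm (zeta s) \<ge> norm C ^ 2 * ((Re s - 1) / Re s)" if s: "Re s > 1" for s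
  proof -
    let ?P = "\<lambda>s. \<Sum>n. of_real (log_zeta_coeff n) / of_nat (Suc n) powr s :: complex"
    note sm = summable_log_zeta_coeff[OF s]
    define p where "p = (\<Sum>n. log_zeta_coeff n * real (Suc n) powr (- Re s))"
    have "norm (?P s) \<le> p"
      unfolding p_def by (rule norm_suminf_le[OF _ sm]) (simp only: norm_log_zeta_coeff_term order_refl)
    have "?P (of_real (Re s)) = of_real p"
    proof -
      have "of_real (log_zeta_coeff n) / of_nat (Suc n) powr of_real (Re s) = (of_real (log_zeta_coeff n * real (Suc n) powr (- Re s)) :: complex)" for n
        using powr_of_real_eq[of n "Re s"] by (simp add: divide_inverse)
      then show ?thesis unfolding p_def by (simp only: suminf_of_real[OF sm, where 'a = complex])
    qed
    then have "of_real (real_zeta (Re s)) = C * exp (of_real p)"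
      using C[of "of_real (Re s)"] zeta_series_of_real[OF s] s by simp
    then have zp: "real_zeta (Re s) = norm C * exp p"
      using real_zeta_pos[OF s] by (metis abs_of_pos exp_gt_zero exp_of_real norm_mult norm_of_real)
    have "norm C ^ 2 * ((Re s - 1) / Re s) \<le> norm C ^ 2 * (1 / real_zeta (Re s))"
    proof (intro mult_left_mono)
      show "(Re s - 1) / Re s \<le> 1 / real_zeta (Re s)"
        using real_zeta_bounds(2)[OF s] real_zeta_pos[OF s] s by (simp add: field_simps)
    qed auto
    also have "\<dots> = norm C * exp (- p)" using C0 by (simp add: zp power2_eq_square exp_minus field_simps)
    also have "\<dots> \<le> norm C * exp (Re (?P s))"
    proof -
      have "- p \<le> Re (?P s)" using \<open>norm (?P s) \<le> p\<close> abs_Re_le_cmod[of "?P s"] by linarith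
      then show ?thesis by (intro mult_left_mono) auto
    qed
    also have "\<dots> = norm (zeta s)" using C[OF s] zeta_eq_zeta_series[OF s] by (simp add: norm_mult)
    finally show ?thesis .
  qed
  with C0 that show ?thesis by (metis norm_eq_zero power2_eq_square zero_less_norm_iff zero_less_power)
qed

subsection \<open>Vertical averages\<close>

text \<open>Vertical integrals are increments of a primitive of \<open>f\<close> on the convex set
  \<open>U\<close>. Hence they differ by its increments along the two horizontal sides, each at most
  \<open>E * (x2 - x1)\<close>.\<close>

lemma rectangle_shift:
  fixes f :: "complex \<Rightarrow> complex"
  assumes hol: "f holomorphic_on U" and U: "open U" "convex U"
    and le: "x1 \<le> x2" "a \<le> b"
    and sub: "\<And>x y. x1 \<le> x \<Longrightarrow> x \<le> x2 \<Longrightarrow> a \<le> y \<Longrightarrow> y \<le> b \<Longrightarrow> Complex x y \<in> U"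
    and E: "\<And>x. x1 \<le> x \<Longrightarrow> x \<le> x2 \<Longrightarrow> norm (f (Complex x a)) \<le> E"
      "\<And>x. x1 \<le> x \<Longrightarrow> x \<le> x2 \<Longrightarrow> norm (f (Complex x b)) \<le> E"
  shows "norm (integral {a..b} (\<lambda>y. f (Complex x1 y)) - integral {a..b} (\<lambda>y. f (Complex x2 y))) \<le> 2 * (x2 - x1) * E"
proof -
  obtain F where F: "\<And>z. z \<in> U \<Longrightarrow> (F has_field_derivative f z) (at z)"
    using holomorphic_convex_primitive'[OF U(2) U(1) hol] U(1) by (metis at_within_open)
  have vert: "integral {a..b} (\<lambda>y. f (Complex x y)) * \<i> = F (Complex x b) - F (Complex x a)"
    if x: "x1 \<le> x" "x \<le> x2" for x
  proof -
    have "((\<lambda>y. f (Complex x y) * \<i>) has_integral (F (Complex x b) - F (Complex x a))) {a..b}"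
    proof (rule fundamental_theorem_of_calculus[OF le(2)])
      fix y assume y: "y \<in> {a..b}"
      have "((\<lambda>y. Complex x y) has_vector_derivative \<i>) (at y within {a..b})"
        unfolding Complex_eq by (auto intro!: derivative_eq_intros)
      moreover have "(F has_field_derivative f (Complex x y)) (at (Complex x y))"
        using x y sub by (intro F) auto
      ultimately have "((F \<circ> (\<lambda>y. Complex x y)) has_vector_derivative (\<i> * f (Complex x y))) (at y within {a..b})"
        by (intro field_vector_diff_chain_within) (auto intro: has_field_derivative_at_within)
      then show "((\<lambda>y. F (Complex x y)) has_vector_derivative f (Complex x y) * \<i>) (at y within {a..b})"
        by (simp add: o_def mult.commute)
    qed
    from has_integral_unique[OF integrable_integral[OF has_integral_integrable[OF this]] this]
    show ?thesis by simp
  qed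
  have hor: "norm (F (Complex x1 y) - F (Complex x2 y)) \<le> E * (x2 - x1)"
    if y: "y = a \<or> y = b" for y
  proof -
    have "norm (F (Complex x1 y) - F (Complex x2 y)) \<le> E * norm (Complex x1 y - Complex x2 y)"
    proof (rule field_differentiable_bound[of "closed_segment (Complex x1 y) (Complex x2 y)" F f])
      fix z assume "z \<in> closed_segment (Complex x1 y) (Complex x2 y)"
      then obtain t where "0 \<le> t" "t \<le> 1" "z = (1 - t) *\<^sub>R Complex x1 y + t *\<^sub>R Complex x2 y"
        by (auto simp: in_segment)
      then have z: "z = Complex (x1 + t * (x2 - x1)) y" and t: "0 \<le> t" "t \<le> 1"
        by (auto simp: complex_eq_iff algebra_simps)
      have xx: "x1 \<le> x1 + t * (x2 - x1)" "x1 + t * (x2 - x1) \<le> x2"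
        using t le(1) mult_left_le_one_le[of "x2 - x1" t] by auto
      have "z \<in> U" unfolding z using xx y le(2) by (intro sub) auto
      then show "(F has_field_derivative f z) (at z within closed_segment (Complex x1 y) (Complex x2 y))"
        by (rule has_field_derivative_at_within[OF F])
      show "norm (f z) \<le> E" unfolding z using y E xx by auto
    qed auto
    also have "norm (Complex x1 y - Complex x2 y) = x2 - x1"
      using le(1) by (simp add: cmod_def)
    finally show ?thesis .
  qed
  have "(integral {a..b} (\<lambda>y. f (Complex x1 y)) - integral {a..b} (\<lambda>y. f (Complex x2 y))) * \<i>
      = (F (Complex x1 b) - F (Complex x2 b)) - (F (Complex x1 a) - F (Complex x2 a))"
    using vert[of x1] vert[of x2] le(1) by (simp add: left_diff_distrib)
  then have "norm (integral {a..b} (\<lambda>y. f (Complex x1 y)) - integral {a..b} (\<lambda>y. f (Complex x2 y)))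
      = norm ((F (Complex x1 b) - F (Complex x2 b)) - (F (Complex x1 a) - F (Complex x2 a)))"
    by (metis norm_mult norm_ii mult.right_neutral)
  also have "\<dots> \<le> E * (x2 - x1) + E * (x2 - x1)"
    by (rule order_trans[OF norm_triangle_ineq4 add_mono[OF hor hor]]) auto
  finally show ?thesis by (simp add: algebra_simps)
qed

text \<open>The decay is doubly exponential: at \<open>u = 6 * w * ln Y\<close> the value is below
  \<open>exp (- (Y ^ 3) / 2)\<close>, which beats a bound \<open>exp Y\<close>. A Gaussian of width
  \<open>w\<close> would need windows of length \<open>w * sqrt Y\<close> for the same
  purpose.\<close>

definition cosh_kernel :: "real \<Rightarrow> real \<Rightarrow> real" where "cosh_kernel w u = exp (- cosh (u / (2 * w)))"

lemma cosh_kernel_pos: "cosh_kernel w u > 0" and cosh_kernel_le_1: "cosh_kernel w u \<le> 1"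
  using cosh_real_ge_1[of "u / (2 * w)"] by (auto simp: cosh_kernel_def)

lemma continuous_on_cosh_kernel [continuous_intros]: "w > 0 \<Longrightarrow> continuous_on A (cosh_kernel w)"
  unfolding cosh_kernel_def by (auto intro!: continuous_intros)

text \<open>On \<open>[-w, w]\<close> the kernel is at least \<open>1/8\<close>, because
  \<open>cosh\<close> is at most \<open>exp (1/2) \<le> 2\<close> there and
  \<open>exp 2 \<le> 8\<close>.\<close>

lemma integral_cosh_kernel_ge:
  assumes w: "0 < w" "w \<le> h"
  shows "integral {-h..h} (cosh_kernel w) \<ge> w / 4"
proof -
  have e2: "exp 2 \<le> (8::real)"
  proof -
    have "exp 1 * exp 1 \<le> (2.72 * 2.72 :: real)"
      using e_less_272 by (intro mult_mono) auto
    then show ?thesis by (simp flip: exp_add)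
  qed
  have k: "cosh_kernel w u \<ge> 1/8" if "u \<in> {-w..w}" for u
  proof -
    have "cosh (u / (2 * w)) = cosh \<bar>u / (2 * w)\<bar>" by (simp add: abs_if)
    also have "\<dots> \<le> exp \<bar>u / (2 * w)\<bar>"
      by (simp add: cosh_def)
    also have "\<dots> \<le> exp (1/2)" using that w by (simp add: abs_le_iff field_simps)
    also have "exp (1/2) \<le> (2::real)"
    proof (rule power2_le_imp_le)
      have "(exp (1/2))\<^sup>2 = (exp 1 :: real)" by (simp add: power2_eq_square flip: exp_add)
      then show "(exp (1/2))\<^sup>2 \<le> (2::real)\<^sup>2" using e_less_272 by simp
    qed auto
    finally have "exp (cosh (u / (2 * w))) \<le> 8" using e2 by (meson exp_le_cancel_iff order_trans)
    then have "inverse 8 \<le> inverse (exp (cosh (u / (2 * w))))" by (intro le_imp_inverse_le) auto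
    then show ?thesis by (simp add: cosh_kernel_def exp_minus)
  qed
  have "w / 4 = integral {-w..w} (\<lambda>_. 1/8 :: real)" using w by simp
  also have "\<dots> \<le> integral {-w..w} (cosh_kernel w)"
    by (rule integral_le) (use w k in \<open>auto intro!: integrable_continuous_real continuous_intros\<close>)
  also have "\<dots> \<le> integral {-h..h} (cosh_kernel w)"
    by (rule integral_subset_le)
       (use w in \<open>auto intro!: integrable_continuous_real continuous_intros less_imp_le[OF cosh_kernel_pos]\<close>)
  finally show ?thesis .
qed

text \<open>The half in the exponent is what a contour shift leaves of the kernel. From
  \<open>2 * cosh y \<ge> 1 + y + y\<^sup>2 / 2\<close> and \<open>exp x \<ge> 1 + x\<close> comes
  the majorant \<open>1 / (1 + (u / c)\<^sup>2)\<close> with \<open>c = 6 * w\<close>, whose total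
  mass \<open>c * pi\<close> is below \<open>20 * w\<close>.\<close>

lemma integral_cosh_kernel_half_le:
  fixes w h :: real
  assumes w: "0 < w" "0 \<le> h"
  shows "integral {-h..h} (\<lambda>u. exp (- (cosh (u / (2 * w)) / 2))) \<le> 20 * w"
proof -
  define c where "c = 6 * w"
  have c: "c > 0" using w by (simp add: c_def)
  have "((\<lambda>u. 1 / (1 + (u / c)\<^sup>2)) has_integral (c * arctan (h / c) - c * arctan (- h / c))) {-h..h}"
  proof (rule fundamental_theorem_of_calculus)
    fix x
    have "((\<lambda>u. c * arctan (u / c)) has_real_derivative c * (inverse (1 + (x / c)\<^sup>2) * (1 / c))) (at x within {-h..h})"
      by (auto intro!: derivative_eq_intros)
    then show "((\<lambda>u. c * arctan (u / c)) has_vector_derivative 1 / (1 + (x / c)\<^sup>2)) (at x within {- h..h})"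
      using c by (simp add: has_real_derivative_iff_has_vector_derivative inverse_eq_divide)
  qed (use w in auto)
  then have "integral {-h..h} (\<lambda>u. 1 / (1 + (u / c)\<^sup>2)) = 2 * (c * arctan (h / c))"
    by (simp add: integral_unique arctan_minus)
  also have "\<dots> \<le> 2 * (c * (pi / 2))"
    using c arctan_ubound[of "h / c"] by (intro mult_left_mono) auto
  also have "\<dots> \<le> 20 * w" using pi_less_4 pi_approx w by (simp add: c_def)
  finally have I: "integral {-h..h} (\<lambda>u. 1 / (1 + (u / c)\<^sup>2)) \<le> 20 * w" .
  have nz: "1 + (u / c)\<^sup>2 \<noteq> 0" for u by (metis add_pos_nonneg less_irrefl zero_le_power2 zero_less_one)
  have "integral {-h..h} (\<lambda>u. exp (- (cosh (u / (2 * w)) / 2))) \<le> integral {-h..h} (\<lambda>u. 1 / (1 + (u / c)\<^sup>2))"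
  proof (rule integral_le)
    show "(\<lambda>u. exp (- (cosh (u / (2 * w)) / 2))) integrable_on {- h..h}"
      using w by (intro integrable_continuous_real continuous_intros) auto
    show "(\<lambda>u. 1 / (1 + (u / c)\<^sup>2)) integrable_on {- h..h}"
      using c nz by (intro integrable_continuous_real continuous_intros) auto
    fix u assume "u \<in> {-h..h}"
    define y where "y = \<bar>u / (2 * w)\<bar>"
    have "1 + y + y\<^sup>2 / 2 \<le> exp y" by (rule exp_lower_Taylor_quadratic) (simp add: y_def)
    also have "\<dots> \<le> 2 * cosh y" by (simp add: cosh_def)
    also have "cosh y = cosh (u / (2 * w))" by (simp add: y_def abs_if)
    finally have "1 + (u / c)\<^sup>2 \<le> 1 + cosh (u / (2 * w)) / 2"
    proof -
      have "(u / c)\<^sup>2 \<le> y\<^sup>2 / 8"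
        using w by (simp add: y_def c_def power2_eq_square field_simps)
      moreover have "y \<ge> 0" by (simp add: y_def)
      moreover assume "1 + y + y\<^sup>2 / 2 \<le> 2 * cosh (u / (2 * w))"
      ultimately show ?thesis by linarith
    qed
    also have "\<dots> \<le> exp (cosh (u / (2 * w)) / 2)" by (rule exp_ge_add_one_self)
    finally have "inverse (exp (cosh (u / (2 * w)) / 2)) \<le> inverse (1 + (u / c)\<^sup>2)"
      by (intro le_imp_inverse_le) (auto intro: add_pos_nonneg)
    then show "exp (- (cosh (u / (2 * w)) / 2)) \<le> 1 / (1 + (u / c)\<^sup>2)"
      by (simp add: exp_minus inverse_eq_divide)
  qed
  with I show ?thesis by linarith
qed

text \<open>
  Averaging vertically over a window preserves \<open>N\<close> and \<open>k\<close> but improves \<open>B\<close>.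
\<close>

definition strip_class where
  "strip_class v p k \<alpha> \<beta> B N F \<longleftrightarrow>
     F holomorphic_on {z. p < Re z \<and> \<alpha> < Im z \<and> Im z < \<beta>} \<and>
     (\<forall>z. v \<le> Re z \<and> Re z \<le> 1 \<and> \<alpha> < Im z \<and> Im z < \<beta> \<longrightarrow> norm (F z) \<le> B) \<and>
     (\<forall>z. 0 < Re z \<and> Re z \<le> 1 \<and> \<alpha> < Im z \<and> Im z < \<beta> \<longrightarrow> norm (F z - 1) \<le> k / Re z) \<and>
     (\<forall>a b. \<alpha> < a \<and> a \<le> b \<and> b < \<beta> \<longrightarrow> integral {a..b} (\<lambda>y. norm (F (Complex v y))) \<le> (N::real))"

definition cosh_average :: "real \<Rightarrow> real \<Rightarrow> (complex \<Rightarrow> complex) \<Rightarrow> complex \<Rightarrow> complex" where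
  "cosh_average w h F z = integral {-h..h} (\<lambda>u. of_real (cosh_kernel w u) * F (z + \<i> * of_real u)) / of_real (integral {-h..h} (cosh_kernel w))"

lemma open_strip: "open {z. p < Re z \<and> \<alpha> < Im z \<and> Im z < \<beta>}"
  by (intro open_Collect_conj open_Collect_less continuous_intros)

lemma convex_strip: "convex {z. p < Re z \<and> \<alpha> < Im z \<and> Im z < \<beta>}"
proof -
  have "{z. p < Re z \<and> \<alpha> < Im z \<and> Im z < \<beta>} = {z. Re z > p} \<inter> {z. Im z > \<alpha>} \<inter> {z. Im z < \<beta>}" by auto
  then show ?thesis by (simp add: convex_Int convex_halfspace_Re_gt convex_halfspace_Im_gt convex_halfspace_Im_lt)
qed

lemma holomorphic_cosh_average:
  assumes F: "F holomorphic_on {z. p < Re z \<and> \<alpha> < Im z \<and> Im z < \<beta>}" and w: "w > 0" "w \<le> h"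
  shows "cosh_average w h F holomorphic_on {z. p < Re z \<and> \<alpha> + h < Im z \<and> Im z < \<beta> - h}"
proof -
  let ?S = "{z. p < Re z \<and> \<alpha> < Im z \<and> Im z < \<beta>}"
  let ?U = "{z. p < Re z \<and> \<alpha> + h < Im z \<and> Im z < \<beta> - h}"
  have mem: "z + \<i> * of_real u \<in> ?S" if "z \<in> ?U" "u \<in> {-h..h}" for z u using that by auto
  have dF: "deriv F holomorphic_on ?S" by (intro holomorphic_deriv F open_strip)
  have cF: "continuous_on ?S F" "continuous_on ?S (deriv F)"
    using F dF by (auto intro: holomorphic_on_imp_continuous_on)
  have "(\<lambda>z. integral (cbox (-h) h) (\<lambda>u. of_real (cosh_kernel w u) * F (z + \<i> * of_real u))) holomorphic_on ?U"
  proof (rule leibniz_rule_holomorphic)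
    fix z u assume z: "z \<in> ?U" and u: "u \<in> cbox (- h) h"
    have "(F has_field_derivative deriv F (z + \<i> * of_real u)) (at (z + \<i> * of_real u))"
      using mem[OF z] u by (intro holomorphic_derivI[OF F open_strip]) auto
    then have "((\<lambda>z. F (z + \<i> * of_real u)) has_field_derivative deriv F (z + \<i> * of_real u)) (at z)"
      by (simp add: DERIV_shift)
    then show "((\<lambda>z. of_real (cosh_kernel w u) * F (z + \<i> * of_real u)) has_field_derivative
       of_real (cosh_kernel w u) * deriv F (z + \<i> * of_real u)) (at z within ?U)"
      by (rule has_field_derivative_at_within[OF DERIV_cmult])
  next
    fix z assume z: "z \<in> ?U"
    have "continuous_on {-h..h} (\<lambda>u. F (z + \<i> * of_real u))"
      by (rule continuous_on_compose2[OF cF(1)]) (use mem[OF z] in \<open>auto intro!: continuous_intros\<close>)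
    then show "(\<lambda>u. of_real (cosh_kernel w u) * F (z + \<i> * of_real u)) integrable_on cbox (- h) h"
      using w by (simp add: integrable_continuous_real continuous_intros)
  next
    have "continuous_on (?U \<times> cbox (- h) h) (\<lambda>x. deriv F (fst x + \<i> * of_real (snd x)))"
      by (rule continuous_on_compose2[OF cF(2)]) (use mem in \<open>auto intro!: continuous_intros\<close>)
    moreover have "continuous_on (?U \<times> cbox (- h) h) (\<lambda>x. cosh_kernel w (snd x))"
      by (rule continuous_on_compose2[OF continuous_on_cosh_kernel[of w UNIV]]) (use w in \<open>auto intro!: continuous_intros\<close>)
    ultimately show "continuous_on (?U \<times> cbox (- h) h) (\<lambda>(z, u). of_real (cosh_kernel w u) * deriv F (z + \<i> * of_real u))"
      by (simp add: case_prod_unfold continuous_intros)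
  qed (rule convex_strip)
  moreover have "integral {-h..h} (cosh_kernel w) \<noteq> 0" using integral_cosh_kernel_ge[OF w] w by linarith
  ultimately show ?thesis unfolding cosh_average_def by (intro holomorphic_intros) (auto simp: cbox_interval)
qed

lemma continuous_on_strip_line:
  assumes F: "F holomorphic_on {z. p < Re z \<and> \<alpha> < Im z \<and> Im z < \<beta>}"
    and x: "p < x" and A: "\<And>y. y \<in> A \<Longrightarrow> \<alpha> < g y \<and> g y < \<beta>" and g: "continuous_on A g"
  shows "continuous_on A (\<lambda>y. F (Complex x (g y)))"
  by (rule continuous_on_compose2[OF holomorphic_on_imp_continuous_on[OF F]])
     (use x A in \<open>auto intro!: continuous_intros g simp: Complex_eq\<close>)

text \<open>The weights are positive and normalised by their integral, so the constant 1 may be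
  moved under the average.\<close>

lemma cosh_average_minus_1_bound:
  assumes F: "continuous_on {-h..h} (\<lambda>u. F (z + \<i> * of_real u))" and w: "0 < w" "w \<le> h"
  shows "cosh_average w h F z - 1 = integral {-h..h} (\<lambda>u. of_real (cosh_kernel w u) * (F (z + \<i> * of_real u) - 1)) / of_real (integral {-h..h} (cosh_kernel w))"
    "(\<And>u. u \<in> {-h..h} \<Longrightarrow> norm (F (z + \<i> * of_real u) - 1) \<le> e) \<Longrightarrow> norm (cosh_average w h F z - 1) \<le> e"
proof -
  define m where "m = integral {-h..h} (cosh_kernel w)"
  have m: "m > 0" using integral_cosh_kernel_ge[OF w] w by (simp add: m_def)
  have ck: "continuous_on {-h..h} (\<lambda>u. complex_of_real (cosh_kernel w u))"
    using w by (intro continuous_intros) auto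
  have im: "integral {-h..h} (\<lambda>u. complex_of_real (cosh_kernel w u)) = of_real m"
    unfolding m_def using w
    by (intro integral_unique has_integral_of_real integrable_integral integrable_continuous_real continuous_intros)
  have "integral {-h..h} (\<lambda>u. of_real (cosh_kernel w u) * (F (z + \<i> * of_real u) - 1))
     = integral {-h..h} (\<lambda>u. of_real (cosh_kernel w u) * F (z + \<i> * of_real u) - of_real (cosh_kernel w u))"
    by (simp add: algebra_simps)
  also have "\<dots> = integral {-h..h} (\<lambda>u. of_real (cosh_kernel w u) * F (z + \<i> * of_real u)) - of_real m"
    unfolding im[symmetric] using F ck w
    by (intro integral_diff integrable_continuous_real continuous_intros) auto
  finally show eq: "cosh_average w h F z - 1 = integral {-h..h} (\<lambda>u. of_real (cosh_kernel w u) * (F (z + \<i> * of_real u) - 1)) / of_real (integral {-h..h} (cosh_kernel w))"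
    using m unfolding cosh_average_def m_def[symmetric] by (simp add: diff_divide_distrib)
  assume e: "\<And>u. u \<in> {-h..h} \<Longrightarrow> norm (F (z + \<i> * of_real u) - 1) \<le> e"
  have "norm (integral {-h..h} (\<lambda>u. of_real (cosh_kernel w u) * (F (z + \<i> * of_real u) - 1))) \<le> integral {-h..h} (\<lambda>u. cosh_kernel w u * e)"
  proof (rule integral_norm_bound_integral)
    show "(\<lambda>u. of_real (cosh_kernel w u) * (F (z + \<i> * of_real u) - 1)) integrable_on {-h..h}"
      using F ck w by (intro integrable_continuous_real continuous_intros) auto
    show "(\<lambda>u. cosh_kernel w u * e) integrable_on {-h..h}"
      using w by (intro integrable_continuous_real continuous_intros) auto
    show "norm (of_real (cosh_kernel w u) * (F (z + \<i> * of_real u) - 1)) \<le> cosh_kernel w u * e" if "u \<in> {-h..h}" for u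
      using e[OF that] cosh_kernel_pos[of w u] by (simp add: norm_mult mult_left_mono)
  qed
  also have "\<dots> = m * e" by (simp add: m_def)
  finally show "norm (cosh_average w h F z - 1) \<le> e"
    unfolding eq m_def[symmetric] using m by (simp add: norm_divide field_simps)
qed

text \<open>Since \<open>1 \<le> pi / 3\<close>, the cosine of the real part is at least
  \<open>1/2\<close>. This explains the 2 in \<open>u / (2 * w)\<close>: a shift by at most
  \<open>2 * w\<close> changes the real part of the argument by at most 1.\<close>

lemma Re_cos_ge:
  assumes "\<bar>Re z\<bar> \<le> 1"
  shows "Re (cos z) \<ge> cosh (Im z) / 2"
proof -
  have "cos (pi / 3) \<le> cos \<bar>Re z\<bar>"
    using assms pi_gt3 by (intro cos_monotone_0_pi_le) auto
  then have "1 / 2 \<le> cos (Re z)" by (simp add: cos_60 cos_abs_real)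
  then have "1 / 2 * cosh (Im z) \<le> cos (Re z) * cosh (Im z)"
    by (intro mult_right_mono) auto
  moreover have "Re (cos z) = cos (Re z) * cosh (Im z)"
    by (simp add: Re_cos cosh_def field_simps)
  ultimately show ?thesis by simp
qed

text \<open>
  On the line through \<open>z\<close> the kernel is \<open>exp (- cos ((\<zeta> - z) / (2 * w)))\<close>. This is an entire
  function of \<open>\<zeta>\<close> which stays bounded up to the line \<open>Re \<zeta> = w\<close> and is doubly exponentially
  small at the ends of the window, so the average may be moved to that line.
\<close>

lemma cosh_average_shift_bound:
  assumes F: "F holomorphic_on {z. p < Re z \<and> \<alpha> < Im z \<and> Im z < \<beta>}"
    and z: "p < Re z" "- w \<le> Re z" "Re z \<le> w" "\<alpha> + h < Im z" "Im z < \<beta> - h"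
    and w: "0 < w" "w \<le> h"
    and B: "\<And>z'. Re z \<le> Re z' \<Longrightarrow> Re z' \<le> w \<Longrightarrow> \<alpha> < Im z' \<Longrightarrow> Im z' < \<beta> \<Longrightarrow> norm (F z' - 1) \<le> B"
    and e: "\<And>y. \<alpha> < y \<Longrightarrow> y < \<beta> \<Longrightarrow> norm (F (Complex w y) - 1) \<le> e"
  shows "norm (cosh_average w h F z - 1) \<le> 80 * e + 16 * B * exp (- exp (h / (2 * w)) / 4)"
proof -
  let ?S = "{z. p < Re z \<and> \<alpha> < Im z \<and> Im z < \<beta>}"
  define x0 y0 where "x0 = Re z" and "y0 = Im z"
  define f where "f = (\<lambda>\<zeta>. (F \<zeta> - 1) * exp (- cos ((\<zeta> - z) / of_real (2 * w))))"
  define E where "E = B * exp (- exp (h / (2 * w)) / 4)"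
  have zc: "z = Complex x0 y0" by (simp add: x0_def y0_def)
  have f: "f holomorphic_on ?S" unfolding f_def using w by (intro holomorphic_intros F) auto
  have h: "h > 0" using w by simp
  have B0: "B \<ge> 0" using B[of z] z h by (smt (verit) norm_ge_zero)
  have e0: "e \<ge> 0" using e[of "Im z"] z h by (smt (verit) norm_ge_zero)
  have W: "norm (exp (- cos ((Complex x y - z) / of_real (2 * w)))) \<le> exp (- (cosh ((y - y0) / (2 * w)) / 2))"
    if "x0 \<le> x" "x \<le> w" for x y
  proof -
    have "\<bar>x - x0\<bar> \<le> 2 * w" using that z by (simp add: x0_def)
    then have "\<bar>Re ((Complex x y - z) / of_real (2 * w))\<bar> \<le> 1"
      using w unfolding Re_divide_of_real by (simp add: zc)
    from Re_cos_ge[OF this] show ?thesis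
      using w unfolding Im_divide_of_real by (simp add: zc)
  qed
  have ends: "norm (f (Complex x y)) \<le> E" if "x0 \<le> x" "x \<le> w" "y = y0 - h \<or> y = y0 + h" for x y
  proof -
    have "exp (h / (2 * w)) / 2 \<le> cosh (h / (2 * w))" by (simp add: cosh_def)
    moreover have "(y - y0) / (2 * w) = h / (2 * w) \<or> (y - y0) / (2 * w) = - (h / (2 * w))"
      using that(3) by auto
    then have ch: "cosh ((y - y0) / (2 * w)) = cosh (h / (2 * w))" by (elim disjE) (simp_all only: cosh_minus)
    ultimately have "exp (- (cosh ((y - y0) / (2 * w)) / 2)) \<le> exp (- exp (h / (2 * w)) / 4)"
      unfolding ch exp_le_cancel_iff by linarith
    then have "norm (exp (- cos ((Complex x y - z) / of_real (2 * w)))) \<le> exp (- exp (h / (2 * w)) / 4)"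
      using W[of x y] that by linarith
    moreover have "norm (F (Complex x y) - 1) \<le> B"
      using that z h by (intro B) (auto simp: x0_def y0_def)
    ultimately show ?thesis unfolding f_def E_def norm_mult using B0 by (intro mult_mono) auto
  qed
  have shift: "norm (integral {y0 - h..y0 + h} (\<lambda>y. f (Complex x0 y)) - integral {y0 - h..y0 + h} (\<lambda>y. f (Complex w y)))
      \<le> 2 * (w - x0) * E"
    by (rule rectangle_shift[OF f open_strip convex_strip]) (use z h ends in \<open>auto simp: x0_def y0_def\<close>)
  have tr: "integral {y0 - h..y0 + h} g = integral {-h..h} (\<lambda>u. g (y0 + u))" for g :: "real \<Rightarrow> complex"
    using integral_shift_Icc_real[of "-h" h g y0] by (simp add: o_def add.commute)
  have left: "integral {y0 - h..y0 + h} (\<lambda>y. f (Complex x0 y)) = integral {-h..h} (\<lambda>u. of_real (cosh_kernel w u) * (F (z + \<i> * of_real u) - 1))"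
  proof -
    have "f (Complex x0 (y0 + u)) = of_real (cosh_kernel w u) * (F (z + \<i> * of_real u) - 1)" for u
    proof -
      have 1: "Complex x0 (y0 + u) = z + \<i> * of_real u" by (simp add: zc complex_eq_iff)
      have "cos ((z + \<i> * of_real u - z) / of_real (2 * w)) = of_real (cosh (u / (2 * w)))"
        by (simp add: complex_eq_iff Re_cos Im_cos cosh_def)
      then have "exp (- cos ((z + \<i> * of_real u - z) / of_real (2 * w))) = of_real (cosh_kernel w u)"
        by (simp add: cosh_kernel_def exp_of_real flip: of_real_minus)
      then show ?thesis unfolding f_def 1 by simp
    qed
    then show ?thesis unfolding tr by simp
  qed
  have right: "norm (integral {y0 - h..y0 + h} (\<lambda>y. f (Complex w y))) \<le> e * (20 * w)"
  proof -
    have "norm (integral {-h..h} (\<lambda>u. f (Complex w (y0 + u)))) \<le> integral {-h..h} (\<lambda>u. e * exp (- (cosh (u / (2 * w)) / 2)))"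
    proof (rule integral_norm_bound_integral)
      show "(\<lambda>u. f (Complex w (y0 + u))) integrable_on {-h..h}"
        by (intro integrable_continuous_real continuous_on_strip_line[OF f])
           (use z in \<open>auto intro!: continuous_intros simp: y0_def\<close>)
      show "(\<lambda>u. e * exp (- (cosh (u / (2 * w)) / 2))) integrable_on {-h..h}"
        using w by (intro integrable_continuous_real continuous_intros) auto
      fix u assume u: "u \<in> {-h..h}"
      have "norm (F (Complex w (y0 + u)) - 1) \<le> e" using u z by (intro e) (auto simp: y0_def)
      moreover have "norm (exp (- cos ((Complex w (y0 + u) - z) / of_real (2 * w)))) \<le> exp (- (cosh (u / (2 * w)) / 2))"
        using W[of w "y0 + u"] z by (simp add: x0_def)
      ultimately show "norm (f (Complex w (y0 + u))) \<le> e * exp (- (cosh (u / (2 * w)) / 2))"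
        unfolding f_def norm_mult using e0 by (intro mult_mono) auto
    qed
    also have "\<dots> = e * integral {-h..h} (\<lambda>u. exp (- (cosh (u / (2 * w)) / 2)))" by simp
    also have "\<dots> \<le> e * (20 * w)" using e0 w h by (intro mult_left_mono integral_cosh_kernel_half_le) auto
    finally show ?thesis unfolding tr .
  qed
  define m where "m = integral {-h..h} (cosh_kernel w)"
  have m: "m \<ge> w / 4" using integral_cosh_kernel_ge[OF w] by (simp add: m_def)
  have cF: "continuous_on {-h..h} (\<lambda>u. F (z + \<i> * of_real u))"
  proof -
    have "z + \<i> * of_real u = Complex x0 (y0 + u)" for u by (simp add: zc complex_eq_iff)
    then show ?thesis using z
      by (simp only:) (intro continuous_on_strip_line[OF F], auto intro!: continuous_intros simp: x0_def y0_def)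
  qed
  have E0: "E \<ge> 0" using B0 by (simp add: E_def)
  have "norm (cosh_average w h F z - 1) = norm (integral {y0 - h..y0 + h} (\<lambda>y. f (Complex x0 y))) / m"
    unfolding left cosh_average_minus_1_bound(1)[where F = F, OF cF w] m_def[symmetric]
    using m w by (simp add: norm_divide)
  \<comment> \<open>The line \<open>Re z = w\<close> contributes \<open>20 * w * e\<close>, the two
    horizontal sides of length at most \<open>2 * w\<close> contribute \<open>4 * w * E\<close>, and
    the kernel has mass at least \<open>w / 4\<close>; hence the constants 80 and 16.\<close>
  also have "\<dots> \<le> (e * (20 * w) + 4 * w * E) / (w / 4)"
  proof (rule frac_le)
    have "2 * (w - x0) * E \<le> 4 * w * E" using z E0 by (intro mult_right_mono) (auto simp: x0_def)
    then show "norm (integral {y0 - h..y0 + h} (\<lambda>y. f (Complex x0 y))) \<le> e * (20 * w) + 4 * w * E"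
      using shift right norm_triangle_sub[of "integral {y0 - h..y0 + h} (\<lambda>y. f (Complex x0 y))" "integral {y0 - h..y0 + h} (\<lambda>y. f (Complex w y))"]
      by linarith
  qed (use m w e0 E0 in auto)
  also have "\<dots> = 80 * e + 16 * E" using w by (simp add: field_simps)
  finally show ?thesis by (simp add: E_def)
qed

text \<open>For \<open>Re z \<le> w\<close> the average is moved to the line
  \<open>Re z = w\<close>, where \<open>F\<close> is within \<open>k / w\<close> of 1; to the right
  of that line this closeness is already at hand. In the last claim the kernel is at most 1 with
  mass at least \<open>w / 4\<close>, so \<open>N\<close> controls single values of the average.
  Through it a lower bound for one value becomes a lower bound for \<open>N\<close>.\<close>

lemma strip_class_step:
  assumes S: "strip_class v p k \<alpha> \<beta> B N F"
    and pv: "p < v" and p: "p \<le> 0" and v: "\<bar>v\<bar> \<le> w" and w: "0 < w" "w \<le> 1" "w \<le> h" and k: "k \<ge> 0" and B: "B \<ge> 0"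
  defines "\<delta> \<equiv> 80 * k / w + 16 * (B + 1) * exp (- exp (h / (2 * w)) / 4)"
  shows "strip_class v p k (\<alpha> + h) (\<beta> - h) (1 + \<delta>) N (cosh_average w h F)"
    and "\<And>z. v \<le> Re z \<Longrightarrow> Re z \<le> 1 \<Longrightarrow> \<alpha> + h < Im z \<Longrightarrow> Im z < \<beta> - h \<Longrightarrow> norm (cosh_average w h F z - 1) \<le> \<delta>"
    and "\<And>y. \<alpha> + h < y \<Longrightarrow> y < \<beta> - h \<Longrightarrow> norm (cosh_average w h F (Complex v y)) \<le> 4 / w * N"
proof -
  have F: "F holomorphic_on {z. p < Re z \<and> \<alpha> < Im z \<and> Im z < \<beta>}"
    and FB: "\<And>z. v \<le> Re z \<Longrightarrow> Re z \<le> 1 \<Longrightarrow> \<alpha> < Im z \<Longrightarrow> Im z < \<beta> \<Longrightarrow> norm (F z) \<le> B"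
    and Fk: "\<And>z. 0 < Re z \<Longrightarrow> Re z \<le> 1 \<Longrightarrow> \<alpha> < Im z \<Longrightarrow> Im z < \<beta> \<Longrightarrow> norm (F z - 1) \<le> k / Re z"
    and FN: "\<And>a b. \<alpha> < a \<Longrightarrow> a \<le> b \<Longrightarrow> b < \<beta> \<Longrightarrow> integral {a..b} (\<lambda>y. norm (F (Complex v y))) \<le> N"
    using S unfolding strip_class_def by blast+
  define m where "m = integral {-h..h} (cosh_kernel w)"
  have m: "m \<ge> w / 4" using integral_cosh_kernel_ge[OF w(1,3)] by (simp add: m_def)
  then have m0: "m > 0" using w by linarith
  have \<delta>0: "\<delta> \<ge> 0" unfolding \<delta>_def using k w B by (intro add_nonneg_nonneg mult_nonneg_nonneg divide_nonneg_nonneg) auto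
  have cF: "continuous_on {-h..h} (\<lambda>u. F (z + \<i> * of_real u))"
    if "p < Re z" "\<alpha> + h < Im z" "Im z < \<beta> - h" for z
  proof -
    have "z + \<i> * of_real u = Complex (Re z) (Im z + u)" for u by (simp add: complex_eq_iff)
    then show ?thesis using that
      by (simp only:) (intro continuous_on_strip_line[OF F], auto intro!: continuous_intros)
  qed
  have b1: "norm (cosh_average w h F z - 1) \<le> k / Re z"
    if "p < Re z" "0 < Re z" "Re z \<le> 1" "\<alpha> + h < Im z" "Im z < \<beta> - h" for z
    by (rule cosh_average_minus_1_bound(2)[OF cF])
       (use that w Fk[of "z + \<i> * of_real _"] in auto)
  show b2: "norm (cosh_average w h F z - 1) \<le> \<delta>"
    if z: "v \<le> Re z" "Re z \<le> 1" "\<alpha> + h < Im z" "Im z < \<beta> - h" for z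
  proof (cases "Re z \<le> w")
    case True
    have "norm (cosh_average w h F z - 1) \<le> 80 * (k / w) + 16 * (B + 1) * exp (- exp (h / (2 * w)) / 4)"
    proof (rule cosh_average_shift_bound[OF F])
      fix z' assume z': "Re z \<le> Re z'" "Re z' \<le> w" "\<alpha> < Im z'" "Im z' < \<beta>"
      then have "norm (F z') \<le> B" using z w by (intro FB) auto
      then show "norm (F z' - 1) \<le> B + 1" using norm_triangle_ineq4[of "F z'" 1] by simp
    next
      show "norm (F (Complex w y) - 1) \<le> k / w" if "\<alpha> < y" "y < \<beta>" for y
        using Fk[of "Complex w y"] that w by simp
    qed (use z v w pv True in auto)
    then show ?thesis by (simp add: \<delta>_def)
  next
    case False
    then have "norm (cosh_average w h F z - 1) \<le> k / Re z" using z w pv by (intro b1) auto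
    also have "\<dots> \<le> k / w" using False w k by (intro divide_left_mono mult_pos_pos) auto
    also have "\<dots> \<le> 80 * k / w" using w k by (simp add: field_simps)
    also have "\<dots> \<le> \<delta>" using B by (simp add: \<delta>_def)
    finally show ?thesis .
  qed
  have eqC: "Complex v y + \<i> * of_real u = Complex v (y + u)" for y u by (simp add: complex_eq_iff)
  have pt: "norm (cosh_average w h F (Complex v y)) \<le> integral {-h..h} (\<lambda>u. cosh_kernel w u * norm (F (Complex v (y + u)))) / m"
    if y: "\<alpha> + h < y" "y < \<beta> - h" for y
  proof -
    have c: "continuous_on {-h..h} (\<lambda>u. F (Complex v (y + u)))"
      using y pv by (intro continuous_on_strip_line[OF F]) (auto intro!: continuous_intros)
    have "norm (integral {-h..h} (\<lambda>u. of_real (cosh_kernel w u) * F (Complex v (y + u)))) \<le>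
       integral {-h..h} (\<lambda>u. cosh_kernel w u * norm (F (Complex v (y + u))))"
    proof (rule integral_norm_bound_integral)
      show "(\<lambda>u. of_real (cosh_kernel w u) * F (Complex v (y + u))) integrable_on {-h..h}"
        "(\<lambda>u. cosh_kernel w u * norm (F (Complex v (y + u)))) integrable_on {-h..h}"
        using c w by (intro integrable_continuous_real continuous_intros; simp)+
    qed (simp add: norm_mult less_imp_le[OF cosh_kernel_pos])
    then show ?thesis
      unfolding cosh_average_def eqC m_def[symmetric] using m0 by (simp add: norm_divide divide_right_mono)
  qed
  show "norm (cosh_average w h F (Complex v y)) \<le> 4 / w * N" if y: "\<alpha> + h < y" "y < \<beta> - h" for y
  proof -
    have c: "continuous_on {-h..h} (\<lambda>u. F (Complex v (y + u)))"
      using y pv by (intro continuous_on_strip_line[OF F]) (auto intro!: continuous_intros)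
    have "integral {-h..h} (\<lambda>u. cosh_kernel w u * norm (F (Complex v (y + u)))) \<le> integral {-h..h} (\<lambda>u. norm (F (Complex v (y + u))))"
    proof (rule integral_le)
      show "(\<lambda>u. cosh_kernel w u * norm (F (Complex v (y + u)))) integrable_on {-h..h}"
        "(\<lambda>u. norm (F (Complex v (y + u)))) integrable_on {-h..h}"
        using c w by (intro integrable_continuous_real continuous_intros; simp)+
    qed (simp add: mult_left_le_one_le cosh_kernel_le_1 less_imp_le[OF cosh_kernel_pos])
    also have "\<dots> = integral {y - h..y + h} (\<lambda>t. norm (F (Complex v t)))"
      using integral_shift_Icc_real[of "-h" h "\<lambda>t. norm (F (Complex v t))" y] by (simp add: o_def add.commute)
    also have "\<dots> \<le> N" using y w by (intro FN) auto
    finally have I: "integral {-h..h} (\<lambda>u. cosh_kernel w u * norm (F (Complex v (y + u)))) \<le> N" .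
    have "norm (cosh_average w h F (Complex v y)) \<le> integral {-h..h} (\<lambda>u. cosh_kernel w u * norm (F (Complex v (y + u)))) / m" by (rule pt[OF y])
    also have "\<dots> \<le> N / (w / 4)"
    proof (rule frac_le)
      show "0 \<le> N" using I by (rule order_trans[rotated]) (auto intro!: integral_nonneg integrable_continuous_real continuous_intros c w simp: less_imp_le[OF cosh_kernel_pos])
    qed (use I m w in auto)
    finally show ?thesis by (simp add: field_simps)
  qed
  show "strip_class v p k (\<alpha> + h) (\<beta> - h) (1 + \<delta>) N (cosh_average w h F)"
    unfolding strip_class_def
  proof (intro conjI allI impI)
    show "cosh_average w h F holomorphic_on {z. p < Re z \<and> \<alpha> + h < Im z \<and> Im z < \<beta> - h}"
      by (rule holomorphic_cosh_average[OF F w(1,3)])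
    show "norm (cosh_average w h F z) \<le> 1 + \<delta>" if "v \<le> Re z \<and> Re z \<le> 1 \<and> \<alpha> + h < Im z \<and> Im z < \<beta> - h" for z
      using b2[of z] that norm_triangle_ineq[of "cosh_average w h F z - 1" 1] by simp
    show "norm (cosh_average w h F z - 1) \<le> k / Re z" if "0 < Re z \<and> Re z \<le> 1 \<and> \<alpha> + h < Im z \<and> Im z < \<beta> - h" for z
      using that p by (intro b1) auto
    fix a b assume ab: "\<alpha> + h < a \<and> a \<le> b \<and> b < \<beta> - h"
    have cc: "continuous_on ({a..b} \<times> {-h..h}) (\<lambda>x. cosh_kernel w (snd x) * norm (F (Complex v (fst x + snd x))))"
    proof (intro continuous_on_mult)
      show "continuous_on ({a..b} \<times> {-h..h}) (\<lambda>x. cosh_kernel w (snd x))"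
        by (rule continuous_on_compose2[OF continuous_on_cosh_kernel[of w UNIV]]) (use w in \<open>auto intro!: continuous_intros\<close>)
      have "continuous_on {a-h..b+h} (\<lambda>y. F (Complex v y))"
        using ab pv by (intro continuous_on_strip_line[OF F]) (auto intro!: continuous_intros)
      then show "continuous_on ({a..b} \<times> {-h..h}) (\<lambda>x. norm (F (Complex v (fst x + snd x))))"
        by (intro continuous_on_norm) (rule continuous_on_compose2, auto intro!: continuous_intros)
    qed
    have "integral {a..b} (\<lambda>y. norm (cosh_average w h F (Complex v y))) \<le>
       integral {a..b} (\<lambda>y. integral {-h..h} (\<lambda>u. cosh_kernel w u * norm (F (Complex v (y + u)))) / m)"
    proof (rule integral_le)
      show "(\<lambda>y. norm (cosh_average w h F (Complex v y))) integrable_on {a..b}"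
        by (intro integrable_continuous_real continuous_on_norm continuous_on_strip_line[OF holomorphic_cosh_average[OF F w(1,3)]])
           (use ab pv in auto)
      have "continuous_on (cbox a b) (\<lambda>y. integral (cbox (-h) h) (\<lambda>u. cosh_kernel w u * norm (F (Complex v (y + u)))))"
        by (rule integral_continuous_on_param) (use cc in \<open>simp add: case_prod_unfold cbox_interval\<close>)
      then show "(\<lambda>y. integral {-h..h} (\<lambda>u. cosh_kernel w u * norm (F (Complex v (y + u)))) / m) integrable_on {a..b}"
        using m0 by (intro integrable_continuous_real continuous_intros) (auto simp: cbox_interval)
    qed (use ab pt in auto)
    also have "\<dots> = integral {a..b} (\<lambda>y. integral {-h..h} (\<lambda>u. cosh_kernel w u * norm (F (Complex v (y + u))))) / m" by simp
    \<comment> \<open>After the interchange the inner integral is over the translate of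
      \<open>{a..b}\<close> by \<open>u\<close>. It still lies between \<open>\<alpha>\<close> and
      \<open>\<beta>\<close>, so \<open>N\<close> is inherited.\<close>
    also have "integral {a..b} (\<lambda>y. integral {-h..h} (\<lambda>u. cosh_kernel w u * norm (F (Complex v (y + u)))))
       = integral {-h..h} (\<lambda>u. integral {a..b} (\<lambda>y. cosh_kernel w u * norm (F (Complex v (y + u)))))"
    proof -
      have "continuous_on (cbox (a, -h) (b, h)) (\<lambda>(y, u). cosh_kernel w u * norm (F (Complex v (y + u))))"
        unfolding cbox_Pair_eq case_prod_unfold using cc by (simp only: cbox_interval)
      from integral_swap_continuous[OF this] show ?thesis by (simp only: cbox_interval)
    qed
    also have "\<dots> \<le> integral {-h..h} (\<lambda>u. cosh_kernel w u * N)"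
    proof (rule integral_le)
      have "continuous_on ({-h..h} \<times> {a..b}) (\<lambda>x. cosh_kernel w (fst x) * norm (F (Complex v (snd x + fst x))))"
      proof -
        have "continuous_on ({-h..h} \<times> {a..b}) (\<lambda>x. (snd x, fst x))" by (auto intro!: continuous_intros)
        moreover have "(\<lambda>x. (snd x, fst x)) ` ({-h..h} \<times> {a..b}) \<subseteq> {a..b} \<times> {-h..h}" by auto
        ultimately show ?thesis using continuous_on_compose2[OF cc] by fastforce
      qed
      then have "continuous_on (cbox (-h) h) (\<lambda>u. integral (cbox a b) (\<lambda>y. cosh_kernel w u * norm (F (Complex v (y + u)))))"
        by (intro integral_continuous_on_param) (simp add: case_prod_unfold cbox_interval)
      then show "(\<lambda>u. integral {a..b} (\<lambda>y. cosh_kernel w u * norm (F (Complex v (y + u))))) integrable_on {-h..h}"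
        by (intro integrable_continuous_real) (auto simp: cbox_interval)
      show "(\<lambda>u. cosh_kernel w u * N) integrable_on {-h..h}"
        using w by (intro integrable_continuous_real continuous_intros) auto
      fix u assume u: "u \<in> {-h..h}"
      have "integral {a..b} (\<lambda>y. norm (F (Complex v (y + u)))) = integral {a + u..b + u} (\<lambda>y. norm (F (Complex v y)))"
        using integral_shift_Icc_real[of a b "\<lambda>t. norm (F (Complex v t))" u] by (simp add: o_def add.commute)
      also have "\<dots> \<le> N" using u ab by (intro FN) auto
      finally show "integral {a..b} (\<lambda>y. cosh_kernel w u * norm (F (Complex v (y + u)))) \<le> cosh_kernel w u * N"
        using cosh_kernel_pos[of w u] by (simp add: mult_left_mono)
    qed
    also have "integral {-h..h} (\<lambda>u. cosh_kernel w u * N) = m * N" by (simp add: m_def)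
    finally show "integral {a..b} (\<lambda>y. norm (cosh_average w h F (Complex v y))) \<le> N"
      using m0 by (simp add: divide_right_mono)
  qed
qed

subsection \<open>Maximum modulus arguments on rectangles\<close>

lemma maximum_modulus_rectangle:
  fixes f :: "complex \<Rightarrow> complex"
  assumes f: "f holomorphic_on U" "cbox (Complex x1 y1) (Complex x2 y2) \<subseteq> U"
    and B: "\<And>x y. x1 \<le> x \<Longrightarrow> x \<le> x2 \<Longrightarrow> y1 \<le> y \<Longrightarrow> y \<le> y2 \<Longrightarrow>
       x = x1 \<or> x = x2 \<or> y = y1 \<or> y = y2 \<Longrightarrow> norm (f (Complex x y)) \<le> B"
    and z: "z \<in> cbox (Complex x1 y1) (Complex x2 y2)"
  shows "norm (f z) \<le> B"
proof (rule maximum_modulus_frontier[OF _ _ bounded_cbox _ z])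
  let ?S = "cbox (Complex x1 y1) (Complex x2 y2)"
  show "f holomorphic_on interior ?S"
    using f interior_subset by (meson holomorphic_on_subset order_trans)
  show "continuous_on (closure ?S) f"
    using f by (simp add: holomorphic_on_imp_continuous_on holomorphic_on_subset)
  fix w assume "w \<in> frontier ?S"
  then have "w \<in> ?S" "w \<notin> box (Complex x1 y1) (Complex x2 y2)"
    by (auto simp: frontier_def)
  then show "norm (f w) \<le> B"
    using B[of "Re w" "Im w"] by (auto simp: in_cbox_complex_iff in_box_complex_iff)
qed

text \<open>
  The quotient of \<open>f\<close> by its reflection in the line \<open>Re z = \<beta>\<close> has modulus 1 on that line.
  With \<open>\<xi> = \<beta> + \<i> t - z\<close>, the real part of \<open>2 \<xi> / R - \<xi>\<^sup>2 / R\<^sup>2\<close> is nonnegative on the line, at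
  least 1 on the other three sides of the rectangle, and at most \<open>2 p / R\<close> at distance \<open>p\<close> from the line.
\<close>

lemma reflection_bound:
  fixes f :: "complex \<Rightarrow> complex"
  assumes f: "f holomorphic_on U" "open U"
    and sub: "\<And>x y. \<bar>x - \<beta>\<bar> \<le> R \<Longrightarrow> \<bar>y - t\<bar> \<le> R \<Longrightarrow> Complex x y \<in> U"
    and R: "R > 0" and p: "0 \<le> p" "p \<le> R"
    and M: "\<And>x y. \<beta> - R \<le> x \<Longrightarrow> x \<le> \<beta> \<Longrightarrow> \<bar>y - t\<bar> \<le> R \<Longrightarrow> norm (f (Complex x y)) \<le> M"
    and m: "0 < m" "\<And>x y. \<beta> \<le> x \<Longrightarrow> x \<le> \<beta> + R \<Longrightarrow> \<bar>y - t\<bar> \<le> R \<Longrightarrow> m \<le> norm (f (Complex x y))"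
  shows "norm (f (Complex (\<beta> - p) t)) \<le> norm (f (Complex (\<beta> + p) t)) * exp (ln (M / m) * (2 * p / R))"
proof -
  define \<Lambda> where "\<Lambda> = ln (M / m)"
  \<comment> \<open>Two conjugations keep the reflected function holomorphic. To the left of
    \<open>Re z = \<beta>\<close> it has the moduli of \<open>f\<close> on the right, so it is
    bounded below by \<open>m\<close> and may be divided by.\<close>
  define f' where "f' = (\<lambda>z. cnj (f (of_real (2 * \<beta>) - cnj z)))"
  define q where "q = (\<lambda>z. 2 * (Complex \<beta> t - z) / of_real R - (Complex \<beta> t - z)\<^sup>2 / of_real (R\<^sup>2))"
  define g where "g = (\<lambda>z. f z / f' z * exp (- (of_real \<Lambda> * q z)))"
  define S where "S = cbox (Complex (\<beta> - R) (t - R)) (Complex \<beta> (t + R))"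
  have f'C: "f' (Complex x y) = cnj (f (Complex (2 * \<beta> - x) y))" for x y
    unfolding f'_def by (rule arg_cong[where f = "\<lambda>z. cnj (f z)"]) (simp add: complex_eq_iff)
  have m': "m \<le> norm (f' (Complex x y))" if "\<beta> - R \<le> x" "x \<le> \<beta>" "\<bar>y - t\<bar> \<le> R" for x y
    unfolding f'C complex_mod_cnj using that by (intro m(2)) auto
  \<comment> \<open>Both bounds apply on \<open>Re z = \<beta>\<close>. The resulting sign
    \<open>\<Lambda> \<ge> 0\<close> allows multiplying the estimates for \<open>Re q\<close> by
    \<open>\<Lambda>\<close>.\<close>
  have mM: "m \<le> M" using m(2)[of \<beta> t] M[of \<beta> t] R by simp
  then have M0: "M > 0" and \<Lambda>0: "\<Lambda> \<ge> 0" using m by (auto simp: \<Lambda>_def)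
  have Req: "Re (q (Complex x y)) = 2 * (\<beta> - x) / R - ((\<beta> - x)\<^sup>2 - (t - y)\<^sup>2) / R\<^sup>2" for x y
  proof -
    have "Complex \<beta> t - Complex x y = Complex (\<beta> - x) (t - y)" by (simp add: complex_eq_iff)
    then show ?thesis unfolding q_def
      by (simp only: minus_complex.sel Re_divide_of_real) (simp add: power2_eq_square)
  qed
  have U1: "open (U \<inter> {z. of_real (2 * \<beta>) - cnj z \<in> U})"
  proof -
    have "open ((\<lambda>z. of_real (2 * \<beta>) - cnj z) -` U)"
      by (intro open_vimage f(2) continuous_intros)
    then show ?thesis using f(2) by (simp add: vimage_def open_Int)
  qed
  have cn: "(\<lambda>z. cnj (f (of_real (2 * \<beta>) - cnj z))) holomorphic_on {z. of_real (2 * \<beta>) - cnj z \<in> U}"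
  proof -
    have o: "open {z. of_real (2 * \<beta>) - cnj z \<in> U}"
      using open_vimage[OF f(2), of "\<lambda>z. of_real (2 * \<beta>) - cnj z"] by (simp add: vimage_def continuous_intros)
    have "(\<lambda>z. f (of_real (2 * \<beta>) - z)) holomorphic_on cnj ` {z. of_real (2 * \<beta>) - cnj z \<in> U}"
      by (rule holomorphic_on_compose_gen[OF _ f(1), unfolded o_def]) (auto intro!: holomorphic_intros)
    from holomorphic_on_compose_cnj_cnj[OF this o] show ?thesis by (simp add: o_def)
  qed
  define V where "V = U \<inter> {z. of_real (2 * \<beta>) - cnj z \<in> U} \<inter> {z. f' z \<noteq> 0}"
  have g: "g holomorphic_on V"
    unfolding g_def
  proof (intro holomorphic_intros)
    show "f holomorphic_on V" by (rule holomorphic_on_subset[OF f(1)]) (auto simp: V_def)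
    show "f' holomorphic_on V" unfolding f'_def by (rule holomorphic_on_subset[OF cn]) (auto simp: V_def)
    show "q holomorphic_on V" unfolding q_def using R by (intro holomorphic_intros) auto
  qed (auto simp: V_def)
  have SV: "S \<subseteq> V"
  proof
    fix z assume "z \<in> S"
    then obtain x y where z: "z = Complex x y" "\<beta> - R \<le> x" "x \<le> \<beta>" "\<bar>y - t\<bar> \<le> R"
      by (cases z) (auto simp: S_def in_cbox_complex_iff)
    have "of_real (2 * \<beta>) - cnj z = Complex (2 * \<beta> - x) y" by (simp add: z complex_eq_iff)
    moreover have "Complex (2 * \<beta> - x) y \<in> U" "Complex x y \<in> U" using z by (auto intro!: sub)
    moreover have "f' z \<noteq> 0" using m'[of x y] m z by auto
    ultimately show "z \<in> V" by (simp add: V_def z(1))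
  qed
  have ng: "norm (g z) = norm (f z) / norm (f' z) * exp (- (\<Lambda> * Re (q z)))" for z
    by (simp add: g_def norm_mult norm_divide)
  have "norm (g (Complex (\<beta> - p) t)) \<le> 1"
  proof (rule maximum_modulus_rectangle[OF g])
    show "cbox (Complex (\<beta> - R) (t - R)) (Complex \<beta> (t + R)) \<subseteq> V" using SV by (simp add: S_def)
    show "Complex (\<beta> - p) t \<in> cbox (Complex (\<beta> - R) (t - R)) (Complex \<beta> (t + R))"
      using p R by (auto simp: in_cbox_complex_iff)
    fix x y assume xy: "\<beta> - R \<le> x" "x \<le> \<beta>" "t - R \<le> y" "y \<le> t + R"
      and bd: "x = \<beta> - R \<or> x = \<beta> \<or> y = t - R \<or> y = t + R"
    have ay: "\<bar>y - t\<bar> \<le> R" using xy by auto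
    show "norm (g (Complex x y)) \<le> 1"
    proof (cases "x = \<beta>")
      case True
      have "norm (f' (Complex x y)) = norm (f (Complex x y))" using True by (simp add: f'C)
      moreover have "Re (q (Complex x y)) \<ge> 0" unfolding Req using True by simp
      ultimately show ?thesis unfolding ng using \<Lambda>0 by auto
    next
      case False
      define r where "r = (\<beta> - x) / R"
      have r: "0 \<le> r" "r \<le> 1" using xy R by (auto simp: r_def)
      have "Re (q (Complex x y)) = 2 * r - r\<^sup>2 + ((t - y) / R)\<^sup>2"
        unfolding Req r_def using R by (simp add: field_simps power2_eq_square)
      moreover have "r = 1 \<or> ((t - y) / R)\<^sup>2 = 1"
        using bd False R by (auto simp: r_def power2_eq_square)
      moreover have "r\<^sup>2 \<le> r" using r by (simp add: power2_eq_square mult_left_le)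
      ultimately have q1: "Re (q (Complex x y)) \<ge> 1"
        using r zero_le_power2[of "(t - y) / R"] by auto
      have "norm (f (Complex x y)) / norm (f' (Complex x y)) \<le> M / m"
        using M[OF xy(1,2) ay] m'[OF xy(1,2) ay] m(1) M0 by (intro frac_le) auto
      also have "M / m = exp \<Lambda>" using M0 m by (simp add: \<Lambda>_def)
      finally have "norm (g (Complex x y)) \<le> exp \<Lambda> * exp (- (\<Lambda> * Re (q (Complex x y))))"
        unfolding ng by (intro mult_right_mono) auto
      also have "\<dots> = exp (\<Lambda> - \<Lambda> * Re (q (Complex x y)))" by (simp flip: exp_add)
      also have "\<dots> \<le> exp 0"
        unfolding exp_le_cancel_iff using \<Lambda>0 q1 by (simp add: mult_le_cancel_left1)
      finally show ?thesis by simp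
    qed
  qed
  then have "norm (f (Complex (\<beta> - p) t)) \<le> norm (f' (Complex (\<beta> - p) t)) * exp (\<Lambda> * Re (q (Complex (\<beta> - p) t)))"
  proof -
    have "norm (f' (Complex (\<beta> - p) t)) > 0" using m'[of "\<beta> - p" t] p R m(1) by auto
    moreover assume "norm (g (Complex (\<beta> - p) t)) \<le> 1"
    ultimately show ?thesis unfolding ng by (simp add: exp_minus divide_le_eq field_simps del: zero_less_norm_iff)
  qed
  also have "f' (Complex (\<beta> - p) t) = cnj (f (Complex (\<beta> + p) t))" unfolding f'C by simp
  also have "norm (cnj (f (Complex (\<beta> + p) t))) * exp (\<Lambda> * Re (q (Complex (\<beta> - p) t))) \<le>
     norm (f (Complex (\<beta> + p) t)) * exp (\<Lambda> * (2 * p / R))"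
  proof -
    have "Re (q (Complex (\<beta> - p) t)) \<le> 2 * p / R" unfolding Req by simp
    then have "\<Lambda> * Re (q (Complex (\<beta> - p) t)) \<le> \<Lambda> * (2 * p / R)"
      using \<Lambda>0 by (rule mult_left_mono)
    then show ?thesis by (intro mult_mono) auto
  qed
  finally show ?thesis by (simp add: \<Lambda>_def)
qed

text \<open>
  A primitive of \<open>f\<close> is small on the whole left side once \<open>f\<close> has small mean there. The exponential
  weight, whose exponent is positive only away from the other three sides, carries this smallness
  to a disc around \<open>x0 + 2 + \<i> / 2\<close>, where Cauchy's inequality returns to \<open>f\<close>.
\<close>

lemma two_constants:
  fixes b B :: real
  assumes b: "0 < b"
  obtains c where "c > 0"
    "\<And>f U x0 N. f holomorphic_on U \<Longrightarrow> open U \<Longrightarrow> convex U \<Longrightarrow>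
      (\<And>x y. x0 \<le> x \<Longrightarrow> x \<le> x0 + 3 \<Longrightarrow> 0 \<le> y \<Longrightarrow> y \<le> 1 \<Longrightarrow> Complex x y \<in> U \<and> norm (f (Complex x y)) \<le> B) \<Longrightarrow>
      b \<le> norm (f (Complex (x0 + 2) (1/2))) \<Longrightarrow>
      integral {0..1} (\<lambda>y. norm (f (Complex x0 y))) \<ge> c"
proof -
  \<comment> \<open>A lower bound for the real part of the exponent \<open>q\<close> on the disc of
    radius \<open>1/4\<close> about \<open>x0 + 2 + \<i> / 2\<close>, where
    \<open>x - x0 \<le> 9/4\<close> and the cosine is at least
    \<open>cos (pi / 4) \<ge> 1/2\<close>.\<close>
  define q0 where "q0 = exp (- (9/4) * pi) / 2 - exp (- 3 * pi)"
  have q0: "q0 > 0"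
  proof -
    have "2 < exp (3/4 * pi)"
    proof -
      have "1 + 3/4 * pi \<le> exp (3/4 * pi)" by (rule exp_ge_add_one_self)
      then show ?thesis using pi_gt3 by linarith
    qed
    then have "exp (- 3 * pi) * 2 < exp (- 3 * pi) * exp (3/4 * pi)" by (intro mult_strict_left_mono) auto
    also have "\<dots> = exp (- (9/4) * pi)" by (simp add: field_simps flip: exp_add)
    finally show ?thesis by (simp add: q0_def)
  qed
  \<comment> \<open>So large that \<open>b \<le> 4 * K * exp (- (\<mu> * q0))\<close> cannot hold
    with \<open>K = 4 * B\<close>; the maximum \<open>K\<close> must then come from the left
    side.\<close>
  define \<mu> where "\<mu> = \<bar>B\<bar> * 16 / b / q0"
  have \<mu>0: "\<mu> \<ge> 0" using b q0 by (simp add: \<mu>_def)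
  have \<mu>: "16 * \<bar>B\<bar> * exp (- (\<mu> * q0)) < b"
  proof -
    have "16 * \<bar>B\<bar> = b * (\<mu> * q0)" using b q0 by (simp add: \<mu>_def)
    also have "\<dots> < b * exp (\<mu> * q0)"
    proof (rule mult_strict_left_mono[OF _ b])
      show "\<mu> * q0 < exp (\<mu> * q0)" using exp_ge_add_one_self[of "\<mu> * q0"] by linarith
    qed
    finally show ?thesis by (simp add: exp_minus field_simps)
  qed
  define c where "c = b * exp (- \<mu>) / 4"
  show ?thesis
  proof (rule that[of c])
    show "c > 0" using b by (simp add: c_def)
    fix f U x0
    assume f: "f holomorphic_on U" "open U" "convex U"
      and fB: "\<And>x y. x0 \<le> x \<Longrightarrow> x \<le> x0 + 3 \<Longrightarrow> 0 \<le> y \<Longrightarrow> y \<le> 1 \<Longrightarrow> Complex x y \<in> U \<and> norm (f (Complex x y)) \<le> B"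
      and fb: "b \<le> norm (f (Complex (x0 + 2) (1/2)))"
    define N where "N = integral {0..1} (\<lambda>y. norm (f (Complex x0 y)))"
    obtain F0 where F0: "\<And>z. z \<in> U \<Longrightarrow> (F0 has_field_derivative f z) (at z)"
      using holomorphic_convex_primitive'[OF f(3,2,1)] f(2) by (metis at_within_open)
    define z0 where "z0 = Complex x0 (1/2)"
    define P where "P = (\<lambda>z. F0 z - F0 z0)"
    have P: "(P has_field_derivative f z) (at z)" if "z \<in> U" for z
      unfolding P_def using F0[OF that] by (auto intro!: derivative_eq_intros)
    have Ph: "P holomorphic_on U" using P f(2) by (auto simp: holomorphic_on_open)
    have B0: "B \<ge> 0" using fB[of x0 0] norm_ge_zero order_trans by (metis add_increasing2 order_refl zero_le_numeral zero_le_one)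
    have cf: "continuous_on {0..1} (\<lambda>y. f (Complex x0 y))"
      by (rule continuous_on_compose2[OF holomorphic_on_imp_continuous_on[OF f(1)]])
         (use fB in \<open>auto intro!: continuous_intros simp: Complex_eq\<close>)
    have N0: "N \<ge> 0" unfolding N_def
      by (intro integral_nonneg integrable_continuous_real continuous_on_norm cf) auto
    have sub_int: "norm (integral {s..t} (\<lambda>y. f (Complex x0 y) * \<i>)) \<le> N" if "0 \<le> s" "t \<le> 1" for s t
    proof -
      have cs: "continuous_on {s..t} (\<lambda>y. f (Complex x0 y))"
        by (rule continuous_on_subset[OF cf]) (use that in auto)
      have "norm (integral {s..t} (\<lambda>y. f (Complex x0 y) * \<i>)) \<le> integral {s..t} (\<lambda>y. norm (f (Complex x0 y)))"
        by (rule integral_norm_bound_integral)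
           (auto intro!: integrable_continuous_real continuous_intros cs simp: norm_mult)
      also have "\<dots> \<le> N" unfolding N_def
        by (rule integral_subset_le) (use that in \<open>auto intro!: integrable_continuous_real continuous_intros cs cf\<close>)
      finally show ?thesis .
    qed
    have ftc: "integral {s..t} (\<lambda>y. f (Complex x0 y) * \<i>) = P (Complex x0 t) - P (Complex x0 s)"
      if "0 \<le> s" "s \<le> t" "t \<le> 1" for s t
    proof (rule integral_unique, rule fundamental_theorem_of_calculus[OF that(2)])
      fix y assume y: "y \<in> {s..t}"
      have "((\<lambda>y. Complex x0 y) has_vector_derivative \<i>) (at y within {s..t})"
        unfolding Complex_eq by (auto intro!: derivative_eq_intros)
      moreover have "(P has_field_derivative f (Complex x0 y)) (at (Complex x0 y))"
        using y that fB by (intro P) auto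
      ultimately have "((P \<circ> (\<lambda>y. Complex x0 y)) has_vector_derivative (\<i> * f (Complex x0 y))) (at y within {s..t})"
        by (intro field_vector_diff_chain_within) (auto intro: has_field_derivative_at_within)
      then show "((\<lambda>y. P (Complex x0 y)) has_vector_derivative f (Complex x0 y) * \<i>) (at y within {s..t})"
        by (simp add: o_def mult.commute)
    qed
    have Pz0: "P z0 = 0" by (simp add: P_def)
    have Pleft: "norm (P (Complex x0 y)) \<le> N" if "0 \<le> y" "y \<le> 1" for y
    proof (cases "y \<le> 1/2")
      case True
      then have "norm (P (Complex x0 (1/2)) - P (Complex x0 y)) \<le> N"
        using ftc[of y "1/2"] sub_int[of y "1/2"] that by simp
      then show ?thesis using Pz0 by (simp add: z0_def)
    next
      case False
      then have "norm (P (Complex x0 y) - P (Complex x0 (1/2))) \<le> N"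
        using ftc[of "1/2" y] sub_int[of "1/2" y] that by simp
      then show ?thesis using Pz0 by (simp add: z0_def)
    qed
    let ?S = "cbox (Complex x0 0) (Complex (x0 + 3) 1)"
    have SU: "z \<in> U \<and> norm (f z) \<le> B" if "z \<in> ?S" for z
      using fB[of "Re z" "Im z"] that by (auto simp: in_cbox_complex_iff)
    have Pbd: "norm (P z) \<le> 4 * B" if z: "z \<in> ?S" for z
    proof -
      have z0S: "z0 \<in> ?S" by (simp add: z0_def in_cbox_complex_iff)
      have "norm (P z - P z0) \<le> B * norm (z - z0)"
      proof (rule field_differentiable_bound[of ?S P f])
        show "(P has_field_derivative f w) (at w within ?S)" if "w \<in> ?S" for w
          using SU[OF that] by (intro has_field_derivative_at_within[OF P]) auto
      qed (use SU z z0S in auto)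
      also have "\<dots> \<le> B * 4"
      proof (rule mult_left_mono[OF _ B0])
        have "norm (z - z0) \<le> \<bar>Re (z - z0)\<bar> + \<bar>Im (z - z0)\<bar>" by (rule cmod_le)
        also have "\<dots> \<le> 4" using z by (auto simp: in_cbox_complex_iff z0_def)
        finally show "norm (z - z0) \<le> 4" .
      qed
      finally show ?thesis using Pz0 by simp
    qed
    \<comment> \<open>In the real part the cosine of \<open>pi * (y - 1/2)\<close> vanishes for
      \<open>y = 0\<close> and \<open>y = 1\<close>, and the subtracted constant makes it
      nonpositive for \<open>x = x0 + 3\<close>. So the weight is at most 1 on the three sides where
      only the crude bound for \<open>P\<close> is known.\<close>
    define q where "q = (\<lambda>z. exp (- (of_real pi * (z - z0))) - of_real (exp (- 3 * pi)))"
    have Rq: "Re (q (Complex x y)) = exp (- (pi * (x - x0))) * cos (pi * (y - 1/2)) - exp (- 3 * pi)" for x y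
    proof -
      have 1: "- (of_real pi * (Complex x y - z0)) = Complex (- (pi * (x - x0))) (- (pi * (y - 1/2)))"
        by (simp add: z0_def complex_eq_iff)
      show ?thesis unfolding q_def 1
        by (simp only: minus_complex.sel Re_exp complex.sel cos_minus Re_complex_of_real)
    qed
    define K where "K = max (N * exp \<mu>) (4 * B)"
    have gb: "norm (P z * exp (of_real \<mu> * q z)) \<le> K" if z: "z \<in> ?S" for z
    proof (rule maximum_modulus_rectangle[of "\<lambda>z. P z * exp (of_real \<mu> * q z)" U, OF _ _ _ z])
      show "(\<lambda>z. P z * exp (of_real \<mu> * q z)) holomorphic_on U"
        unfolding q_def by (intro holomorphic_intros Ph)
      show "?S \<subseteq> U" using SU by blast
      fix x y :: real
      assume xy: "x0 \<le> x" "x \<le> x0 + 3" "0 \<le> y" "y \<le> 1"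
        and bd: "x = x0 \<or> x = x0 + 3 \<or> y = 0 \<or> y = 1"
      have ng: "norm (P (Complex x y) * exp (of_real \<mu> * q (Complex x y))) = norm (P (Complex x y)) * exp (\<mu> * Re (q (Complex x y)))"
        by (simp add: norm_mult)
      show "norm (P (Complex x y) * exp (of_real \<mu> * q (Complex x y))) \<le> K"
      proof (cases "x = x0")
        case True
        have "Re (q (Complex x y)) \<le> 1" unfolding Rq True by (simp add: cos_le_one add_increasing2 less_imp_le diff_le_eq)
        then have "exp (\<mu> * Re (q (Complex x y))) \<le> exp \<mu>" using \<mu>0 by (simp add: mult_left_le)
        then have "norm (P (Complex x y)) * exp (\<mu> * Re (q (Complex x y))) \<le> N * exp \<mu>"
          using Pleft xy True N0 by (intro mult_mono) auto
        then show ?thesis unfolding ng K_def by linarith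
      next
        case False
        have "Re (q (Complex x y)) \<le> 0"
        proof (cases "x = x0 + 3")
          case True
          have "exp (- (pi * 3)) * cos (pi * (y - 1/2)) \<le> exp (- (pi * 3)) * 1"
            by (intro mult_left_mono) auto
          then show ?thesis unfolding Rq using True by (simp add: mult.commute)
        next
          case x: False
          then have "y = 0 \<or> y = 1" using bd False by auto
          then have "cos (pi * (y - 1/2)) = 0" by (auto simp: cos_minus)
          then show ?thesis unfolding Rq by simp
        qed
        then have "exp (\<mu> * Re (q (Complex x y))) \<le> 1" using \<mu>0 by (simp add: mult_le_0_iff)
        then have "norm (P (Complex x y)) * exp (\<mu> * Re (q (Complex x y))) \<le> 4 * B * 1"
          using Pbd[of "Complex x y"] xy B0 by (intro mult_mono) (auto simp: in_cbox_complex_iff)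
        then show ?thesis unfolding ng K_def by linarith
      qed
    qed
    define z1 where "z1 = Complex (x0 + 2) (1/2)"
    have ball_S: "cball z1 (1/4) \<subseteq> ?S" and q_ball: "\<And>z. z \<in> cball z1 (1/4) \<Longrightarrow> Re (q z) \<ge> q0"
    proof -
      have 1: "\<bar>Re z - (x0 + 2)\<bar> \<le> 1/4 \<and> \<bar>Im z - 1/2\<bar> \<le> 1/4" if "z \<in> cball z1 (1/4)" for z
        using that abs_Re_le_cmod[of "z - z1"] abs_Im_le_cmod[of "z - z1"]
        by (auto simp: dist_norm norm_minus_commute z1_def)
      show "cball z1 (1/4) \<subseteq> ?S"
      proof
        fix z assume "z \<in> cball z1 (1/4)"
        from 1[OF this] have "x0 \<le> Re z" "Re z \<le> x0 + 3" "0 \<le> Im z" "Im z \<le> 1" by linarith+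
        then show "z \<in> ?S" by (simp add: in_cbox_complex_iff)
      qed
      fix z assume z: "z \<in> cball z1 (1/4)"
      obtain x y where xy: "z = Complex x y" by (cases z)
      have "\<bar>pi * (y - 1/2)\<bar> \<le> pi / 4" using 1[OF z] xy by (simp add: abs_mult)
      then have "cos (pi / 4) \<le> cos \<bar>pi * (y - 1/2)\<bar>" by (intro cos_monotone_0_pi_le) auto
      moreover have "cos (pi / 4) \<ge> 1/2" using real_le_rsqrt[of 1 2] by (simp add: cos_45)
      ultimately have c: "cos (pi * (y - 1/2)) \<ge> 1/2" by (simp only: cos_abs_real)
      have "x - x0 \<le> 9/4" using 1[OF z] unfolding xy complex.sel by linarith
      then have "pi * (x - x0) \<le> pi * (9/4)" by (intro mult_left_mono) auto
      then have "exp (- (9/4) * pi) \<le> exp (- (pi * (x - x0)))" by (simp add: mult.commute)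
      then have "exp (- (9/4) * pi) * (1/2) \<le> exp (- (pi * (x - x0))) * cos (pi * (y - 1/2))"
        using c by (intro mult_mono) auto
      then show "Re (q z) \<ge> q0" unfolding xy Rq q0_def by simp
    qed
    have P_ball: "norm (P z) \<le> K * exp (- (\<mu> * q0))" if z: "z \<in> cball z1 (1/4)" for z
    proof -
      have "norm (P z) * exp (\<mu> * q0) \<le> norm (P z) * exp (\<mu> * Re (q z))"
        using q_ball[OF z] \<mu>0 by (intro mult_left_mono) (auto intro: mult_left_mono)
      also have "\<dots> = norm (P z * exp (of_real \<mu> * q z))" by (simp add: norm_mult)
      also have "\<dots> \<le> K" using z ball_S by (intro gb) auto
      finally show ?thesis by (simp add: exp_minus field_simps)
    qed
    have bS: "cball z1 (1/4) \<subseteq> U" using ball_S SU by blast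
    \<comment> \<open>The circle of radius \<open>1/4\<close> about \<open>z1\<close> recovers the
      value of \<open>f\<close>, the derivative of \<open>P\<close>, at the cost of a factor
      4.\<close>
    have "norm ((deriv ^^ 1) P z1) \<le> fact 1 * (K * exp (- (\<mu> * q0))) / (1/4) ^ 1"
    proof (rule Cauchy_inequality)
      show "P holomorphic_on ball z1 (1/4)" using Ph bS by (meson ball_subset_cball holomorphic_on_subset order_trans)
      show "continuous_on (cball z1 (1/4)) P" using Ph bS by (meson holomorphic_on_imp_continuous_on continuous_on_subset)
      show "norm (P x) \<le> K * exp (- (\<mu> * q0))" if "norm (z1 - x) = 1/4" for x
        by (rule P_ball) (use that in \<open>simp add: dist_norm\<close>)
    qed auto
    moreover have "deriv P z1 = f z1" using bS by (intro DERIV_imp_deriv P) auto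
    ultimately have "b \<le> 4 * K * exp (- (\<mu> * q0))" using fb by (simp add: z1_def)
    moreover have "4 * (4 * B) * exp (- (\<mu> * q0)) < b" using \<mu> B0 by simp
    ultimately have "K \<noteq> 4 * B" by auto
    then have KN: "K = N * exp \<mu>" by (auto simp: K_def max_def)
    have "b \<le> 4 * K * 1"
      using \<open>b \<le> 4 * K * exp (- (\<mu> * q0))\<close> \<mu>0 q0 KN N0 by (elim order_trans) (intro mult_left_mono, auto)
    then have "b * exp (- \<mu>) / 4 \<le> N" by (simp add: KN exp_minus field_simps)
    then show "c \<le> integral {0..1} (\<lambda>y. norm (f (Complex x0 y)))" by (simp add: c_def N_def)
  qed
qed

subsection \<open>Averaging over decreasing scales\<close>

lemma strip_class_mono_bound:
  "strip_class v p k \<alpha> \<beta> B N F \<Longrightarrow> B \<le> B' \<Longrightarrow> strip_class v p k \<alpha> \<beta> B' N F"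
  unfolding strip_class_def by (meson order_trans)

text \<open>
  The averaging widths \<open>6 * w j * ln (Y j)\<close> make the bound \<open>exp (3 * Y (j + 1))\<close>
  drop to \<open>exp (3 * Y j)\<close> in one step.
\<close>

lemma strip_class_descent:
  fixes Y w :: "nat \<Rightarrow> real"
  assumes Y0: "Y 0 \<ge> 16" and YS: "\<And>j. Y (Suc j) = (Y j)\<^sup>2"
    and w: "\<And>j. 1 / Y j \<le> w j" "\<And>j. w j \<le> 1" "\<And>j. w (Suc j) \<le> w j"
    and k: "0 \<le> k" "k \<le> w 0 / 320" and p: "p \<le> 0" "p < v"
    and S: "strip_class v p k \<alpha> \<beta> (exp (3 * Y (Suc j))) N F"
    and v: "\<bar>v\<bar> \<le> w j" and len: "12 * (\<Sum>i\<le>j. w i * ln (Y i)) < \<beta> - \<alpha>"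
  shows "N \<ge> w 0 / 8"
proof -
  have Y16: "Y j \<ge> 16" for j
  proof (induction j)
    case (Suc j)
    have "16 * 1 \<le> Y j * Y j" using Suc by (intro mult_mono) auto
    then show ?case by (simp add: YS power2_eq_square)
  qed (rule Y0)
  have w0: "w j > 0" for j using w(1)[of j] Y16[of j] by (smt (verit) divide_pos_pos)
  define \<delta> where "\<delta> = (\<lambda>j. 80 * k / w j + 16 * (exp (3 * Y (Suc j)) + 1) * exp (- exp (6 * w j * ln (Y j) / (2 * w j)) / 4))"
  have \<delta>: "\<delta> j \<le> 80 * k / w j + 1 / 4" for j
  proof -
    have Yp: "Y j > 0" using Y16[of j] by simp
    \<comment> \<open>The width 6 makes the window ends as small as
      \<open>exp (- (Y j ^ 3) / 4)\<close>, and \<open>Y j \<ge> 16\<close> turns the cube into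
      \<open>16 * (Y j)\<^sup>2\<close>. Thus \<open>exp (- (4 * Y (Suc j)))\<close> meets the bound
      \<open>exp (3 * Y (Suc j))\<close>.\<close>
    have "6 * w j * ln (Y j) / (2 * w j) = real 3 * ln (Y j)" using w0[of j] by simp
    then have "exp (6 * w j * ln (Y j) / (2 * w j)) = Y j ^ 3"
      using Yp by (simp only: exp_of_nat_mult exp_ln)
    also have "\<dots> \<ge> 16 * Y (Suc j)"
      unfolding YS using Y16[of j] by (simp add: power3_eq_cube power2_eq_square)
    finally have "exp (- exp (6 * w j * ln (Y j) / (2 * w j)) / 4) \<le> exp (- (4 * Y (Suc j)))" by simp
    then have "(exp (3 * Y (Suc j)) + 1) * exp (- exp (6 * w j * ln (Y j) / (2 * w j)) / 4)
        \<le> (2 * exp (3 * Y (Suc j))) * exp (- (4 * Y (Suc j)))"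
      using Y16[of "Suc j"] by (intro mult_mono) auto
    also have "\<dots> = 2 * exp (- Y (Suc j))" by (simp add: mult.assoc flip: exp_add)
    finally have 0: "(exp (3 * Y (Suc j)) + 1) * exp (- exp (6 * w j * ln (Y j) / (2 * w j)) / 4) \<le> 2 * exp (- Y (Suc j))" .
    have 1: "16 * (exp (3 * Y (Suc j)) + 1) * exp (- exp (6 * w j * ln (Y j) / (2 * w j)) / 4) \<le> 16 * (2 * exp (- Y (Suc j)))"
      using mult_left_mono[OF 0, of 16] by (simp only: mult.assoc)
    have "Y (Suc j) \<ge> 16 * 16" unfolding YS power2_eq_square using Y16[of j] by (intro mult_mono) auto
    then have "exp (Y (Suc j)) \<ge> 128" using exp_ge_add_one_self[of "Y (Suc j)"] by linarith
    then have "32 * exp (- Y (Suc j)) \<le> 1 / 4" by (simp add: exp_minus field_simps)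
    with 1 show ?thesis unfolding \<delta>_def by linarith
  qed
  have h: "w j \<le> 6 * w j * ln (Y j)" for j
  proof -
    have "1 \<le> ln (Y j)"
    proof -
      have "exp 1 \<le> Y j" using Y16[of j] e_less_272 by linarith
      then show ?thesis using Y16[of j] by (simp add: ln_ge_iff)
    qed
    then have "w j * 1 \<le> w j * (6 * ln (Y j))" using w0[of j] by (intro mult_left_mono) auto
    then show ?thesis by (simp add: mult_ac)
  qed
  show ?thesis
    using S v len
  proof (induction j arbitrary: F \<alpha> \<beta>)
    case (0 F \<alpha> \<beta>)
    \<comment> \<open>By the length hypothesis the last window fits on both sides of the midpoint.
      There \<open>k \<le> w 0 / 320\<close> keeps the average within \<open>1/4 + 1/4\<close> of
      1.\<close>
    define y where "y = (\<alpha> + \<beta>) / 2"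
    have y: "\<alpha> + 6 * w 0 * ln (Y 0) < y" "y < \<beta> - 6 * w 0 * ln (Y 0)"
      using 0(3) by (auto simp: y_def field_simps)
    note st = strip_class_step[OF 0(1) p(2,1) 0(2) w0 w(2) h k(1) exp_ge_zero]
    have "norm (cosh_average (w 0) (6 * w 0 * ln (Y 0)) F (Complex v y) - 1) \<le> \<delta> 0"
      unfolding \<delta>_def using st(2)[of "Complex v y"] y 0(2) w(2)[of 0] by simp
    also have "\<dots> \<le> 80 * k / w 0 + 1/4" by (rule \<delta>)
    also have "\<dots> \<le> 1 / 2" using k w0[of 0] by (simp add: field_simps)
    finally have "norm (cosh_average (w 0) (6 * w 0 * ln (Y 0)) F (Complex v y)) \<ge> 1 / 2"
      using norm_triangle_ineq2[of 1 "1 - cosh_average (w 0) (6 * w 0 * ln (Y 0)) F (Complex v y)"]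
      by (simp add: norm_minus_commute)
    moreover have "norm (cosh_average (w 0) (6 * w 0 * ln (Y 0)) F (Complex v y)) \<le> 4 / w 0 * N"
      using y by (intro st(3)) auto
    ultimately have "1 / 2 \<le> 4 / w 0 * N" by linarith
    then show ?case using w0[of 0] by (simp add: field_simps)
  next
    case (Suc j F \<alpha> \<beta>)
    let ?h = "6 * w (Suc j) * ln (Y (Suc j))"
    note st = strip_class_step[OF Suc(2) p(2,1) Suc(3) w0 w(2) h k(1) exp_ge_zero]
    have "1 + \<delta> (Suc j) \<le> 1 + (80 * k / w (Suc j) + 1 / 4)" using \<delta>[of "Suc j"] by simp
    also have "80 * k / w (Suc j) \<le> 1 / w (Suc j)"
      using k w(2)[of 0] w0[of "Suc j"] by (intro divide_right_mono) auto
    also have "\<dots> \<le> Y (Suc j)" using w(1)[of "Suc j"] w0[of "Suc j"] Y16[of "Suc j"] by (simp add: field_simps)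
    also have "1 + (Y (Suc j) + 1 / 4) \<le> exp (3 * Y (Suc j))"
      using exp_ge_add_one_self[of "3 * Y (Suc j)"] Y16[of "Suc j"] by linarith
    finally have "1 + \<delta> (Suc j) \<le> exp (3 * Y (Suc j))" by simp
    from strip_class_mono_bound[OF st(1)[folded \<delta>_def] this[unfolded \<delta>_def]]
    have "strip_class v p k (\<alpha> + ?h) (\<beta> - ?h) (exp (3 * Y (Suc j))) N (cosh_average (w (Suc j)) ?h F)" .
    moreover have "\<bar>v\<bar> \<le> w j" using Suc(3) w(3)[of j] by linarith
    moreover have "12 * (\<Sum>i\<le>j. w i * ln (Y i)) < (\<beta> - ?h) - (\<alpha> + ?h)" using Suc(4) by simp
    ultimately show ?case by (rule Suc.IH)
  qed
qed

section \<open>Consequences of the hypotheses on \<omega>\<close>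

locale decay_function =
  fixes \<omega> :: "real \<Rightarrow> real"
  assumes pos: "\<And>x. x \<ge> 0 \<Longrightarrow> \<omega> x > 0"
    and eq_1: "\<And>x. 0 \<le> x \<Longrightarrow> x \<le> 1 \<Longrightarrow> \<omega> x = 1"
    and mono_mult: "mono_on {1..} (\<lambda>x. x * \<omega> x)"
    and mono_inverse: "mono_on {1..} (\<lambda>x. 1 / \<omega> x)"
    and integrable: "set_integrable lborel {1..} (\<lambda>x. \<omega> x / x)"
begin

lemma antimono: "1 \<le> x \<Longrightarrow> x \<le> y \<Longrightarrow> \<omega> y \<le> \<omega> x"
  using mono_onD[OF mono_inverse, of x y] pos[of x] pos[of y] by (simp add: field_simps)

lemma le_1: "0 \<le> x \<Longrightarrow> \<omega> x \<le> 1"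
  using antimono[of 1 x] eq_1[of 1] eq_1[of x] by (cases "x \<le> 1") auto

lemma ge_inverse: "1 \<le> x \<Longrightarrow> 1 / x \<le> \<omega> x"
  using mono_onD[OF mono_mult, of 1 x] eq_1[of 1] by (simp add: field_simps)

lemma integrable_on: "1 \<le> a \<Longrightarrow> (\<lambda>x. \<omega> x / x) integrable_on {a..b}"
proof -
  assume a: "1 \<le> a"
  have "set_integrable lborel {a..b} (\<lambda>x. \<omega> x / x)"
    by (rule set_integrable_subset[OF integrable]) (use a in auto)
  then show ?thesis by (rule set_borel_integral_eq_integral)
qed

text \<open>\<open>\<omega>\<close> is smallest at the right end of the interval. For
  \<open>b = a\<^sup>2\<close> the left side is half of \<open>\<omega> b * ln b\<close>; in this
  way window lengths are charged to disjoint pieces of the integral.\<close>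

lemma ln_diff_le_integral:
  assumes a: "1 \<le> a" "a \<le> b"
  shows "\<omega> b * (ln b - ln a) \<le> integral {a..b} (\<lambda>x. \<omega> x / x)"
proof -
  have I: "((\<lambda>x. \<omega> b * (1 / x)) has_integral (\<omega> b * (ln b - ln a))) {a..b}"
  proof (intro has_integral_mult_right fundamental_theorem_of_calculus a(2))
    fix x assume "x \<in> {a..b}"
    then show "(ln has_vector_derivative 1 / x) (at x within {a..b})"
      unfolding has_real_derivative_iff_has_vector_derivative[symmetric]
      using a by (auto intro!: derivative_eq_intros)
  qed
  show ?thesis
  proof (rule has_integral_le[OF I integrable_integral[OF integrable_on[OF a(1)]]])
    fix x assume x: "x \<in> {a..b}"
    have "\<omega> b * (1 / x) \<le> \<omega> x * (1 / x)"
      using antimono[of x b] a x by (intro mult_right_mono) auto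
    then show "\<omega> b * (1 / x) \<le> \<omega> x / x" by simp
  qed
qed

lemma integral_nonneg': "1 \<le> a \<Longrightarrow> 0 \<le> integral {a..b} (\<lambda>x. \<omega> x / x)"
  by (intro integral_nonneg integrable_on) (auto intro!: divide_nonneg_nonneg less_imp_le[OF pos])

text \<open>The integrals up to integers increase and are bounded, hence form a Cauchy sequence. As
  the integrand is nonnegative, its tails control every upper limit \<open>b\<close>.\<close>

lemma small_tail:
  assumes "e > 0"
  obtains R where "R \<ge> A" "R \<ge> 1" "\<And>b. integral {R..b} (\<lambda>x. \<omega> x / x) \<le> e"
proof -
  define f where "f = (\<lambda>x. \<omega> x / x)"
  define g where "g = (\<lambda>n. integral {1..1 + real n} f)"
  have io: "f integrable_on {1..}"
    unfolding f_def using integrable by (rule set_borel_integral_eq_integral)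
  have f0: "f x \<ge> 0" if "x \<ge> 1" for x
    unfolding f_def using that by (auto intro!: divide_nonneg_nonneg less_imp_le[OF pos])
  have comb: "integral {1..a} f + integral {a..b} f = integral {1..b} f" if "1 \<le> a" "a \<le> b" for a b
    using that integrable_on[of 1 b] unfolding f_def by (intro Henstock_Kurzweil_Integration.integral_combine) auto
  have "incseq g"
  proof (rule incseq_SucI)
    fix n
    show "g n \<le> g (Suc n)"
      using comb[of "1 + real n" "1 + real (Suc n)"] integral_nonneg'[of "1 + real n" "1 + real (Suc n)"]
      by (simp add: g_def f_def)
  qed
  moreover have "g n \<le> integral {1..} f" for n
    unfolding g_def using io f0 integrable_on[of 1 "1 + real n"]
    by (intro integral_subset_le) (auto simp: f_def)
  ultimately have "convergent g"
    using incseq_convergent[of g] by (metis convergent_def)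
  then have "Cauchy g" by (rule convergent_Cauchy)
  then obtain M where M: "\<And>m n. m \<ge> M \<Longrightarrow> n \<ge> M \<Longrightarrow> dist (g m) (g n) < e"
    using assms unfolding Cauchy_def by blast
  define n where "n = max M (nat \<lceil>A\<rceil>)"
  have nM: "n \<ge> M" by (simp add: n_def)
  show ?thesis
  proof (rule that[of "1 + real n"])
    show "1 + real n \<ge> A" unfolding n_def by linarith
    fix b
    show "integral {1 + real n..b} (\<lambda>x. \<omega> x / x) \<le> e"
    proof (cases "1 + real n \<le> b")
      case True
      define m where "m = max n (nat \<lceil>b\<rceil>)"
      have b: "b \<le> 1 + real m" unfolding m_def by linarith
      have mn: "n \<le> m" by (simp add: m_def)
      have "integral {1 + real n..b} f \<le> integral {1 + real n..1 + real m} f"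
        using b by (intro integral_subset_le) (auto simp: f_def intro!: integrable_on f0[unfolded f_def])
      also have "\<dots> = g m - g n" using comb[of "1 + real n" "1 + real m"] mn by (simp add: g_def)
      also have "\<dots> \<le> e" using M[of m n] mn nM by (simp add: dist_real_def)
      finally show ?thesis by (simp add: f_def)
    qed (use assms in auto)
  qed auto
qed

text \<open>The logarithm grows by 1 from \<open>R\<close> to \<open>R * exp 1\<close>, so a small
  tail of the integral forces \<open>\<omega>\<close> to be small at the right end.\<close>

lemma exists_small:
  assumes "e > 0"
  obtains X where "X \<ge> A" "X \<ge> 1" "\<omega> X \<le> e"
proof -
  obtain R where R: "R \<ge> A" "R \<ge> 1" "\<And>b. integral {R..b} (\<lambda>x. \<omega> x / x) \<le> e"
    using small_tail[OF assms] by blast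
  have ee: "R * 1 \<le> R * exp 1" using R by (intro mult_left_mono) auto
  have "\<omega> (R * exp 1) * (ln (R * exp 1) - ln R) \<le> e"
    using ln_diff_le_integral[of R "R * exp 1"] R(3)[of "R * exp 1"] R(2) ee by simp
  then have "\<omega> (R * exp 1) \<le> e" using R by (simp add: ln_mult)
  then show ?thesis using that[of "R * exp 1"] R ee by simp
qed

text \<open>The descent has two starting situations: a bound \<open>exp (3 * X)\<close> on a line
  that may lie to the left of 0, and a line slightly to the right of 0, where closeness to 1
  provides \<open>1 + k / v\<close>. They differ in how the first scale is selected; the constants
  come from \<open>\<omega>\<close> alone.\<close>

lemma strip_lower_bound:
  obtains w k X0 where "0 < w" "w \<le> 1" "0 < k" "k \<le> 1" "X0 \<ge> 1"
    "\<And>X v p B N F. strip_class v p k 0 1 B N F \<Longrightarrow> p < v \<Longrightarrow> p \<le> 0 \<Longrightarrow> X \<ge> X0 \<Longrightarrow> \<bar>v\<bar> \<le> \<omega> X \<Longrightarrow> B \<le> exp (3 * X)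
       \<Longrightarrow> N \<ge> w / 8"
    "\<And>v p N F. strip_class v p k 0 1 (1 + k / v) N F \<Longrightarrow> p < v \<Longrightarrow> p \<le> 0 \<Longrightarrow> 0 < v \<Longrightarrow> v \<le> w
       \<Longrightarrow> N \<ge> w / 8"
proof -
  \<comment> \<open>The windows use at most \<open>12 * 2 * (1 / 48) = 1/2\<close> of the unit
    interval, and \<open>R \<ge> 4\<close> gives \<open>Y 0 \<ge> 16\<close>.\<close>
  obtain R where R: "R \<ge> 4" "R \<ge> 1" "\<And>b. integral {R..b} (\<lambda>x. \<omega> x / x) \<le> 1 / 48"
    using small_tail[of "1/48" 4] by auto
  define Y where "Y = (\<lambda>j. R ^ (2 ^ Suc j))"
  have YS: "Y (Suc j) = (Y j)\<^sup>2" for j by (simp add: Y_def power_mult[symmetric] mult.commute)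
  have Y0: "Y 0 = R\<^sup>2" by (simp add: Y_def)
  have "4 * 4 \<le> R * R" using R by (intro mult_mono) auto
  then have Y16: "Y 0 \<ge> 16" by (simp add: Y0 power2_eq_square)
  have YR: "Y j \<ge> R" for j
    unfolding Y_def using R(2) by (simp add: self_le_power)
  then have Y1: "Y j \<ge> 1" for j using R(2) order_trans by blast
  have Yle: "Y j \<le> Y (Suc j)" for j using Y1[of j] by (simp add: YS power2_eq_square mult_le_cancel_left1)
  define w where "w = (\<lambda>j. \<omega> (Y j))"
  have sum: "(\<Sum>i\<le>j. w i * ln (Y i)) \<le> 2 * integral {R..Y j} (\<lambda>x. \<omega> x / x)" for j
  proof (induction j)
    case 0
    have "ln (Y 0) = 2 * ln R" using R by (simp add: Y0 ln_realpow)
    then show ?case using ln_diff_le_integral[of R "Y 0"] R YR[of 0] by (simp add: w_def)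
  next
    case (Suc j)
    have "ln (Y (Suc j)) = 2 * ln (Y j)" using Y1[of j] by (simp add: YS ln_realpow)
    then have "w (Suc j) * ln (Y (Suc j)) \<le> 2 * integral {Y j..Y (Suc j)} (\<lambda>x. \<omega> x / x)"
      using ln_diff_le_integral[of "Y j" "Y (Suc j)"] Y1[of j] Yle[of j] by (simp add: w_def)
    moreover have "integral {R..Y j} (\<lambda>x. \<omega> x / x) + integral {Y j..Y (Suc j)} (\<lambda>x. \<omega> x / x)
       = integral {R..Y (Suc j)} (\<lambda>x. \<omega> x / x)"
      using YR[of j] Yle[of j] R(2) by (intro Henstock_Kurzweil_Integration.integral_combine integrable_on)
    ultimately show ?case using Suc by simp
  qed
  have len: "12 * (\<Sum>i\<le>j. w i * ln (Y i)) < 1 - 0" for j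
    using sum[of j] R(3)[of "Y j"] by simp
  have w: "1 / Y j \<le> w j" "w j \<le> 1" "w (Suc j) \<le> w j" for j
    using ge_inverse[of "Y j"] le_1[of "Y j"] antimono[of "Y j" "Y (Suc j)"] Y1[of j] Yle[of j]
    by (auto simp: w_def)
  have w0: "w j > 0" for j unfolding w_def using Y1[of j] by (intro pos) auto
  define k where "k = w 0 / 320"
  have k: "0 < k" "k \<le> 1" using w0[of 0] w(2)[of 0] by (auto simp: k_def)
  have Ybig: "Y j \<ge> 2 ^ Suc j" for j
  proof (induction j)
    case (Suc j)
    have "2 * 2 ^ Suc j \<le> Y j * Y j" using Suc YR[of j] R(1) by (intro mult_mono) auto
    then show ?case by (simp add: YS power2_eq_square)
  qed (use Y16 in auto)
  note descent = strip_class_descent[where Y = Y and w = w and k = k, OF Y16 YS w less_imp_le[OF k(1)] eq_refl[OF k_def]]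
  show ?thesis
  proof (rule that[of "w 0" k "Y 0"])
    show "0 < w 0" "w 0 \<le> 1" "0 < k" "k \<le> 1" "Y 0 \<ge> 1" using w0 w k Y1 by auto
  next
    fix X v p B N F
    assume S: "strip_class v p k 0 1 B N F" and p: "p < v" "p \<le> 0"
      and X: "Y 0 \<le> X" and v: "\<bar>v\<bar> \<le> \<omega> X" and B: "B \<le> exp (3 * X)"
    have "\<exists>j. X < Y j"
    proof -
      obtain n where "X < 2 ^ n" using real_arch_pow[of 2 X] by auto
      also have "(2::real) ^ n \<le> 2 ^ Suc n" by simp
      also have "\<dots> \<le> Y n" by (rule Ybig)
      finally show ?thesis by blast
    qed
    \<comment> \<open>For the predecessor \<open>i\<close> of the first scale above \<open>X\<close>
      one has \<open>Y i \<le> X < Y (Suc i)\<close>. The left inequality gives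
      \<open>\<bar>v\<bar> \<le> \<omega> X \<le> w i\<close>, the right one
      \<open>B \<le> exp (3 * Y (Suc i))\<close>.\<close>
    define j where "j = (LEAST j. X < Y j)"
    have j: "X < Y j" unfolding j_def by (rule LeastI_ex) fact
    then obtain i where i: "j = Suc i" using X by (cases j) auto
    have "\<not> X < Y i" using not_less_Least[of i "\<lambda>j. X < Y j"] i by (simp add: j_def)
    then have "\<bar>v\<bar> \<le> w i" using v antimono[of "Y i" X] Y1[of i] by (simp add: w_def)
    moreover have "B \<le> exp (3 * Y (Suc i))" using B j i by (elim order_trans) simp
    ultimately show "w 0 / 8 \<le> N"
      using descent[OF p(2,1) strip_class_mono_bound[OF S]] len by blast
  next
    fix v p N F
    assume S: "strip_class v p k 0 1 (1 + k / v) N F" and p: "p < v" "p \<le> 0" and v: "0 < v" "v \<le> w 0"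
    have "\<exists>j. w j < v"
    proof -
      obtain X where X: "X \<ge> 1" "\<omega> X \<le> v / 2" using exists_small[of "v / 2"] v by auto
      obtain n where "X < 2 ^ n" using real_arch_pow[of 2 X] by auto
      also have "(2::real) ^ n \<le> 2 ^ Suc n" by simp
      also have "\<dots> \<le> Y n" by (rule Ybig)
      finally have "w n \<le> \<omega> X" unfolding w_def using X by (intro antimono) auto
      then show ?thesis using X v by (intro exI[of _ n]) auto
    qed
    \<comment> \<open>Now the position of the line selects the scale:
      \<open>w i \<ge> v > w (Suc i) \<ge> 1 / Y (Suc i)\<close>, so \<open>k / v\<close> is below
      \<open>Y (Suc i)\<close>.\<close>
    define j where "j = (LEAST j. w j < v)"
    have j: "w j < v" unfolding j_def by (rule LeastI_ex) fact
    then obtain i where i: "j = Suc i" using v by (cases j) auto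
    have "\<not> w i < v" using not_less_Least[of i "\<lambda>j. w j < v"] i by (simp add: j_def)
    then have vi: "\<bar>v\<bar> \<le> w i" using v by simp
    have "1 / Y j < v" using w(1)[of j] j by linarith
    then have "1 / v < Y j" using v Y1[of j] by (simp add: field_simps)
    moreover have "k / v \<le> 1 / v" using k v by (intro divide_right_mono) auto
    moreover have "1 + Y j \<le> exp (3 * Y j)" using exp_ge_add_one_self[of "3 * Y j"] Y1[of j] by linarith
    ultimately have "1 + k / v \<le> exp (3 * Y (Suc i))" using i by simp
    then show "w 0 / 8 \<le> N"
      using descent[OF p(2,1) strip_class_mono_bound[OF S]] len vi by blast
  qed
qed

end

subsection \<open>The mollified zeta function\<close>

lemma zeta_upper_bound:
  obtains A where "A \<ge> 1"
    "\<And>s. 1/2 \<le> Re s \<Longrightarrow> Re s \<le> 2 \<Longrightarrow> 1/2 \<le> Im s \<Longrightarrow> norm (zeta s) \<le> A * (1 + Im s)"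
proof -
  define S where "S = (\<Sum>n. real (Suc n) powr (- (3/2)))"
  have S: "S \<ge> 0" unfolding S_def by (rule suminf_nonneg) (subst summable_Suc_powr, auto)
  show ?thesis
  proof (rule that[of "2 + 2 * S"])
    fix s assume s: "1/2 \<le> Re s" "Re s \<le> 2" "1/2 \<le> Im s"
    have n1: "norm (s - 1) \<ge> 1/2" using abs_Im_le_cmod[of "s - 1"] s by simp
    then have s1: "s \<noteq> 1" by auto
    have "norm s \<le> \<bar>Re s\<bar> + \<bar>Im s\<bar>" by (rule cmod_le)
    also have "\<dots> \<le> 2 + Im s" using s by simp
    finally have ns: "norm s \<le> 2 + Im s" .
    have "norm (s - 1) * norm (zeta s) \<le> 1 + norm s * norm (s - 1) * S"
      using norm_zeta_le[OF s(1) s1] unfolding S_def by (simp add: norm_mult)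
    also have "\<dots> \<le> norm (s - 1) * (2 + norm s * S)" using n1 by (simp add: algebra_simps)
    finally have "norm (zeta s) \<le> 2 + norm s * S" by (rule mult_left_le_imp_le) (use n1 in linarith)
    also have "\<dots> \<le> 2 + (2 + Im s) * S" using ns S by (simp add: mult_right_mono)
    also have "\<dots> \<le> (2 + 2 * S) * (1 + Im s)" using s S by (simp add: algebra_simps)
    finally show "norm (zeta s) \<le> (2 + 2 * S) * (1 + Im s)" .
  qed (use S in auto)
qed

text \<open>Far enough to the right the quotient is within 12 of 1. Otherwise \<open>s\<close> and
  \<open>s + r\<close> are mirror images in a line to the right of 1. The lower bound of order
  \<open>r\<close> beyond that line costs \<open>ln (1 / r)\<close>, but the exponent carries a
  factor \<open>r\<close>, and \<open>r * ln (1 / r) \<le> 1\<close>; so \<open>C\<close> is uniform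
  in \<open>r\<close>.\<close>

lemma zeta_shift_bound:
  obtains C where "C \<ge> 1"
    "\<And>r s. 0 < r \<Longrightarrow> r \<le> 1/4 \<Longrightarrow> 1 - r / 4 \<le> Re s \<Longrightarrow> Re s \<le> 2 \<Longrightarrow> 1 \<le> Im s \<Longrightarrow>
       norm (zeta s / zeta (s + of_real r)) \<le> C * exp (2 * r * ln (Im s))"
proof -
  obtain A where A: "A \<ge> 1"
    "\<And>s. 1/2 \<le> Re s \<Longrightarrow> Re s \<le> 2 \<Longrightarrow> 1/2 \<le> Im s \<Longrightarrow> norm (zeta s) \<le> A * (1 + Im s)"
    using zeta_upper_bound by blast
  obtain c where c: "c > 0" "\<And>s. Re s > 1 \<Longrightarrow> norm (zeta s) \<ge> c * ((Re s - 1) / Re s)"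
    using zeta_lower_bound by blast
  define E where "E = \<bar>ln (24 * A / c)\<bar>"
  show ?thesis
  proof (rule that[of "13 * exp (2 + E)"])
    show "13 * exp (2 + E) \<ge> 1"
      using exp_ge_add_one_self[of "2 + E"] by (simp add: E_def)
    fix r s
    assume r: "0 < r" "r \<le> 1/4" and s: "1 - r / 4 \<le> Re s" "Re s \<le> 2" "1 \<le> Im s"
    show "norm (zeta s / zeta (s + of_real r)) \<le> 13 * exp (2 + E) * exp (2 * r * ln (Im s))"
    proof (cases "Re s \<ge> 1 + r")
      case True
      have "norm (zeta s / zeta (s + of_real r) - 1) \<le> 12 * r / (Re s - 1)"
        using True r s by (intro zeta_ratio_bounds) auto
      also have "\<dots> \<le> 12" using True r by (simp add: divide_le_eq)
      finally have "norm (zeta s / zeta (s + of_real r)) \<le> 13"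
        using norm_triangle_sub[of "zeta s / zeta (s + of_real r)" 1] by simp
      also have "13 \<le> 13 * exp (2 + E)" by (simp add: E_def)
      also have "\<dots> \<le> 13 * exp (2 + E) * exp (2 * r * ln (Im s))" using r s by simp
      finally show ?thesis .
    next
      case False
      \<comment> \<open>The line midway between \<open>s\<close> and \<open>s + r\<close>. As
        \<open>Re s \<ge> 1 - r / 4\<close>, it is at least \<open>r / 4\<close> to the right of 1.
        The half-side \<open>1/2\<close> of the rectangle keeps \<open>Re\<close> and
        \<open>Im\<close> at least \<open>1/2\<close>, away from the pole.\<close>
      define \<beta> t where "\<beta> = Re s + r / 2" and "t = Im s"
      have \<beta>: "1 + r / 4 \<le> \<beta>" "\<beta> \<le> 11 / 8" using s r False by (auto simp: \<beta>_def)
      have t: "t \<ge> 1" using s by (simp add: t_def)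
      have "norm (zeta (Complex (\<beta> - r/2) t)) \<le> norm (zeta (Complex (\<beta> + r/2) t)) *
          exp (ln (A * (3 * t) / (c * (r / 8))) * (2 * (r/2) / (1/2)))"
      proof (rule reflection_bound[of zeta "{z. Im z > 0}"])
        show "zeta holomorphic_on {z. Im z > 0}" by (rule zeta_holomorphic) simp
        show "open {z. Im z > 0}" by (simp add: open_halfspace_Im_gt)
        show "Complex x y \<in> {z. Im z > 0}" if "\<bar>y - t\<bar> \<le> 1/2" for x y
          unfolding mem_Collect_eq complex.sel using that t by linarith
        show "norm (zeta (Complex x y)) \<le> A * (3 * t)"
          if "\<beta> - 1/2 \<le> x" "x \<le> \<beta>" "\<bar>y - t\<bar> \<le> 1/2" for x y
        proof -
          have y: "y \<le> t + 1/2" "y \<ge> t - 1/2" using that(3) by linarith+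
          have "norm (zeta (Complex x y)) \<le> A * (1 + Im (Complex x y))"
            using that(1,2) \<beta> y t r by (intro A(2)) auto
          also have "\<dots> \<le> A * (3 * t)" using y t A(1) by (intro mult_left_mono) auto
          finally show ?thesis .
        qed
        show "c * (r / 8) \<le> norm (zeta (Complex x y))"
          if "\<beta> \<le> x" "x \<le> \<beta> + 1/2" "\<bar>y - t\<bar> \<le> 1/2" for x y
        proof -
          have "(r / 4) / 2 \<le> (x - 1) / x" using that \<beta> r by (intro frac_le) auto
          then have "c * (r / 8) \<le> c * ((x - 1) / x)" using c(1) by (intro mult_left_mono) auto
          also have "\<dots> \<le> norm (zeta (Complex x y))" using c(2)[of "Complex x y"] that \<beta> r by simp
          finally show ?thesis .
        qed
      qed (use c r in auto)
      also have "Complex (\<beta> - r/2) t = s" by (simp add: \<beta>_def t_def complex_eq_iff)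
      also have "Complex (\<beta> + r/2) t = s + of_real r" by (simp add: \<beta>_def t_def complex_eq_iff)
      also have "ln (A * (3 * t) / (c * (r / 8))) * (2 * (r/2) / (1/2)) = 2 * r * ln (24 * A / c) + 2 * (r * ln (1 / r)) + 2 * r * ln t"
      proof -
        have "A * (3 * t) / (c * (r / 8)) = (24 * A / c) * (1 / r) * t" by (simp add: field_simps)
        also have "ln \<dots> = ln (24 * A / c) + ln (1 / r) + ln t"
        proof -
          have "24 * A / c > 0" "1 / r > 0" "t > 0" using A(1) c(1) r t by auto
          then show ?thesis by (simp only: ln_mult_pos mult_pos_pos)
        qed
        finally show ?thesis by (simp add: algebra_simps)
      qed
      finally have 1: "norm (zeta s) \<le> norm (zeta (s + of_real r)) * exp (2 * r * ln (24 * A / c) + 2 * (r * ln (1 / r)) + 2 * r * ln t)" .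
      have E1: "2 * r * ln (24 * A / c) \<le> 1 * E"
      proof -
        have "2 * r * ln (24 * A / c) \<le> 2 * r * E" using r by (intro mult_left_mono) (auto simp: E_def)
        also have "\<dots> \<le> 1 * E" using r by (intro mult_right_mono) (auto simp: E_def)
        finally show ?thesis .
      qed
      have "r * ln (1 / r) \<le> r * (1 / r - 1)" using r by (intro mult_left_mono ln_le_minus_one) auto
      moreover have "r * (1 / r - 1) = 1 - r" using r by (simp add: right_diff_distrib)
      ultimately have rl: "r * ln (1 / r) \<le> 1" using r by linarith
      from E1 rl have "2 * r * ln (24 * A / c) + 2 * (r * ln (1 / r)) + 2 * r * ln t \<le> (2 + E) + 2 * r * ln t" by linarith
      then have "exp (2 * r * ln (24 * A / c) + 2 * (r * ln (1 / r)) + 2 * r * ln t) \<le> exp ((2 + E) + 2 * r * ln t)"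
        by (simp only: exp_le_cancel_iff)
      also have "\<dots> = exp (2 + E) * exp (2 * r * ln t)" by (rule exp_add)
      also have "\<dots> \<le> 13 * exp (2 + E) * exp (2 * r * ln t)" by (intro mult_right_mono) auto
      finally have "exp (2 * r * ln (24 * A / c) + 2 * (r * ln (1 / r)) + 2 * r * ln t) \<le> 13 * exp (2 + E) * exp (2 * r * ln t)" .
      from mult_left_mono[OF this norm_ge_zero[of "zeta (s + of_real r)"]] 1
      have "norm (zeta s) \<le> norm (zeta (s + of_real r)) * (13 * exp (2 + E) * exp (2 * r * ln t))" by linarith
      then show ?thesis
        using r s c(1) by (cases "zeta (s + of_real r) = 0") (simp_all add: norm_divide divide_le_eq t_def mult.commute)
    qed
  qed
qed

lemma continuous_on_zeta_vertical: "T > 0 \<Longrightarrow> continuous_on {T..T'} (\<lambda>t. zeta (Complex \<sigma> t))"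
  by (rule continuous_on_compose2[OF holomorphic_on_imp_continuous_on[OF zeta_holomorphic[of "{z. Im z > 0}"]]])
     (auto intro!: continuous_intros simp: Complex_eq)

lemma integral_zeta_rescale:
  assumes "H > 0" "T > 0"
  shows "integral {T..T + H} (\<lambda>t. norm (zeta (Complex \<sigma> t))) = H * integral {0..1} (\<lambda>y. norm (zeta (Complex \<sigma> (T + H * y))))"
proof -
  have "((\<lambda>t. norm (zeta (Complex \<sigma> t))) has_integral integral {T..T + H} (\<lambda>t. norm (zeta (Complex \<sigma> t)))) (cbox T (T + H))"
    using assms by (simp add: integrable_integral integrable_continuous_real continuous_on_norm continuous_on_zeta_vertical)
  from has_integral_affinity'[OF this assms(1), of T]
  have "((\<lambda>y. norm (zeta (Complex \<sigma> (T + H * y)))) has_integral integral {T..T + H} (\<lambda>t. norm (zeta (Complex \<sigma> t))) / H) {0..1}"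
    using assms by (simp add: add.commute divide_inverse mult.commute)
  then show ?thesis using assms by (simp add: integral_unique)
qed

text \<open>
  The mollified function in the coordinate \<open>z\<close> with \<open>s = 1 + \<i> T + H z\<close>, so that the segment
  \<open>[T, T + H]\<close> becomes \<open>0 \<le> Im z \<le> 1\<close>.
\<close>

definition zeta_quot :: "real \<Rightarrow> real \<Rightarrow> real \<Rightarrow> complex \<Rightarrow> complex" where
  "zeta_quot r H T z = zeta (of_real H * z + Complex 1 T) / zeta (of_real H * z + Complex 1 T + of_real (r * H))"

lemma affine_Complex: "of_real H * Complex x y + Complex 1 T = Complex (1 + H * x) (T + H * y)"
  by (simp add: complex_eq_iff)

lemma zeta_nonzero: "Re s > 1 \<Longrightarrow> zeta s \<noteq> 0"
proof -
  assume s: "Re s > 1"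
  obtain c where "c > 0" "norm (zeta s) \<ge> c * ((Re s - 1) / Re s)"
    using zeta_lower_bound s by metis
  then have "norm (zeta s) > 0" using s by (smt (verit) divide_pos_pos mult_pos_pos)
  then show ?thesis by auto
qed

lemma holomorphic_zeta_quot:
  assumes "0 < H" "H \<le> 1" "T \<ge> 1"
  shows "zeta_quot r H T holomorphic_on {z. - r < Re z \<and> -1 < Im z \<and> Im z < b}"
proof -
  let ?S = "{z. - r < Re z \<and> -1 < Im z \<and> Im z < b}"
  have im: "Im (of_real H * z + Complex 1 T) > 0" if "z \<in> ?S" for z
  proof -
    have "H * (- 1) < H * Im z" using that assms by (intro mult_strict_left_mono) auto
    then show ?thesis using assms by simp
  qed
  have re: "Re (of_real H * z + Complex 1 T + of_real (r * H)) > 1" if "z \<in> ?S" for z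
  proof -
    have "H * (- r) < H * Re z" using that assms by (intro mult_strict_left_mono) auto
    then show ?thesis by (simp add: mult.commute)
  qed
  have "(\<lambda>z. zeta (of_real H * z + Complex 1 T)) holomorphic_on ?S"
    by (rule holomorphic_on_compose_gen[OF _ zeta_holomorphic[of "{z. Im z > 0}"], unfolded o_def])
       (use im in \<open>auto intro!: holomorphic_intros\<close>)
  moreover have "(\<lambda>z. zeta (of_real H * z + Complex 1 T + of_real (r * H))) holomorphic_on ?S"
    by (rule holomorphic_on_compose_gen[OF _ zeta_holomorphic[of "{z. Re z > 1}"], unfolded o_def])
       (use re in \<open>auto intro!: holomorphic_intros\<close>)
  ultimately show ?thesis
    unfolding zeta_quot_def using re by (intro holomorphic_on_divide) (auto intro!: zeta_nonzero)
qed

text \<open>\<open>zeta s\<close> is the quotient times \<open>zeta (s + r H)\<close>, whose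
  argument lies at least \<open>3 / 4 * (r * H)\<close> to the right of 1; this factor is of order
  at least \<open>r * H\<close>. Rescaling the segment contributes the second
  \<open>H\<close>.\<close>

lemma zeta_integral_ge_zeta_quot:
  obtains c where "c > 0"
   "\<And>H T r v. 0 < H \<Longrightarrow> H \<le> 1 \<Longrightarrow> T \<ge> 1 \<Longrightarrow> 0 < r \<Longrightarrow> r * H \<le> 1 \<Longrightarrow> - r / 4 \<le> v \<Longrightarrow> v \<le> 1 \<Longrightarrow>
      integral {T..T + H} (\<lambda>t. norm (zeta (Complex (1 + H * v) t)))
        \<ge> c * r * H\<^sup>2 * integral {0..1} (\<lambda>y. norm (zeta_quot r H T (Complex v y)))"
proof -
  obtain c where c: "c > 0" "\<And>s. Re s > 1 \<Longrightarrow> norm (zeta s) \<ge> c * ((Re s - 1) / Re s)"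
    using zeta_lower_bound by blast
  show ?thesis
  proof (rule that[of "c / 4"])
    show "c / 4 > 0" using c by simp
    fix H T r v :: real
    assume H: "0 < H" "H \<le> 1" and T: "T \<ge> 1" and r: "0 < r" "r * H \<le> 1" and v: "- r / 4 \<le> v" "v \<le> 1"
    define \<mu> where "\<mu> = c / 4 * r * H"
    have \<mu>: "\<mu> > 0" using c H r by (simp add: \<mu>_def)
    have le: "\<mu> * norm (zeta_quot r H T (Complex v y)) \<le> norm (zeta (Complex (1 + H * v) (T + H * y)))" for y
    proof -
      let ?s = "Complex (1 + H * v + r * H) (T + H * y)"
      have "H * (- r / 4) \<le> H * v" using v H by (intro mult_left_mono) auto
      then have re: "Re ?s - 1 \<ge> 3 / 4 * (r * H)" by (simp add: mult.commute)
      have "H * v \<le> 1 * 1" using v H by (intro order_trans[OF mult_left_mono[OF v(2)]]) auto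
      then have re2: "Re ?s \<le> 3" using r by simp
      have rH: "r * H > 0" using r H by simp
      have "r * H / 4 \<le> (Re ?s - 1) / Re ?s"
      proof -
        have "r * H / 4 = (3 / 4 * (r * H)) / 3" by simp
        also have "\<dots> \<le> (Re ?s - 1) / Re ?s" by (intro frac_le) (use re re2 rH in linarith)+
        finally show ?thesis .
      qed
      then have "c * (r * H / 4) \<le> c * ((Re ?s - 1) / Re ?s)" using c(1) by (intro mult_left_mono) auto
      also have "\<dots> \<le> norm (zeta ?s)" by (intro c(2)) (use re rH in linarith)
      finally have "\<mu> \<le> norm (zeta ?s)" by (simp add: \<mu>_def)
      moreover have "zeta_quot r H T (Complex v y) = zeta (Complex (1 + H * v) (T + H * y)) / zeta ?s"
      proof -
        have "Complex (1 + H * v) (T + H * y) + of_real (r * H) = ?s" by (simp add: complex_eq_iff)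
        then show ?thesis unfolding zeta_quot_def affine_Complex by simp
      qed
      ultimately show ?thesis using \<mu> by (simp add: norm_divide divide_le_eq mult_right_mono mult.commute[of _ "norm (zeta ?s)"]) 
    qed
    have cq: "continuous_on {0..1} (\<lambda>y. zeta_quot r H T (Complex v y))"
      by (rule continuous_on_strip_line[OF holomorphic_zeta_quot[OF H T, where b = 2]])
         (use v r in \<open>auto intro!: continuous_intros\<close>)
    have cz: "continuous_on {0..1} (\<lambda>y. zeta (Complex (1 + H * v) (T + H * y)))"
      by (rule continuous_on_compose2[OF continuous_on_zeta_vertical[of T "T + H"]])
         (use T H in \<open>auto intro!: continuous_intros simp: mult_left_le\<close>)
    have "\<mu> * integral {0..1} (\<lambda>y. norm (zeta_quot r H T (Complex v y))) = integral {0..1} (\<lambda>y. \<mu> * norm (zeta_quot r H T (Complex v y)))"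
      by simp
    also have "\<dots> \<le> integral {0..1} (\<lambda>y. norm (zeta (Complex (1 + H * v) (T + H * y))))"
      by (rule integral_le) (auto intro!: integrable_continuous_real continuous_intros cq cz le)
    finally have "H * (\<mu> * integral {0..1} (\<lambda>y. norm (zeta_quot r H T (Complex v y))))
       \<le> integral {T..T + H} (\<lambda>t. norm (zeta (Complex (1 + H * v) t)))"
      using H T by (subst integral_zeta_rescale) auto
    then show "c / 4 * r * H\<^sup>2 * integral {0..1} (\<lambda>y. norm (zeta_quot r H T (Complex v y)))
       \<le> integral {T..T + H} (\<lambda>t. norm (zeta (Complex (1 + H * v) t)))"
      by (simp add: \<mu>_def power2_eq_square mult_ac)
  qed
qed

text \<open>The shift and the distance from the line \<open>Re s = 1\<close> both scale with
  \<open>H\<close>, which therefore cancels. The reciprocal yields a lower bound at a single point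
  for the two-constants argument.\<close>

lemma zeta_quot_minus_1:
  assumes "0 < H" "H \<le> 1" "0 < r" "r * H \<le> 1" "0 < Re z" "H * Re z \<le> 1"
  shows "norm (zeta_quot r H T z - 1) \<le> 12 * r / Re z" "norm (1 / zeta_quot r H T z) \<le> 1 + 12 * r / Re z"
proof -
  let ?s = "of_real H * z + Complex 1 T"
  have s: "1 < Re ?s" "Re ?s \<le> 2" using assms by auto
  have rH: "0 < r * H" using assms by simp
  have eq: "12 * (r * H) / (Re ?s - 1) = 12 * r / Re z" using assms by simp
  show "norm (zeta_quot r H T z - 1) \<le> 12 * r / Re z"
    using zeta_ratio_bounds(1)[OF s rH assms(4)] unfolding eq zeta_quot_def .
  show "norm (1 / zeta_quot r H T z) \<le> 1 + 12 * r / Re z"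
    using zeta_ratio_bounds(2)[OF s rH assms(4)] unfolding eq zeta_quot_def by simp
qed

text \<open>The height is at most \<open>2 * T\<close>, and \<open>2 * r * H * ln 2 \<le> 1\<close>,
  so replacing it by \<open>T\<close> costs only a factor \<open>exp 1\<close>.\<close>

lemma zeta_quot_bound:
  obtains C where "C \<ge> 1"
   "\<And>H T r z. 0 < H \<Longrightarrow> H \<le> 1 \<Longrightarrow> T \<ge> 1 \<Longrightarrow> 0 < r \<Longrightarrow> r * H \<le> 1/4 \<Longrightarrow> - r / 4 \<le> Re z \<Longrightarrow> H * Re z \<le> 1 \<Longrightarrow>
      0 \<le> Im z \<Longrightarrow> Im z \<le> 1 \<Longrightarrow> norm (zeta_quot r H T z) \<le> C * exp (2 * r * (H * ln T))"
proof -
  obtain C where C: "C \<ge> 1"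
    "\<And>r s. 0 < r \<Longrightarrow> r \<le> 1/4 \<Longrightarrow> 1 - r / 4 \<le> Re s \<Longrightarrow> Re s \<le> 2 \<Longrightarrow> 1 \<le> Im s \<Longrightarrow>
       norm (zeta s / zeta (s + of_real r)) \<le> C * exp (2 * r * ln (Im s))"
    using zeta_shift_bound by blast
  show ?thesis
  proof (rule that[of "C * exp 1"])
    show "C * exp 1 \<ge> 1" using C(1) mult_mono[of 1 C 1 "exp 1"] by simp
    fix H T r :: real and z
    assume H: "0 < H" "H \<le> 1" and T: "T \<ge> 1" and r: "0 < r" "r * H \<le> 1/4"
      and z: "- r / 4 \<le> Re z" "H * Re z \<le> 1" "0 \<le> Im z" "Im z \<le> 1"
    let ?s = "of_real H * z + Complex 1 T"
    have "H * (- r / 4) \<le> H * Re z" using z H by (intro mult_left_mono) auto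
    moreover have Im: "1 \<le> Im ?s" "Im ?s \<le> 2 * T"
    proof -
      have "0 \<le> H * Im z" "H * Im z \<le> 1" using z H mult_mono[of H 1 "Im z" 1] by auto
      then show "1 \<le> Im ?s" "Im ?s \<le> 2 * T" using T by auto
    qed
    ultimately have "norm (zeta_quot r H T z) \<le> C * exp (2 * (r * H) * ln (Im ?s))"
      unfolding zeta_quot_def using z H r by (intro C(2)) (auto simp: mult.commute)
    also have "\<dots> \<le> C * (exp 1 * exp (2 * r * (H * ln T)))"
    proof (intro mult_left_mono)
      have "ln (Im ?s) \<le> ln (2 * T)" using Im by simp
      also have "\<dots> = ln 2 + ln T" using T by (simp add: ln_mult)
      also have "ln 2 \<le> (1::real)" using ln_le_minus_one[of 2] by simp
      finally have "ln (Im ?s) \<le> 1 + ln T" by simp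
      then have "2 * (r * H) * ln (Im ?s) \<le> 2 * (r * H) * (1 + ln T)" using r H by (intro mult_left_mono) auto
      also have "\<dots> \<le> 1 + 2 * r * (H * ln T)" using r by (simp add: algebra_simps)
      finally show "exp (2 * (r * H) * ln (Im ?s)) \<le> exp 1 * exp (2 * r * (H * ln T))" by (simp flip: exp_add)
    qed (use C in auto)
    finally show "norm (zeta_quot r H T z) \<le> C * exp 1 * exp (2 * r * (H * ln T))" by simp
  qed
qed

lemma strip_class_zeta_quot:
  assumes H: "0 < H" "H \<le> 1" and T: "T \<ge> 1" and r: "0 < r" "r \<le> 1/4" and v: "- r / 4 \<le> v" "v \<le> 1"
    and B: "\<And>z. v \<le> Re z \<Longrightarrow> Re z \<le> 1 \<Longrightarrow> 0 < Im z \<Longrightarrow> Im z < 1 \<Longrightarrow> norm (zeta_quot r H T z) \<le> B"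
  shows "strip_class v (- r) (12 * r) 0 1 B (integral {0..1} (\<lambda>y. norm (zeta_quot r H T (Complex v y)))) (zeta_quot r H T)"
  unfolding strip_class_def
proof (intro conjI allI impI)
  \<comment> \<open>The wider strip gives continuity up to the ends of \<open>{0..1}\<close>, so the
    integral over the closed segment dominates those over its parts.\<close>
  have h2: "zeta_quot r H T holomorphic_on {z. - r < Re z \<and> -1 < Im z \<and> Im z < 2}"
    by (rule holomorphic_zeta_quot[OF H T])
  then show "zeta_quot r H T holomorphic_on {z. - r < Re z \<and> 0 < Im z \<and> Im z < 1}"
    by (rule holomorphic_on_subset) auto
  show "norm (zeta_quot r H T z) \<le> B" if "v \<le> Re z \<and> Re z \<le> 1 \<and> 0 < Im z \<and> Im z < 1" for z
    using B that by blast
  show "norm (zeta_quot r H T z - 1) \<le> 12 * r / Re z" if "0 < Re z \<and> Re z \<le> 1 \<and> 0 < Im z \<and> Im z < 1" for z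
    using that H r mult_mono[of H 1 "Re z" 1] mult_mono[of r "1" H 1] by (intro zeta_quot_minus_1(1)) auto
  fix a b :: real assume ab: "0 < a \<and> a \<le> b \<and> b < 1"
  have "continuous_on {0..1} (\<lambda>y. zeta_quot r H T (Complex v y))"
    by (rule continuous_on_strip_line[OF h2]) (use v r in \<open>auto intro!: continuous_intros\<close>)
  then show "integral {a..b} (\<lambda>y. norm (zeta_quot r H T (Complex v y))) \<le> integral {0..1} (\<lambda>y. norm (zeta_quot r H T (Complex v y)))"
    using ab by (intro integral_subset_le integrable_continuous_real continuous_on_norm)
      (auto elim: continuous_on_subset)
qed

text \<open>For \<open>v > w\<close> the pointwise lower bound for \<open>zeta\<close> suffices, for
  \<open>0 < v \<le> w\<close> the descent starts from closeness to 1, and for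
  \<open>v \<le> 0\<close> from the growth bound, for which \<open>H * ln T\<close> has to be
  large.\<close>

lemma (in decay_function) zeta_integral_bound_large:
  obtains c X1 where "c > 0" "X1 \<ge> 1"
    "\<And>H T v. 0 < H \<Longrightarrow> H \<le> 1 \<Longrightarrow> T \<ge> 1 \<Longrightarrow> 0 < v \<or> X1 \<le> H * ln T \<Longrightarrow> - \<omega> (H * ln T) \<le> v \<Longrightarrow>
       integral {T..T + H} (\<lambda>t. norm (zeta (Complex (1 + H * v) t))) \<ge> c * H\<^sup>2"
proof -
  obtain w k X0 where wk: "0 < w" "w \<le> 1" "0 < k" "k \<le> 1" "X0 \<ge> 1"
    and st1: "\<And>X v p B N F. strip_class v p k 0 1 B N F \<Longrightarrow> p < v \<Longrightarrow> p \<le> 0 \<Longrightarrow> X \<ge> X0 \<Longrightarrow> \<bar>v\<bar> \<le> \<omega> X \<Longrightarrow> B \<le> exp (3 * X)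
       \<Longrightarrow> N \<ge> w / 8"
    and st2: "\<And>v p N F. strip_class v p k 0 1 (1 + k / v) N F \<Longrightarrow> p < v \<Longrightarrow> p \<le> 0 \<Longrightarrow> 0 < v \<Longrightarrow> v \<le> w
       \<Longrightarrow> N \<ge> w / 8"
    using strip_lower_bound by blast
  obtain c0 where c0: "c0 > 0" "\<And>s. Re s > 1 \<Longrightarrow> norm (zeta s) \<ge> c0 * ((Re s - 1) / Re s)"
    using zeta_lower_bound by blast
  obtain c1 where c1: "c1 > 0"
   "\<And>H T r v. 0 < H \<Longrightarrow> H \<le> 1 \<Longrightarrow> T \<ge> 1 \<Longrightarrow> 0 < r \<Longrightarrow> r * H \<le> 1 \<Longrightarrow> - r / 4 \<le> v \<Longrightarrow> v \<le> 1 \<Longrightarrow>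
      integral {T..T + H} (\<lambda>t. norm (zeta (Complex (1 + H * v) t)))
        \<ge> c1 * r * H\<^sup>2 * integral {0..1} (\<lambda>y. norm (zeta_quot r H T (Complex v y)))"
    using zeta_integral_ge_zeta_quot by blast
  obtain C where C: "C \<ge> 1"
   "\<And>H T r z. 0 < H \<Longrightarrow> H \<le> 1 \<Longrightarrow> T \<ge> 1 \<Longrightarrow> 0 < r \<Longrightarrow> r * H \<le> 1/4 \<Longrightarrow> - r / 4 \<le> Re z \<Longrightarrow> H * Re z \<le> 1 \<Longrightarrow>
      0 \<le> Im z \<Longrightarrow> Im z \<le> 1 \<Longrightarrow> norm (zeta_quot r H T z) \<le> C * exp (2 * r * (H * ln T))"
    using zeta_quot_bound by blast
  define r where "r = k / 12"
  have r: "0 < r" "r \<le> 1/4" and kr: "12 * r = k" using wk by (auto simp: r_def)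
  \<comment> \<open>\<open>\<omega> X2 \<le> r / 4\<close> keeps the line inside the region of the
    growth bound, and \<open>ln C \<le> X2\<close> lets \<open>exp (3 * X)\<close> absorb the
    constant \<open>C\<close>.\<close>
  obtain X2 where X2: "X2 \<ge> max X0 (ln C)" "X2 \<ge> 1" "\<omega> X2 \<le> r / 4"
    using exists_small[of "r / 4" "max X0 (ln C)"] r by auto
  define c where "c = min (c0 * w / 2) (c1 * r * (w / 8))"
  show ?thesis
  proof (rule that[of c X2])
    show "c > 0" using c0 c1 wk r by (simp add: c_def)
    show "X2 \<ge> 1" by (rule X2)
    fix H T v :: real
    assume H: "0 < H" "H \<le> 1" and T: "T \<ge> 1" and cs: "0 < v \<or> X2 \<le> H * ln T"
      and v: "- \<omega> (H * ln T) \<le> v"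
    define I where "I = integral {T..T + H} (\<lambda>t. norm (zeta (Complex (1 + H * v) t)))"
    define N where "N = integral {0..1} (\<lambda>y. norm (zeta_quot r H T (Complex v y)))"
    have rH: "r * H \<le> 1/4" using r H mult_mono[of r "1/4" H 1] by simp
    have Hx: "H * x \<le> 1" if "x \<le> 1" for x
      using that H mult_left_mono[of x 1 H] by linarith
    have fin: "c * H\<^sup>2 \<le> I" if "N \<ge> w / 8" "- r / 4 \<le> v" "v \<le> 1"
    proof -
      have "c * H\<^sup>2 \<le> (c1 * r * (w / 8)) * H\<^sup>2" by (intro mult_right_mono) (auto simp: c_def)
      also have "\<dots> = c1 * r * H\<^sup>2 * (w / 8)" by simp
      also have "\<dots> \<le> c1 * r * H\<^sup>2 * N" using that c1 r by (intro mult_left_mono) auto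
      also have "\<dots> \<le> I" unfolding I_def N_def using that H T r rH by (intro c1(2)) auto
      finally show ?thesis .
    qed
    consider "v > w" | "0 < v" "v \<le> w" | "v \<le> 0" "X2 \<le> H * ln T" using cs by linarith
    then have "c * H\<^sup>2 \<le> I"
    proof cases
      case 1
      have "c0 * (w / 2 * H) \<le> norm (zeta (Complex (1 + H * v) t))" for t
      proof -
        have "w * H \<le> H * v" using 1 H by (simp add: mult.commute)
        moreover have "w * H \<le> 1" using wk H by (simp add: mult_le_one)
        moreover have "w * H > 0" using wk H by simp
        moreover have "w * H * (1 + H * v) \<le> 2 * (H * v)"
        proof -
          have "w * H * (H * v) \<le> 1 * (H * v)" using calculation by (intro mult_right_mono) auto
          then show ?thesis using calculation by (simp add: algebra_simps)
        qed
        ultimately have "w / 2 * H \<le> (H * v) / (1 + H * v)" by (simp add: field_simps)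
        then have "c0 * (w / 2 * H) \<le> c0 * ((H * v) / (1 + H * v))" using c0(1) by (intro mult_left_mono) auto
        also have "\<dots> \<le> norm (zeta (Complex (1 + H * v) t))"
          using c0(2)[of "Complex (1 + H * v) t"] \<open>w * H \<le> H * v\<close> \<open>w * H > 0\<close> by simp
        finally show ?thesis .
      qed
      then have "integral {T..T + H} (\<lambda>t. c0 * (w / 2 * H)) \<le> I"
        unfolding I_def using T
        by (intro integral_le) (auto intro!: integrable_continuous_real continuous_intros continuous_on_zeta_vertical)
      then have "(c0 * w / 2) * H\<^sup>2 \<le> I" using H by (simp add: power2_eq_square mult_ac)
      moreover have "c * H\<^sup>2 \<le> (c0 * w / 2) * H\<^sup>2" by (intro mult_right_mono) (auto simp: c_def)
      ultimately show ?thesis by linarith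
    next
      case 2
      have "strip_class v (- r) k 0 1 (1 + k / v) N (zeta_quot r H T)"
        unfolding N_def kr[symmetric]
      proof (rule strip_class_zeta_quot[OF H T r])
        fix z assume z: "v \<le> Re z" "Re z \<le> 1" "0 < Im z" "Im z < 1"
        have "norm (zeta_quot r H T z - 1) \<le> 12 * r / Re z"
          using z 2 H r rH Hx by (intro zeta_quot_minus_1(1)) auto
        also have "\<dots> \<le> 12 * r / v" using z 2 r by (intro divide_left_mono) auto
        finally show "norm (zeta_quot r H T z) \<le> 1 + 12 * r / v"
          using norm_triangle_sub[of "zeta_quot r H T z" 1] by simp
      qed (use 2 r wk in auto)
      then have "N \<ge> w / 8" using 2 r by (intro st2[of v "- r" N "zeta_quot r H T"]) auto
      then show ?thesis using 2 r wk by (intro fin) auto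
    next
      case 3
      let ?X = "H * ln T"
      have "\<omega> ?X \<le> \<omega> X2" using 3 X2 by (intro antimono) auto
      then have v4: "- r / 4 \<le> v" using v X2(3) by linarith
      have "strip_class v (- r) (12 * r) 0 1 (C * exp (2 * r * ?X)) N (zeta_quot r H T)"
        unfolding N_def
      proof (rule strip_class_zeta_quot[OF H T r v4])
        fix z assume z: "v \<le> Re z" "Re z \<le> 1" "0 < Im z" "Im z < 1"
        show "norm (zeta_quot r H T z) \<le> C * exp (2 * r * ?X)"
          by (rule C(2)[OF H T r(1) rH]) (use z v4 Hx[OF z(2)] in linarith)+
      qed (use 3 in simp)
      moreover have "C * exp (2 * r * ?X) \<le> exp (3 * ?X)"
      proof -
        have "C = exp (ln C)" using C(1) by simp
        also have "\<dots> \<le> exp ?X" using 3 X2 by simp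
        finally have "C * exp (2 * r * ?X) \<le> exp ?X * exp (2 * r * ?X)" by (intro mult_right_mono) auto
        also have "\<dots> = exp (?X + 2 * r * ?X)" by (simp add: exp_add)
        also have "?X + 2 * r * ?X \<le> 3 * ?X"
          using 3 X2 r mult_right_mono[of r 1 ?X] by simp
        finally show ?thesis by simp
      qed
      ultimately have "N \<ge> w / 8"
        using 3 v v4 r X2 by (intro st1[of v "- r" _ N "zeta_quot r H T" ?X]) (auto simp: kr)
      then show ?thesis using 3 v4 by (intro fin) auto
    qed
    then show "c * H\<^sup>2 \<le> integral {T..T + H} (\<lambda>t. norm (zeta (Complex (1 + H * v) t)))"
      by (simp add: I_def)
  qed
qed

text \<open>With bounded \<open>H * ln T\<close> no closeness to 1 on a small scale is required, so
  the shift can be generous: \<open>r = 4\<close> makes \<open>Re z \<ge> - r / 4\<close> cover all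
  \<open>v \<ge> -1\<close>, at the price of \<open>H \<le> 1/16\<close>. For larger
  \<open>H\<close> the two-constants argument applies to \<open>zeta\<close> itself.\<close>

lemma zeta_integral_bound_bounded:
  obtains c where "c > 0"
    "\<And>H T v. 0 < H \<Longrightarrow> H \<le> 1 \<Longrightarrow> T \<ge> 1 \<Longrightarrow> H * ln T \<le> X1 \<Longrightarrow> -1 \<le> v \<Longrightarrow> v \<le> 0 \<Longrightarrow>
       integral {T..T + H} (\<lambda>t. norm (zeta (Complex (1 + H * v) t))) \<ge> c * H\<^sup>2"
proof -
  obtain c0 where c0: "c0 > 0" "\<And>s. Re s > 1 \<Longrightarrow> norm (zeta s) \<ge> c0 * ((Re s - 1) / Re s)"
    using zeta_lower_bound by blast
  obtain c1 where c1: "c1 > 0"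
   "\<And>H T r v. 0 < H \<Longrightarrow> H \<le> 1 \<Longrightarrow> T \<ge> 1 \<Longrightarrow> 0 < r \<Longrightarrow> r * H \<le> 1 \<Longrightarrow> - r / 4 \<le> v \<Longrightarrow> v \<le> 1 \<Longrightarrow>
      integral {T..T + H} (\<lambda>t. norm (zeta (Complex (1 + H * v) t)))
        \<ge> c1 * r * H\<^sup>2 * integral {0..1} (\<lambda>y. norm (zeta_quot r H T (Complex v y)))"
    using zeta_integral_ge_zeta_quot by blast
  obtain C where C: "C \<ge> 1"
   "\<And>H T r z. 0 < H \<Longrightarrow> H \<le> 1 \<Longrightarrow> T \<ge> 1 \<Longrightarrow> 0 < r \<Longrightarrow> r * H \<le> 1/4 \<Longrightarrow> - r / 4 \<le> Re z \<Longrightarrow> H * Re z \<le> 1 \<Longrightarrow>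
      0 \<le> Im z \<Longrightarrow> Im z \<le> 1 \<Longrightarrow> norm (zeta_quot r H T z) \<le> C * exp (2 * r * (H * ln T))"
    using zeta_quot_bound by blast
  obtain d1 where d1: "d1 > 0" and tc1: "\<And>f U x0. f holomorphic_on U \<Longrightarrow> open U \<Longrightarrow> convex U \<Longrightarrow>
      (\<And>x y. x0 \<le> x \<Longrightarrow> x \<le> x0 + 3 \<Longrightarrow> 0 \<le> y \<Longrightarrow> y \<le> 1 \<Longrightarrow> Complex x y \<in> U \<and> norm (f (Complex x y)) \<le> C * exp (8 * X1)) \<Longrightarrow>
      1/49 \<le> norm (f (Complex (x0 + 2) (1/2))) \<Longrightarrow>
      integral {0..1} (\<lambda>y. norm (f (Complex x0 y))) \<ge> d1"
    using two_constants[of "1/49" "C * exp (8 * X1)"] by auto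
  \<comment> \<open>For \<open>H > 1/16\<close> one has \<open>ln T \<le> 16 * X1\<close>, so
    \<open>zeta\<close> is only evaluated on a fixed compact rectangle with
    \<open>Im s \<ge> 1\<close>, away from the pole.\<close>
  define T1 where "T1 = exp (16 * X1)"
  have "continuous_on (cbox (Complex 0 1) (Complex 4 (T1 + 1))) zeta"
    by (intro holomorphic_on_imp_continuous_on zeta_holomorphic) (auto simp: in_cbox_complex_iff)
  then have "bounded (zeta ` cbox (Complex 0 1) (Complex 4 (T1 + 1)))"
    by (intro compact_imp_bounded compact_continuous_image compact_cbox)
  then obtain B where B: "\<And>s. s \<in> cbox (Complex 0 1) (Complex 4 (T1 + 1)) \<Longrightarrow> norm (zeta s) \<le> B"
    by (auto simp: bounded_iff)
  obtain d2 where d2: "d2 > 0" and tc2: "\<And>f U x0. f holomorphic_on U \<Longrightarrow> open U \<Longrightarrow> convex U \<Longrightarrow>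
      (\<And>x y. x0 \<le> x \<Longrightarrow> x \<le> x0 + 3 \<Longrightarrow> 0 \<le> y \<Longrightarrow> y \<le> 1 \<Longrightarrow> Complex x y \<in> U \<and> norm (f (Complex x y)) \<le> B) \<Longrightarrow>
      c0 / 48 \<le> norm (f (Complex (x0 + 2) (1/2))) \<Longrightarrow>
      integral {0..1} (\<lambda>y. norm (f (Complex x0 y))) \<ge> d2"
    using two_constants[of "c0 / 48" B] c0(1) by auto
  define c where "c = min (c1 * 4 * d1) d2"
  show ?thesis
  proof (rule that[of c])
    show "c > 0" using c1 d1 d2 by (simp add: c_def)
    fix H T v :: real
    assume H: "0 < H" "H \<le> 1" and T: "T \<ge> 1" and X: "H * ln T \<le> X1" and v: "-1 \<le> v" "v \<le> 0"
    show "c * H\<^sup>2 \<le> integral {T..T + H} (\<lambda>t. norm (zeta (Complex (1 + H * v) t)))"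
    proof (cases "H \<le> 1/16")
      case True
      have Hx: "H * x \<le> 1" if "x \<le> 3" for x
        using that H True mult_left_mono[of x 3 H] by linarith
      have "d1 \<le> integral {0..1} (\<lambda>y. norm (zeta_quot 4 H T (Complex v y)))"
      proof (rule tc1)
        show "zeta_quot 4 H T holomorphic_on {z. - 4 < Re z \<and> -1 < Im z \<and> Im z < 2}"
          by (rule holomorphic_zeta_quot[OF H T])
        show "open {z. - 4 < Re z \<and> -1 < Im z \<and> Im z < 2}" by (rule open_strip)
        show "convex {z. - 4 < Re z \<and> -1 < Im z \<and> Im z < 2}" by (rule convex_strip)
        fix x y :: real assume xy: "v \<le> x" "x \<le> v + 3" "0 \<le> y" "y \<le> 1"
        have "norm (zeta_quot 4 H T (Complex x y)) \<le> C * exp (2 * 4 * (H * ln T))"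
          using xy v H T True Hx by (intro C(2)) auto
        also have "\<dots> \<le> C * exp (8 * X1)" using X C(1) by (intro mult_left_mono) auto
        finally show "Complex x y \<in> {z. - 4 < Re z \<and> -1 < Im z \<and> Im z < 2} \<and> norm (zeta_quot 4 H T (Complex x y)) \<le> C * exp (8 * X1)"
          using xy v by simp
      next
        \<comment> \<open>At \<open>Re z = v + 2 \<ge> 1\<close> the reciprocal is at most
          \<open>1 + 12 * 4 = 49\<close>, the source of the constant \<open>1/49\<close>.\<close>
        have "norm (1 / zeta_quot 4 H T (Complex (v + 2) (1/2))) \<le> 1 + 12 * 4 / Re (Complex (v + 2) (1/2))"
          using v H True Hx by (intro zeta_quot_minus_1(2)) auto
        also have "\<dots> \<le> 49" using v by (simp add: divide_le_eq)
        finally have le: "1 / norm (zeta_quot 4 H T (Complex (v + 2) (1/2))) \<le> 49" by (simp add: norm_divide)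
        have "zeta_quot 4 H T (Complex (v + 2) (1/2)) \<noteq> 0"
        proof -
          have "H * v \<ge> - H" using v H mult_left_mono[of "-1" v H] by simp
          then have "1 < 1 + H * (v + 2)" using H by (simp add: algebra_simps)
          then show ?thesis
            unfolding zeta_quot_def affine_Complex divide_eq_0_iff using H zeta_nonzero by simp
        qed
        then show "1/49 \<le> norm (zeta_quot 4 H T (Complex (v + 2) (1/2)))"
          using le by (simp add: field_simps)
      qed
      then have "c1 * 4 * H\<^sup>2 * d1 \<le> c1 * 4 * H\<^sup>2 * integral {0..1} (\<lambda>y. norm (zeta_quot 4 H T (Complex v y)))"
        using c1 by (intro mult_left_mono) auto
      also have "\<dots> \<le> integral {T..T + H} (\<lambda>t. norm (zeta (Complex (1 + H * v) t)))"
        using H T v True by (intro c1(2)) auto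
      finally have "(c1 * 4 * d1) * H\<^sup>2 \<le> integral {T..T + H} (\<lambda>t. norm (zeta (Complex (1 + H * v) t)))"
        by (simp add: mult_ac)
      moreover have "c * H\<^sup>2 \<le> (c1 * 4 * d1) * H\<^sup>2" by (intro mult_right_mono) (auto simp: c_def)
      ultimately show ?thesis by linarith
    next
      case False
      have "1/16 * ln T \<le> H * ln T" using False T by (intro mult_right_mono) auto
      then have "ln T \<le> 16 * X1" using X by simp
      then have TT: "T \<le> T1" 
        using exp_le_cancel_iff[of "ln T" "16 * X1"] T by (simp add: T1_def)
      let ?f = "\<lambda>z. zeta (of_real H * z + Complex 1 T)"
      have "d2 \<le> integral {0..1} (\<lambda>y. norm (?f (Complex v y)))"
      proof (rule tc2)
        show "?f holomorphic_on {z. - 4 < Re z \<and> -1 < Im z \<and> Im z < 2}"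
        proof (rule holomorphic_on_compose_gen[OF _ zeta_holomorphic[of "{z. Im z > 0}"], unfolded o_def])
          show "(\<lambda>z. of_real H * z + Complex 1 T) ` {z. - 4 < Re z \<and> -1 < Im z \<and> Im z < 2} \<subseteq> {z. Im z > 0}"
          proof safe
            fix z assume "-1 < Im z"
            then have "H * (- 1) < H * Im z" using H by (intro mult_strict_left_mono) auto
            then show "Im (of_real H * z + Complex 1 T) > 0" using H T by simp
          qed
        qed (auto intro!: holomorphic_intros)
        show "open {z. - 4 < Re z \<and> -1 < Im z \<and> Im z < 2}" by (rule open_strip)
        show "convex {z. - 4 < Re z \<and> -1 < Im z \<and> Im z < 2}" by (rule convex_strip)
        fix x y :: real assume xy: "v \<le> x" "x \<le> v + 3" "0 \<le> y" "y \<le> 1"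
        have "H * x \<ge> -1" using mult_left_mono[of "-1" x H] xy v H by simp
        moreover have "H * x \<le> 3" using mult_left_mono[of x 3 H] xy v H by linarith
        moreover have "0 \<le> H * y" "H * y \<le> 1" using xy H mult_mono[of H 1 y 1] by auto
        ultimately have "norm (?f (Complex x y)) \<le> B"
          unfolding affine_Complex using T TT by (intro B) (auto simp: in_cbox_complex_iff)
        then show "Complex x y \<in> {z. - 4 < Re z \<and> -1 < Im z \<and> Im z < 2} \<and> norm (?f (Complex x y)) \<le> B"
          using xy v by simp
      next
        define x where "x = H * (v + 2)"
        have x: "1/16 \<le> x" "x \<le> 2"
          using mult_mono[of "1/16" H 1 "v + 2"] mult_mono[of H 1 "v + 2" 2] v H False by (auto simp: x_def)
        have "c0 / 48 \<le> c0 * (x / (1 + x))"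
        proof -
          have "(1/16) / 3 \<le> x / (1 + x)" using x by (intro frac_le) auto
          from mult_left_mono[OF this, of c0] show ?thesis using c0(1) by simp
        qed
        also have "\<dots> \<le> norm (?f (Complex (v + 2) (1/2)))"
          unfolding affine_Complex x_def[symmetric] using c0(2)[of "Complex (1 + x) (T + H * (1/2))"] x by simp
        finally show "c0 / 48 \<le> norm (?f (Complex (v + 2) (1/2)))" .
      qed
      then have "d2 \<le> integral {0..1} (\<lambda>y. norm (zeta (Complex (1 + H * v) (T + H * y))))"
        unfolding affine_Complex .
      then have "H * d2 \<le> integral {T..T + H} (\<lambda>t. norm (zeta (Complex (1 + H * v) t)))"
        using H T by (subst integral_zeta_rescale) auto
      moreover have "c * H\<^sup>2 \<le> d2 * H"
        using H d2 by (intro mult_mono) (auto simp: c_def power2_eq_square mult_left_le)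
      ultimately show ?thesis by (simp add: mult.commute)
    qed
  qed
qed

text \<open>In terms of \<open>v = (\<sigma> - 1) / H\<close> the hypothesis reads
  \<open>v \<ge> - \<omega> (H * ln T)\<close>. As \<open>\<omega> \<le> 1\<close>, this implies
  \<open>v \<ge> -1\<close>, so the bounded case covers whatever is neither to the right of 1 nor
  has large \<open>H * ln T\<close>.\<close>

lemma (in decay_function) zeta_integral_lower_bound:
  obtains c where "c > 0"
    "\<And>H T \<sigma>. 0 < H \<Longrightarrow> H \<le> 1 \<Longrightarrow> T \<ge> 1 \<Longrightarrow> \<sigma> \<ge> 1 - H * \<omega> (H * ln T) \<Longrightarrow>
       integral {T..T + H} (\<lambda>t. norm (zeta (Complex \<sigma> t))) \<ge> c * H\<^sup>2"
proof -
  obtain c1 X1 where c1: "c1 > 0" "X1 \<ge> 1"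
    "\<And>H T v. 0 < H \<Longrightarrow> H \<le> 1 \<Longrightarrow> T \<ge> 1 \<Longrightarrow> 0 < v \<or> X1 \<le> H * ln T \<Longrightarrow> - \<omega> (H * ln T) \<le> v \<Longrightarrow>
       integral {T..T + H} (\<lambda>t. norm (zeta (Complex (1 + H * v) t))) \<ge> c1 * H\<^sup>2"
    using zeta_integral_bound_large by blast
  obtain c2 where c2: "c2 > 0"
    "\<And>H T v. 0 < H \<Longrightarrow> H \<le> 1 \<Longrightarrow> T \<ge> 1 \<Longrightarrow> H * ln T \<le> X1 \<Longrightarrow> -1 \<le> v \<Longrightarrow> v \<le> 0 \<Longrightarrow>
       integral {T..T + H} (\<lambda>t. norm (zeta (Complex (1 + H * v) t))) \<ge> c2 * H\<^sup>2"
    using zeta_integral_bound_bounded[of X1] by blast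
  show ?thesis
  proof (rule that[of "min c1 c2"])
    show "min c1 c2 > 0" using c1 c2 by simp
    fix H T \<sigma> :: real
    assume H: "0 < H" "H \<le> 1" and T: "T \<ge> 1" and \<sigma>: "\<sigma> \<ge> 1 - H * \<omega> (H * ln T)"
    define v where "v = (\<sigma> - 1) / H"
    have \<sigma>v: "\<sigma> = 1 + H * v" using H by (simp add: v_def)
    have "H * (- \<omega> (H * ln T)) \<le> H * v" using \<sigma> by (simp add: \<sigma>v)
    then have v: "- \<omega> (H * ln T) \<le> v" using H by (simp only: mult_le_cancel_left_pos)
    have "\<omega> (H * ln T) \<le> 1" using H T by (intro le_1) auto
    then have v1: "-1 \<le> v" using v by linarith
    have "c1 * H\<^sup>2 \<ge> min c1 c2 * H\<^sup>2" "c2 * H\<^sup>2 \<ge> min c1 c2 * H\<^sup>2"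
      by (auto intro!: mult_right_mono)
    then show "min c1 c2 * H\<^sup>2 \<le> integral {T..T + H} (\<lambda>t. norm (zeta (Complex \<sigma> t)))"
      unfolding \<sigma>v using c1(3)[OF H T _ v] c2(2)[OF H T _ v1]
      by (cases "0 < v \<or> X1 \<le> H * ln T") fastforce+
  qed
qed

theorem theorem4:
  fixes \<omega> :: "real \<Rightarrow> real"
  assumes "\<And>x. x \<ge> 0 \<Longrightarrow> \<omega> x > 0"
    and "\<And>x. 0 \<le> x \<Longrightarrow> x \<le> 1 \<Longrightarrow> \<omega> x = 1"
    and "mono_on {1..} (\<lambda>x. x * \<omega> x)"
    and "mono_on {1..} (\<lambda>x. 1 / \<omega> x)"
    and "set_integrable lborel {1..} (\<lambda>x. \<omega> x / x)"
  shows "\<exists>c>0. \<forall>H T \<sigma> :: real. 0 < H \<longrightarrow> H \<le> 1 \<longrightarrow> T \<ge> 1 \<longrightarrow>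
           \<sigma> \<ge> 1 - H * \<omega> (H * ln T) \<longrightarrow>
           integral {T..T + H} (\<lambda>t. norm (zeta (Complex \<sigma> t)))
             \<ge> c * (H ^ 2 * \<omega> \<bar>ln H\<bar> / (1 + \<bar>ln H\<bar>))"
proof -
  interpret decay_function \<omega> by (rule decay_function.intro) (fact assms)+
  obtain c where c: "c > 0"
    "\<And>H T \<sigma>. 0 < H \<Longrightarrow> H \<le> 1 \<Longrightarrow> T \<ge> 1 \<Longrightarrow> \<sigma> \<ge> 1 - H * \<omega> (H * ln T) \<Longrightarrow>
       integral {T..T + H} (\<lambda>t. norm (zeta (Complex \<sigma> t))) \<ge> c * H\<^sup>2"
    using zeta_integral_lower_bound by blast
  have "c * (H\<^sup>2 * \<omega> \<bar>ln H\<bar> / (1 + \<bar>ln H\<bar>)) \<le> integral {T..T + H} (\<lambda>t. norm (zeta (Complex \<sigma> t)))"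
    if H: "0 < H" "H \<le> 1" "T \<ge> 1" "\<sigma> \<ge> 1 - H * \<omega> (H * ln T)" for H T \<sigma>
  proof -
    \<comment> \<open>The numerator is at most 1 and the denominator at least 1, so the bound by
      \<open>H\<^sup>2\<close> is the stronger one.\<close>
    have "\<omega> \<bar>ln H\<bar> / (1 + \<bar>ln H\<bar>) \<le> 1"
      using le_1[of "\<bar>ln H\<bar>"] by (intro divide_le_eq_1_pos[THEN iffD2]) linarith+
    then have "H\<^sup>2 * (\<omega> \<bar>ln H\<bar> / (1 + \<bar>ln H\<bar>)) \<le> H\<^sup>2 * 1" by (intro mult_left_mono) auto
    then have "c * (H\<^sup>2 * \<omega> \<bar>ln H\<bar> / (1 + \<bar>ln H\<bar>)) \<le> c * H\<^sup>2"
      using c(1) mult_left_mono[of "H\<^sup>2 * (\<omega> \<bar>ln H\<bar> / (1 + \<bar>ln H\<bar>))" "H\<^sup>2 * 1" c] by simp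
    also have "\<dots> \<le> integral {T..T + H} (\<lambda>t. norm (zeta (Complex \<sigma> t)))" by (rule c(2)[OF H])
    finally show ?thesis .
  qed
  with c(1) show ?thesis by blast
qed

end
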